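(* Let $X_t=\int_{-\infty}^tK(t,s)\sigma_s\,dB_s$, $t\in\mathbb{R}$, be a volatility modulated Volterra process on the real line with kernel $K$ (satisfying the standing assumptions on $K$ and $\sigma$ given in the context). Let $\lambda>0$ and set $f_{t,\lambda}(s):=e^{-\lambda(t-s)}$ for $s\le t$. Suppose that for every $t\ge0$: (a) for almost all $s<t$, $\lim_{u\downarrow s}[f_{t,\lambda}(u)-f_{t,\lambda}(s)]K(u,s)=0$; (b) $\int_{-\infty}^t\left(\int_{-\infty}^sK(s,r)^2\,dr\right)^{1/2}d|f_{t,\lambda}|(s)<\infty$, where $d|f_{t,\lambda}|(s)=\lambda e^{-\lambda(t-s)}\,ds$ is the total variation measure of $f_{t,\lambda}$. Then the process $$Z_t:=\int_{-\infty}^te^{-\lambda(t-s)}\,dX_s,\qquad t\ge0,$$ is the unique solution (up to a modification) of the Langevin equation with respect to $X$ with parameter $\lambda>0$ and initial condition $\xi=-\lambda\int_{-\infty}^0e^{\lambda u}X_u\,du$.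
   Context: $(\Omega,\mathcal{F},(\mathcal{F}_t)_{t\in\mathbb{R}},\mathbb{P})$ is a filtered probability space satisfying the usual conditions. $B=(B_t)_{t\in\mathbb{R}}$ is a two-sided Brownian motion on it: a continuous centered Gaussian process with $B_0=0$ such that for all $t\ge 0$, $s\in\mathbb{R}$, $B_{t+s}-B_s$ has variance $t$, is $\mathcal{F}_{t+s}$-measurable and is independent of $\mathcal{F}_s$. Standing assumptions: $K:\mathbb{R}^2\to\mathbb{R}$ is measurable with $K(t,s)=0$ for $s>t$; $\int_{-\infty}^tK^2(t,s)\,ds<\infty$ for every $t\in\mathbb{R}$; $t\mapsto K(t,s)$ is continuously differentiable on $(s,\infty)$ for almost all $s$; $K(0,s)=0$ for almost all $s$; and $K(t,\cdot)\to K(u,\cdot)$ in $\mathcal{L}^2(ds)$ as $t\to u$, for every $u$. The process $\sigma$ is adapted, càglàd (left-continuous with right limits) and satisfies $\sup_t\mathbb{E}(\sigma_t^2)<\infty$. A volatility modulated Volterra process is a process $X_t=\int_{-\infty}^tK(t,s)\sigma_s\,dB_s$ of this form (Itô integral); it is continuous in probability, and a measurable modification is used. Wiener-type integral: for measurable $f$ and $s<t$ put $$\mathcal{K}_Kf(t,s):=f(s)K(t,s)+\int_s^t[f(u)-f(s)]\frac{\partial}{\partial u}K(u,s)\,du,$$ $$\mathcal{H}_t^K:=\{f\text{ measurable}:\ \mathcal{K}_Kf(t,\cdot)\in\mathcal{L}^2((-\infty,t])\},$$ and for $f\in\mathcal{H}_t^K$ define $\int_{-\infty}^tf(s)\,dX_s:=\int_{-\infty}^t\mathcal{K}_Kf(t,s)\,\sigma_s\,dB_s$.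 Langevin equation: a process $(Z_t)_{t\ge0}$ solves the Langevin equation with parameter $\lambda>0$ with respect to $X$ and with initial condition $\xi$ (an $\mathcal{F}_0$-measurable random variable) if for every $t\ge0$, almost surely, $Z_t=\xi+X_t-\lambda\int_0^tZ_s\,ds$. *)

theory Defs
  imports "HOL-Probability.Probability"
begin

section \<open>Filtered probability spaces and Brownian motion on the line\<close>

definition measurable_process ::
  "'a measure \<Rightarrow> real set \<Rightarrow> (real \<Rightarrow> 'a \<Rightarrow> real) \<Rightarrow> bool" where
  "measurable_process M T X \<longleftrightarrow>
     (\<lambda>(t, \<omega>). X t \<omega>) \<in> borel_measurable (restrict_space borel T \<Otimes>\<^sub>M M)"

locale usual_filtered_prob_space =
  prob_space M + complete_measure M + filtration "space M" F
  for M :: "'a measure" and F :: "real \<Rightarrow> 'a measure" +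
  assumes sets_F_subset: "sets (F t) \<subseteq> sets M"
    and null_sets_F: "null_sets M \<subseteq> sets (F t)"
    and right_continuous_F: "sets (F t) = (\<Inter>u\<in>{t<..}. sets (F u))"

text \<open>A point mass at 0 counts as a (degenerate) centered Gaussian law.\<close>

definition centered_gaussian :: "'a measure \<Rightarrow> ('a \<Rightarrow> real) \<Rightarrow> bool" where
  "centered_gaussian M Y \<longleftrightarrow> Y \<in> borel_measurable M \<and>
     ((AE \<omega> in M. Y \<omega> = 0) \<or> (\<exists>v>0. distributed M lborel Y (normal_density 0 v)))"

definition centered_gaussian_process :: "'a measure \<Rightarrow> (real \<Rightarrow> 'a \<Rightarrow> real) \<Rightarrow> bool" where
  "centered_gaussian_process M B \<longleftrightarrow>
     (\<forall>J c. finite J \<longrightarrow> centered_gaussian M (\<lambda>\<omega>. \<Sum>t\<in>J. c t * B t \<omega>))"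

text \<open>Only the increments are adapted: \<open>B t\<close> itself is not \<open>F t\<close>-measurable for \<open>t < 0\<close>.\<close>

locale two_sided_brownian_motion = usual_filtered_prob_space M F
  for M :: "'a measure" and F :: "real \<Rightarrow> 'a measure" +
  fixes B :: "real \<Rightarrow> 'a \<Rightarrow> real"
  assumes continuous_paths: "\<omega> \<in> space M \<Longrightarrow> continuous_on UNIV (\<lambda>t. B t \<omega>)"
    and gaussian: "centered_gaussian_process M B"
    and start_zero: "\<omega> \<in> space M \<Longrightarrow> B 0 \<omega> = 0"
    and increment_variance: "t \<ge> 0 \<Longrightarrow> variance (\<lambda>\<omega>. B (t + s) \<omega> - B s \<omega>) = t"
    and increment_measurable:
      "t \<ge> 0 \<Longrightarrow> (\<lambda>\<omega>. B (t + s) \<omega> - B s \<omega>) \<in> borel_measurable (F (t + s))"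
    and increment_independent:
      "t \<ge> 0 \<Longrightarrow> indep_set (sets (F s))
         (sets (vimage_algebra (space M) (\<lambda>\<omega>. B (t + s) \<omega> - B s \<omega>) borel))"


section \<open>The Ito integral over the line\<close>

text \<open>
  The elementary process given by \<open>n\<close>, \<open>\<tau>\<close>, \<open>h\<close> takes the value \<open>h i\<close> on
  \<open>(\<tau> i, \<tau> (i + 1)]\<close> for \<open>i < n\<close> and vanishes elsewhere.
\<close>

definition elementary_integrand ::
  "'a measure \<Rightarrow> (real \<Rightarrow> 'a measure) \<Rightarrow> nat \<Rightarrow> (nat \<Rightarrow> real) \<Rightarrow> (nat \<Rightarrow> 'a \<Rightarrow> real) \<Rightarrow> bool" where
  "elementary_integrand M F n \<tau> h \<longleftrightarrow>
     (\<forall>i<n. \<tau> i < \<tau> (Suc i) \<and> h i \<in> borel_measurable (F (\<tau> i)) \<and> bounded (h i ` space M))"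

definition elementary_process ::
  "nat \<Rightarrow> (nat \<Rightarrow> real) \<Rightarrow> (nat \<Rightarrow> 'a \<Rightarrow> real) \<Rightarrow> real \<Rightarrow> 'a \<Rightarrow> real" where
  "elementary_process n \<tau> h s \<omega> = (\<Sum>i<n. h i \<omega> * indicator {\<tau> i<..\<tau> (Suc i)} s)"

definition elementary_ito ::
  "(real \<Rightarrow> 'a \<Rightarrow> real) \<Rightarrow> nat \<Rightarrow> (nat \<Rightarrow> real) \<Rightarrow> (nat \<Rightarrow> 'a \<Rightarrow> real) \<Rightarrow> 'a \<Rightarrow> real" where
  "elementary_ito B n \<tau> h \<omega> = (\<Sum>i<n. h i \<omega> * (B (\<tau> (Suc i)) \<omega> - B (\<tau> i) \<omega>))"

text \<open>
  \<open>has_ito_integral M F B \<phi> I\<close>: the process \<open>\<phi>\<close> lies in the closure of the elementary processes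
  in \<open>L\<^sup>2(ds \<otimes> M)\<close>, and the random variable \<open>I\<close> is a version of its Ito integral over the
  whole line, i.e. the \<open>L\<^sup>2(M)\<close>-limit of the elementary integrals. By the Ito isometry
  \<open>I\<close> is unique up to null sets. Integrands matter only up to \<open>ds \<otimes> M\<close>-null sets, hence the
  completion. Integrals over \<open>(-\<infinity>, t]\<close> are obtained by multiplying with an indicator.
\<close>

definition has_ito_integral ::
  "'a measure \<Rightarrow> (real \<Rightarrow> 'a measure) \<Rightarrow> (real \<Rightarrow> 'a \<Rightarrow> real) \<Rightarrow> (real \<Rightarrow> 'a \<Rightarrow> real) \<Rightarrow>
   ('a \<Rightarrow> real) \<Rightarrow> bool" where
  "has_ito_integral M F B \<phi> I \<longleftrightarrow>
     (\<lambda>(s, \<omega>). \<phi> s \<omega>) \<in> borel_measurable (completion (lborel \<Otimes>\<^sub>M M)) \<and>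
     I \<in> borel_measurable M \<and>
     (\<exists>n \<tau> h.
        (\<forall>k. elementary_integrand M F (n k) (\<tau> k) (h k)) \<and>
        (\<lambda>k. \<integral>\<^sup>+(s, \<omega>). ennreal ((elementary_process (n k) (\<tau> k) (h k) s \<omega> - \<phi> s \<omega>)\<^sup>2)
               \<partial>completion (lborel \<Otimes>\<^sub>M M)) \<longlonglongrightarrow> 0 \<and>
        (\<lambda>k. \<integral>\<^sup>+\<omega>. ennreal ((elementary_ito B (n k) (\<tau> k) (h k) \<omega> - I \<omega>)\<^sup>2) \<partial>M) \<longlonglongrightarrow> 0)"


section \<open>Volatility modulated Volterra processes\<close>

locale volterra_kernel =
  fixes K :: "real \<Rightarrow> real \<Rightarrow> real"
  assumes measurable_K: "(\<lambda>(t, s). K t s) \<in> borel_measurable borel"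
    and causal: "s > t \<Longrightarrow> K t s = 0"
    and square_integrable: "set_integrable lborel {..t} (\<lambda>s. (K t s)\<^sup>2)"
    and continuously_differentiable:
      "AE s in lborel. (\<lambda>t. K t s) C1_differentiable_on {s<..}"
    and zero_at_origin: "AE s in lborel. K 0 s = 0"
    and L2_continuous:
      "((\<lambda>t. \<integral>\<^sup>+s. ennreal ((K t s - K u s)\<^sup>2) \<partial>lborel) \<longlongrightarrow> 0) (at u)"

definition caglad :: "(real \<Rightarrow> real) \<Rightarrow> bool" where
  "caglad x \<longleftrightarrow>
     (\<forall>t. (x \<longlongrightarrow> x t) (at_left t) \<and> (\<exists>l. (x \<longlongrightarrow> l) (at_right t)))"

definition volatility_process ::
  "'a measure \<Rightarrow> (real \<Rightarrow> 'a measure) \<Rightarrow> (real \<Rightarrow> 'a \<Rightarrow> real) \<Rightarrow> bool" where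
  "volatility_process M F \<sigma> \<longleftrightarrow>
     (\<forall>t. \<sigma> t \<in> borel_measurable (F t)) \<and>
     (\<forall>\<omega>\<in>space M. caglad (\<lambda>t. \<sigma> t \<omega>)) \<and>
     (SUP t. \<integral>\<^sup>+\<omega>. ennreal ((\<sigma> t \<omega>)\<^sup>2) \<partial>M) < \<infinity>"

text \<open>
  Each \<open>X t\<close> is determined by the Ito integral only up to a null set; as usual the version is
  chosen jointly measurable, so that pathwise Lebesgue integrals of \<open>X\<close> make sense.
\<close>

definition vmv_process ::
  "'a measure \<Rightarrow> (real \<Rightarrow> 'a measure) \<Rightarrow> (real \<Rightarrow> 'a \<Rightarrow> real) \<Rightarrow> (real \<Rightarrow> real \<Rightarrow> real) \<Rightarrow>
   (real \<Rightarrow> 'a \<Rightarrow> real) \<Rightarrow> (real \<Rightarrow> 'a \<Rightarrow> real) \<Rightarrow> bool" where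
  "vmv_process M F B K \<sigma> X \<longleftrightarrow>
     measurable_process M UNIV X \<and>
     (\<forall>t. has_ito_integral M F B (\<lambda>s \<omega>. indicator {..t} s * (K t s * \<sigma> s \<omega>)) (X t))"


section \<open>The Wiener-type integral\<close>

text \<open>
  The integral over \<open>u\<close> is the gauge (Henstock-Kurzweil) integral. It agrees with the Lebesgue
  integral whenever the latter exists, and it also covers integrals that exist only improperly at
  the lower endpoint \<open>s\<close>, where \<open>\<partial>K(u,s)/\<partial>u\<close> may be singular.
\<close>

definition \<K> :: "(real \<Rightarrow> real \<Rightarrow> real) \<Rightarrow> (real \<Rightarrow> real) \<Rightarrow> real \<Rightarrow> real \<Rightarrow> real" where
  "\<K> K f t s = f s * K t s + integral {s..t} (\<lambda>u. (f u - f s) * deriv (\<lambda>v. K v s) u)"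

definition \<H> :: "(real \<Rightarrow> real \<Rightarrow> real) \<Rightarrow> real \<Rightarrow> (real \<Rightarrow> real) set" where
  "\<H> K t = {f. f \<in> borel_measurable borel \<and>
     (AE s in lborel. s < t \<longrightarrow> (\<lambda>u. (f u - f s) * deriv (\<lambda>v. K v s) u) integrable_on {s..t}) \<and>
     \<K> K f t \<in> borel_measurable (lebesgue_on {..t}) \<and>
     integrable (lebesgue_on {..t}) (\<lambda>s. (\<K> K f t s)\<^sup>2)}"

text \<open>\<open>I\<close> is a version of the integral of \<open>f\<close> over \<open>(-\<infinity>, t]\<close> with respect to the process \<open>X\<close>
  given by \<open>B\<close>, \<open>K\<close> and \<open>\<sigma>\<close>.\<close>

definition has_vmv_integral ::
  "'a measure \<Rightarrow> (real \<Rightarrow> 'a measure) \<Rightarrow> (real \<Rightarrow> 'a \<Rightarrow> real) \<Rightarrow> (real \<Rightarrow> real \<Rightarrow> real) \<Rightarrow>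
   (real \<Rightarrow> 'a \<Rightarrow> real) \<Rightarrow> real \<Rightarrow> (real \<Rightarrow> real) \<Rightarrow> ('a \<Rightarrow> real) \<Rightarrow> bool" where
  "has_vmv_integral M F B K \<sigma> t f I \<longleftrightarrow> f \<in> \<H> K t \<and>
     has_ito_integral M F B (\<lambda>s \<omega>. indicator {..t} s * (\<K> K f t s * \<sigma> s \<omega>)) I"


section \<open>The Langevin equation\<close>

definition langevin_integrand :: "real \<Rightarrow> real \<Rightarrow> real \<Rightarrow> real" where
  "langevin_integrand l t s = exp (- l * (t - s))"

text \<open>
  The total variation measure of the (increasing) function \<open>langevin_integrand l t\<close>.
\<close>

definition langevin_variation :: "real \<Rightarrow> real \<Rightarrow> real measure" where
  "langevin_variation l t = density lborel (\<lambda>s. ennreal (l * exp (- l * (t - s))))"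

text \<open>
  \<open>Z\<close> is a jointly measurable version of the process
  \<open>t \<mapsto> \<integral>\<^bsub>-\<infinity>\<^esub>\<^bsup>t\<^esup> exp (- l * (t - s)) dX\<^sub>s\<close>, \<open>t \<ge> 0\<close>.
\<close>

definition exp_integral_process ::
  "'a measure \<Rightarrow> (real \<Rightarrow> 'a measure) \<Rightarrow> (real \<Rightarrow> 'a \<Rightarrow> real) \<Rightarrow> (real \<Rightarrow> real \<Rightarrow> real) \<Rightarrow>
   (real \<Rightarrow> 'a \<Rightarrow> real) \<Rightarrow> real \<Rightarrow> (real \<Rightarrow> 'a \<Rightarrow> real) \<Rightarrow> bool" where
  "exp_integral_process M F B K \<sigma> l Z \<longleftrightarrow>
     measurable_process M {0..} Z \<and>
     (\<forall>t\<ge>0. has_vmv_integral M F B K \<sigma> t (langevin_integrand l t) (Z t))"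

text \<open>
  Joint measurability of \<open>Z\<close> is part of the notion of solution, because the pathwise integral
  of \<open>Z\<close> is not invariant under modification without it.
\<close>

definition langevin_solution ::
  "'a measure \<Rightarrow> (real \<Rightarrow> 'a measure) \<Rightarrow> real \<Rightarrow> (real \<Rightarrow> 'a \<Rightarrow> real) \<Rightarrow> ('a \<Rightarrow> real) \<Rightarrow>
   (real \<Rightarrow> 'a \<Rightarrow> real) \<Rightarrow> bool" where
  "langevin_solution M F l X \<xi> Z \<longleftrightarrow>
     \<xi> \<in> borel_measurable (F 0) \<and> measurable_process M {0..} Z \<and>
     (\<forall>t\<ge>0. AE \<omega> in M. set_integrable lborel {0..t} (\<lambda>s. Z s \<omega>) \<and>
        Z t \<omega> = \<xi> \<omega> + X t \<omega> - l * (LINT s:{0..t}|lborel. Z s \<omega>))"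

end

theory Submission
  imports Defs
begin

text \<open>
  Integration by parts turns the kernel of \<open>\<integral>\<^bsub>-\<infinity>\<^esub>\<^bsup>t\<^esup> exp(-l(t - s)) dX\<^sub>s\<close> into
  \<open>K(t, s) - \<integral>\<^bsub>s\<^esub>\<^bsup>t\<^esup> l exp(-l(t - u)) K(u, s) du\<close>; the boundary term at \<open>s\<close> is the one that the
  first condition on the kernel kills (\<open>\<K>_langevin_integrand\<close>). A stochastic Fubini theorem
  (\<open>stochastic_Fubini\<close>) exchanges \<open>du\<close> and \<open>dB\<^sub>s\<close>, so that almost surely
  \<open>Z t = X t - \<integral>\<^bsub>-\<infinity>\<^esub>\<^bsup>t\<^esup> l exp(-l(t - u)) X u du\<close>. From there on the argument is pathwise: an
  ordinary exchange of integrals shows that this expression solves the Langevin equation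
  (\<open>langevin_path\<close>), and the difference of two solutions with the same initial value vanishes
  because its primitive \<open>G\<close> satisfies \<open>G' = -l G\<close>, \<open>G 0 = 0\<close> (\<open>langevin_path_unique\<close>). Identities
  that hold at each time almost surely pass to almost every time, almost surely, by Fubini and
  joint measurability.

  The stochastic Fubini theorem only concerns the family \<open>u \<mapsto> K(u, \<cdot>)\<close>, which is a continuous curve
  in \<open>L\<^sup>2(ds)\<close>. It can therefore be approximated by step functions with finitely many values, and for
  step functions the theorem is the linearity of the Ito integral. The errors, both of the
  integrands and of the integrals, are controlled by Minkowski's integral inequality together with
  the bound \<open>E I\<^sup>2 \<le> 4 \<parallel>\<phi>\<parallel>\<^sup>2\<close> for the Ito integral \<open>I\<close> of \<open>\<phi>\<close>. The second condition on the kernel says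
  exactly that \<open>u \<mapsto> K(u, \<cdot>)\<close> has integrable \<open>L\<^sup>2\<close> norm with respect to \<open>l exp(-l(t - u)) du\<close>.

  The Ito integral itself is given only as an \<open>L\<^sup>2\<close> limit of elementary integrals, so its linearity,
  its uniqueness and the measurability of the integral over \<open>(-\<infinity>, t]\<close> with respect to \<open>F t\<close> are
  derived from the isometry for elementary processes, using common refinements of partitions.
\<close>

section \<open>Weighted Cauchy-Schwarz and Minkowski inequalities\<close>

text \<open>
  Writing the square as a double integral, this is the arithmetic-geometric mean inequality
  \<open>2 h(x) h(y) \<le> h(x)\<^sup>2 d(y) / d(x) + d(x) h(y)\<^sup>2 / d(y)\<close>.
\<close>

lemma nn_integral_Cauchy_Schwarz_weight:
  fixes h d :: "'b \<Rightarrow> real"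
  assumes [measurable]: "h \<in> borel_measurable N" "d \<in> borel_measurable N"
    and h: "\<And>x. 0 \<le> h x" and d: "\<And>x. 0 < d x"
  shows "(\<integral>\<^sup>+x. h x \<partial>N)\<^sup>2 \<le> (\<integral>\<^sup>+x. d x \<partial>N) * (\<integral>\<^sup>+x. (h x)\<^sup>2 / d x \<partial>N)"
proof -
  have "(\<integral>\<^sup>+x. h x \<partial>N)\<^sup>2 = (\<integral>\<^sup>+x. \<integral>\<^sup>+y. ennreal (h x) * ennreal (h y) \<partial>N \<partial>N)"
    by (simp add: power2_eq_square nn_integral_cmult nn_integral_multc)
  also have "\<dots> \<le> (\<integral>\<^sup>+x. \<integral>\<^sup>+y. ennreal (1/2) * (ennreal ((h x)\<^sup>2 / d x) * ennreal (d y)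
      + ennreal (d x) * ennreal ((h y)\<^sup>2 / d y)) \<partial>N \<partial>N)"
  proof (intro nn_integral_mono)
    fix x y
    have gen: "ennreal (p * (a * b + e * f)) = ennreal p * (ennreal a * ennreal b + ennreal e * ennreal f)"
      if "p \<ge> 0" "a \<ge> 0" "b \<ge> 0" "e \<ge> 0" "f \<ge> 0" for p a b e f
      using that by (simp add: ennreal_mult ennreal_plus)
    have dd: "d x > 0" "d y > 0" using d by auto
    have "(h x * d y - h y * d x)\<^sup>2 \<ge> 0" by simp
    then have "2 * (h x * d y) * (h y * d x) \<le> (h x * d y)\<^sup>2 + (h y * d x)\<^sup>2"
      by (simp add: power2_diff algebra_simps)
    moreover have "(h x)\<^sup>2 / d x * d y + d x * ((h y)\<^sup>2 / d y)
        = ((h x * d y)\<^sup>2 + (h y * d x)\<^sup>2) / (d x * d y)"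
      using dd by (simp add: field_simps power2_eq_square)
    moreover have "2 * (h x * h y) = 2 * (h x * d y) * (h y * d x) / (d x * d y)"
      using dd by (simp add: field_simps)
    ultimately have "2 * (h x * h y) \<le> (h x)\<^sup>2 / d x * d y + d x * ((h y)\<^sup>2 / d y)"
      using dd by (metis divide_right_mono mult_pos_pos order_less_imp_le)
    then have "h x * h y \<le> (1/2) * ((h x)\<^sup>2 / d x * d y + d x * ((h y)\<^sup>2 / d y))"
      by simp
    then have "ennreal (h x * h y) \<le> ennreal ((1/2) * ((h x)\<^sup>2 / d x * d y + d x * ((h y)\<^sup>2 / d y)))"
      by (rule ennreal_leI)
    also have "\<dots> = ennreal (1/2) * (ennreal ((h x)\<^sup>2 / d x) * ennreal (d y)
      + ennreal (d x) * ennreal ((h y)\<^sup>2 / d y))"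
      using dd by (intro gen) auto
    finally show "ennreal (h x) * ennreal (h y) \<le> \<dots>"
      using h by (simp add: ennreal_mult)
  qed
  also have "\<dots> = ennreal (1/2) * ((\<integral>\<^sup>+x. d x \<partial>N) * (\<integral>\<^sup>+x. (h x)\<^sup>2 / d x \<partial>N)
      + (\<integral>\<^sup>+x. d x \<partial>N) * (\<integral>\<^sup>+x. (h x)\<^sup>2 / d x \<partial>N))"
    by (simp add: nn_integral_cmult nn_integral_multc nn_integral_add mult.commute)
  also have "\<dots> = (\<integral>\<^sup>+x. d x \<partial>N) * (\<integral>\<^sup>+x. (h x)\<^sup>2 / d x \<partial>N)"
  proof -
    have "ennreal (1/2) * (a + a) = a" for a
    proof -
      have "ennreal (1/2) * (a + a) = ennreal (1/2) * (ennreal 2 * a)" by (simp add: mult_2)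
      also have "\<dots> = (ennreal (1/2) * ennreal 2) * a" by (simp only: mult.assoc)
      also have "ennreal (1/2) * ennreal 2 = 1" by (subst ennreal_mult[symmetric]) auto
      finally show ?thesis by simp
    qed
    then show ?thesis .
  qed
  finally show ?thesis .
qed

text \<open>
  Minkowski's integral inequality with an explicit majorant \<open>sqrt c * d\<close> of the norms
  \<open>\<parallel>h u\<parallel>\<close> in \<open>L\<^sup>2(P)\<close>.
\<close>

lemma nn_integral_Minkowski_square:
  fixes h :: "'b \<Rightarrow> 'c \<Rightarrow> real" and d :: "'b \<Rightarrow> real" and c :: real
  assumes "sigma_finite_measure N" "sigma_finite_measure P"
    and h_meas: "(\<lambda>(u, y). h u y) \<in> borel_measurable (N \<Otimes>\<^sub>M P)"
    and [measurable]: "d \<in> borel_measurable N"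
    and d: "\<And>u. 0 < d u" and c: "0 \<le> c"
    and bound: "AE u in N. (\<integral>\<^sup>+y. (h u y)\<^sup>2 \<partial>P) \<le> ennreal (c * (d u)\<^sup>2)"
  shows "(\<integral>\<^sup>+y. (\<integral>\<^sup>+u. \<bar>h u y\<bar> \<partial>N)\<^sup>2 \<partial>P) \<le> ennreal c * (\<integral>\<^sup>+u. d u \<partial>N)\<^sup>2"
proof -
  interpret N: sigma_finite_measure N by fact
  interpret P: sigma_finite_measure P by fact
  interpret NP: pair_sigma_finite N P by unfold_locales
  note [measurable] = h_meas
  have "(\<integral>\<^sup>+y. (\<integral>\<^sup>+u. \<bar>h u y\<bar> \<partial>N)\<^sup>2 \<partial>P)
      \<le> (\<integral>\<^sup>+y. (\<integral>\<^sup>+u. d u \<partial>N) * (\<integral>\<^sup>+u. \<bar>h u y\<bar>\<^sup>2 / d u \<partial>N) \<partial>P)"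
  proof (intro nn_integral_mono nn_integral_Cauchy_Schwarz_weight)
    fix y assume [measurable]: "y \<in> space P"
    show "(\<lambda>u. \<bar>h u y\<bar>) \<in> borel_measurable N" by measurable
  qed (auto simp: d)
  also have "\<dots> = (\<integral>\<^sup>+u. d u \<partial>N) * (\<integral>\<^sup>+y. \<integral>\<^sup>+u. (h u y)\<^sup>2 / d u \<partial>N \<partial>P)"
    by (subst nn_integral_cmult) auto
  also have "(\<integral>\<^sup>+y. \<integral>\<^sup>+u. (h u y)\<^sup>2 / d u \<partial>N \<partial>P) = (\<integral>\<^sup>+u. \<integral>\<^sup>+y. (h u y)\<^sup>2 / d u \<partial>P \<partial>N)"
    by (rule NP.Fubini') measurable
  also have "\<dots> \<le> (\<integral>\<^sup>+u. ennreal c * ennreal (d u) \<partial>N)"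
  proof (rule nn_integral_mono_AE, use bound AE_space in eventually_elim)
    case (elim u)
    note [measurable] = \<open>u \<in> space N\<close>
    have "(\<integral>\<^sup>+y. (h u y)\<^sup>2 / d u \<partial>P) = (\<integral>\<^sup>+y. ennreal (1 / d u) * ennreal ((h u y)\<^sup>2) \<partial>P)"
      using d[of u] by (intro nn_integral_cong) (simp add: ennreal_mult[symmetric])
    also have "\<dots> = ennreal (1 / d u) * (\<integral>\<^sup>+y. (h u y)\<^sup>2 \<partial>P)"
      by (rule nn_integral_cmult) measurable
    also have "\<dots> \<le> ennreal (1 / d u) * ennreal (c * (d u)\<^sup>2)"
      using elim by (intro mult_left_mono) auto
    also have "\<dots> = ennreal (c * d u)"
      using d[of u] c by (subst ennreal_mult[symmetric]) (auto simp: power2_eq_square)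
    finally show ?case using d[of u] c by (simp add: ennreal_mult)

  qed
  also have "\<dots> = ennreal c * (\<integral>\<^sup>+u. d u \<partial>N)" by (rule nn_integral_cmult) measurable
  finally show ?thesis
    by (simp add: power2_eq_square mult_left_mono mult.left_commute)
qed

section \<open>The Ito isometry for elementary processes\<close>

context usual_filtered_prob_space
begin

lemma borel_measurable_of_F:
  fixes f :: "'a \<Rightarrow> real"
  assumes "f \<in> borel_measurable (F t)"
  shows "f \<in> borel_measurable M"
  by (rule measurable_from_subalg[OF _ assms]) (simp add: subalgebra_def space_F sets_F_subset)

lemma borel_measurable_F_mono:
  fixes f :: "'a \<Rightarrow> real"
  assumes "f \<in> borel_measurable (F s)" "s \<le> t"
  shows "f \<in> borel_measurable (F t)"
  by (rule measurable_from_subalg[OF _ assms(1)])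
    (simp add: subalgebra_def space_F sets_F_mono assms(2))

end

context two_sided_brownian_motion
begin

lemma increment_measurable_F:
  "s \<le> u \<Longrightarrow> (\<lambda>\<omega>. B u \<omega> - B s \<omega>) \<in> borel_measurable (F u)"
  using increment_measurable[of "u - s" s] by simp

lemma increment_measurable_M [measurable]: "(\<lambda>\<omega>. B u \<omega> - B s \<omega>) \<in> borel_measurable M"
proof (cases "s \<le> u")
  case True
  then show ?thesis using increment_measurable_F borel_measurable_of_F by blast
next
  case False
  then have "(\<lambda>\<omega>. - (B s \<omega> - B u \<omega>)) \<in> borel_measurable M"
    by (intro borel_measurable_uminus borel_measurable_of_F[OF increment_measurable_F]) simp
  then show ?thesis by simp
qed

lemma increment_moments:
  assumes "s < u"
  shows "integrable M (\<lambda>\<omega>. B u \<omega> - B s \<omega>)"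
    and "integrable M (\<lambda>\<omega>. (B u \<omega> - B s \<omega>)\<^sup>2)"
    and "(LINT \<omega>|M. B u \<omega> - B s \<omega>) = 0"
    and "(LINT \<omega>|M. (B u \<omega> - B s \<omega>)\<^sup>2) = u - s"
proof -
  define D where "D \<omega> = B u \<omega> - B s \<omega>" for \<omega>
  have "centered_gaussian M (\<lambda>\<omega>. \<Sum>t\<in>{s, u}. (if t = u then 1 else -1) * B t \<omega>)"
    using gaussian[unfolded centered_gaussian_process_def,
        THEN spec[of _ "{s, u}"], THEN spec[of _ "\<lambda>t. if t = u then 1 else -1"]] by simp
  also have "(\<lambda>\<omega>. \<Sum>t\<in>{s, u}. (if t = u then 1 else -1) * B t \<omega>) = D"
    using assms by (auto simp: D_def)
  finally have D: "D \<in> borel_measurable M"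
    "(AE \<omega> in M. D \<omega> = 0) \<or> (\<exists>v>0. distributed M lborel D (normal_density 0 v))"
    by (auto simp: centered_gaussian_def)
  have *: "integrable M D \<and> integrable M (\<lambda>\<omega>. (D \<omega>)\<^sup>2) \<and> (LINT \<omega>|M. D \<omega>) = 0"
    using D(2)
  proof
    assume "AE \<omega> in M. D \<omega> = 0"
    moreover from this have "AE \<omega> in M. (D \<omega>)\<^sup>2 = 0" by eventually_elim simp
    ultimately show ?thesis
      using D(1) integrable_cong_AE[of D M "\<lambda>_. 0"] integrable_cong_AE[of "\<lambda>\<omega>. (D \<omega>)\<^sup>2" M "\<lambda>_. 0"]
        integral_cong_AE[of D M "\<lambda>_. 0"]
      by auto
  next
    assume "\<exists>v>0. distributed M lborel D (normal_density 0 v)"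
    then obtain v where v: "v > 0" "distributed M lborel D (normal_density 0 v)" by blast
    have "integrable M (\<lambda>\<omega>. (D \<omega>)\<^sup>2)"
      using distributed_integrable[OF v(2), of "\<lambda>x. x\<^sup>2"] integrable_normal_moment[OF v(1), of 0 2]
      by simp
    moreover have "integrable M D"
      using distributed_integrable[OF v(2), of "\<lambda>x. x"] integrable_normal_moment[OF v(1), of 0 1]
      by simp
    moreover have "(LINT \<omega>|M. D \<omega>) = 0"
      using distributed_integral[OF v(2), of "\<lambda>x. x"] integral_normal_moment_nz_1[OF v(1), of 0]
      by simp
    ultimately show ?thesis by blast
  qed
  then show "integrable M (\<lambda>\<omega>. B u \<omega> - B s \<omega>)" "integrable M (\<lambda>\<omega>. (B u \<omega> - B s \<omega>)\<^sup>2)"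
    and mean: "(LINT \<omega>|M. B u \<omega> - B s \<omega>) = 0"
    by (simp_all add: D_def [abs_def])
  show "(LINT \<omega>|M. (B u \<omega> - B s \<omega>)\<^sup>2) = u - s"
    using increment_variance[of "u - s" s] assms mean by simp
qed

lemma independent_increment:
  fixes g :: "real \<Rightarrow> real"
  assumes "s \<le> u" and G: "G \<in> borel_measurable (F s)" "integrable M G"
    and g [measurable]: "g \<in> borel_measurable borel"
    and int: "integrable M (\<lambda>\<omega>. g (B u \<omega> - B s \<omega>))"
  shows "integrable M (\<lambda>\<omega>. G \<omega> * g (B u \<omega> - B s \<omega>))"
    and "(LINT \<omega>|M. G \<omega> * g (B u \<omega> - B s \<omega>))
      = (LINT \<omega>|M. G \<omega>) * (LINT \<omega>|M. g (B u \<omega> - B s \<omega>))"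
proof -
  define D where "D \<omega> = B u \<omega> - B s \<omega>" for \<omega>
  have D [measurable]: "D \<in> borel_measurable M" by (simp add: D_def [abs_def])
  have ind: "indep_set (sets (F s)) (sets (vimage_algebra (space M) D borel))"
    using increment_independent[of "u - s" s] assms(1) by (simp add: D_def [abs_def])
  have indep_set_subset: "indep_set A' B'" if "indep_set A B" "A' \<subseteq> A" "B' \<subseteq> B" for A A' B B'
    using that unfolding indep_sets2_eq by blast
  have "indep_set (sigma_sets (space M) {G -` A \<inter> space M | A. A \<in> sets borel})
      (sigma_sets (space M) {(\<lambda>\<omega>. g (D \<omega>)) -` A \<inter> space M | A. A \<in> sets borel})"
  proof (rule indep_set_subset[OF ind])
    show "sigma_sets (space M) {G -` A \<inter> space M |A. A \<in> sets borel} \<subseteq> sets (F s)"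
      using measurable_sets[OF G(1)]
      by (intro sets.sigma_sets_subset[of _ "F s", unfolded space_F]) (auto simp: space_F)
    have "sigma_sets (space M) {(\<lambda>\<omega>. g (D \<omega>)) -` A \<inter> space M |A. A \<in> sets borel}
      \<subseteq> sigma_sets (space M) {D -` A \<inter> space M |A. A \<in> sets borel}"
    proof (rule sigma_sets_mono, safe)
      fix A :: "real set" assume "A \<in> sets borel"
      then have "g -` A \<in> sets borel" using measurable_sets[OF g] by simp
      moreover have "(\<lambda>\<omega>. g (D \<omega>)) -` A \<inter> space M = D -` (g -` A) \<inter> space M" by auto
      ultimately show "(\<lambda>\<omega>. g (D \<omega>)) -` A \<inter> space M
          \<in> sigma_sets (space M) {D -` A \<inter> space M |A. A \<in> sets borel}"
        by blast
    qed
    then show "sigma_sets (space M) {(\<lambda>\<omega>. g (D \<omega>)) -` A \<inter> space M |A. A \<in> sets borel}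
      \<subseteq> sets (vimage_algebra (space M) D borel)"
      by (simp add: sets_vimage_algebra)
  qed
  then have "indep_var borel G borel (\<lambda>\<omega>. g (D \<omega>))"
    using borel_measurable_of_F[OF G(1)] by (simp add: indep_var_eq)
  then show "integrable M (\<lambda>\<omega>. G \<omega> * g (B u \<omega> - B s \<omega>))"
    and "(LINT \<omega>|M. G \<omega> * g (B u \<omega> - B s \<omega>))
      = (LINT \<omega>|M. G \<omega>) * (LINT \<omega>|M. g (B u \<omega> - B s \<omega>))"
    using indep_var_integrable indep_var_lebesgue_integral G(2) int by (auto simp: D_def)
qed

lemma elementary_integrand_Suc:
  "elementary_integrand M F (Suc n) \<tau> h \<Longrightarrow> elementary_integrand M F n \<tau> h"
  by (simp add: elementary_integrand_def)

lemma elementary_partition_mono: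
  assumes "elementary_integrand M F n \<tau> h" "i \<le> j" "j \<le> n"
  shows "\<tau> i \<le> \<tau> j"
  using assms(2,3)
proof (induction j rule: dec_induct)
  case (step j)
  then have "\<tau> j < \<tau> (Suc j)" using assms(1) by (simp add: elementary_integrand_def)
  then show ?case using step by simp
qed simp

lemma elementary_process_eq_0:
  assumes "elementary_integrand M F n \<tau> h" "\<tau> n < s"
  shows "elementary_process n \<tau> h s \<omega> = 0"
proof -
  have "s \<notin> {\<tau> i<..\<tau> (Suc i)}" if "i < n" for i
    using elementary_partition_mono[OF assms(1), of "Suc i" n] that assms(2) by auto
  then show ?thesis by (auto simp: elementary_process_def intro!: sum.neutral)
qed

lemma elementary_coefficient_measurable:
  assumes "elementary_integrand M F n \<tau> h" "i < n"
  shows "h i \<in> borel_measurable M"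
  by (rule borel_measurable_of_F[of _ "\<tau> i"]) (use assms in \<open>simp add: elementary_integrand_def\<close>)

lemma elementary_process_measurable:
  assumes "elementary_integrand M F n \<tau> h"
  shows "(\<lambda>(s, \<omega>). elementary_process n \<tau> h s \<omega>) \<in> borel_measurable (lborel \<Otimes>\<^sub>M M)"
proof -
  have [measurable]: "i < n \<Longrightarrow> h i \<in> borel_measurable M" for i
    by (rule elementary_coefficient_measurable[OF assms])
  show ?thesis
    unfolding elementary_process_def split_beta'
    by (intro borel_measurable_sum borel_measurable_times) auto
qed

lemma elementary_ito_measurable_F:
  assumes "elementary_integrand M F n \<tau> h"
  shows "elementary_ito B n \<tau> h \<in> borel_measurable (F (\<tau> n))"
proof -
  have "(\<lambda>\<omega>. h i \<omega> * (B (\<tau> (Suc i)) \<omega> - B (\<tau> i) \<omega>)) \<in> borel_measurable (F (\<tau> n))" if i: "i < n" for i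
  proof (intro borel_measurable_times)
    have *: "\<tau> i < \<tau> (Suc i)" "h i \<in> borel_measurable (F (\<tau> i))"
      using assms i by (auto simp: elementary_integrand_def)
    show "h i \<in> borel_measurable (F (\<tau> n))"
      using *(2) elementary_partition_mono[OF assms, of i n] i by (auto intro: borel_measurable_F_mono)
    show "(\<lambda>\<omega>. B (\<tau> (Suc i)) \<omega> - B (\<tau> i) \<omega>) \<in> borel_measurable (F (\<tau> n))"
      using *(1) elementary_partition_mono[OF assms, of "Suc i" n] i
      by (intro borel_measurable_F_mono[OF increment_measurable_F]) auto
  qed
  then show ?thesis unfolding elementary_ito_def [abs_def] by (intro borel_measurable_sum) auto
qed

text \<open>
  Induction over the number of intervals. The last increment is independent of the past, so the
  mixed term has expectation zero and the square of the last term factorizes.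
\<close>

lemma elementary_ito_isometry_aux:
  assumes "elementary_integrand M F n \<tau> h"
  shows "integrable M (\<lambda>\<omega>. (elementary_ito B n \<tau> h \<omega>)\<^sup>2) \<and>
    (\<integral>\<^sup>+\<omega>. ennreal ((elementary_ito B n \<tau> h \<omega>)\<^sup>2) \<partial>M)
      = (\<integral>\<^sup>+\<omega>. \<integral>\<^sup>+s. ennreal ((elementary_process n \<tau> h s \<omega>)\<^sup>2) \<partial>lborel \<partial>M)"
  using assms
proof (induction n)
  case 0
  then show ?case by (simp add: elementary_ito_def elementary_process_def)
next
  case (Suc n)
  note el = elementary_integrand_Suc[OF Suc.prems]
  define Q where "Q = elementary_ito B n \<tau> h"
  define D where "D \<omega> = B (\<tau> (Suc n)) \<omega> - B (\<tau> n) \<omega>" for \<omega>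
  have lt: "\<tau> n < \<tau> (Suc n)" and hF: "h n \<in> borel_measurable (F (\<tau> n))" and "bounded (h n ` space M)"
    using Suc.prems by (auto simp: elementary_integrand_def)
  then obtain b where b: "\<And>\<omega>. \<omega> \<in> space M \<Longrightarrow> \<bar>h n \<omega>\<bar> \<le> b" by (auto simp: bounded_iff)
  have h [measurable]: "h n \<in> borel_measurable M" by (rule borel_measurable_of_F[OF hF])
  have QF: "Q \<in> borel_measurable (F (\<tau> n))"
    unfolding Q_def by (rule elementary_ito_measurable_F[OF el])
  have [measurable]: "Q \<in> borel_measurable M" by (rule borel_measurable_of_F[OF QF])
  have Q2: "integrable M (\<lambda>\<omega>. (Q \<omega>)\<^sup>2)" using Suc.IH[OF el] by (simp add: Q_def)
  have Q1: "integrable M Q" by (rule square_integrable_imp_integrable[OF _ Q2]) simp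
  have Qh: "integrable M (\<lambda>\<omega>. Q \<omega> * h n \<omega>)"
  proof (rule Bochner_Integration.integrable_bound)
    show "integrable M (\<lambda>\<omega>. b * Q \<omega>)" using Q1 by simp
    show "AE \<omega> in M. norm (Q \<omega> * h n \<omega>) \<le> norm (b * Q \<omega>)"
    proof (rule AE_I2)
      fix \<omega> assume "\<omega> \<in> space M"
      then have "\<bar>h n \<omega>\<bar> \<le> \<bar>b\<bar>" using b by fastforce
      then show "norm (Q \<omega> * h n \<omega>) \<le> norm (b * Q \<omega>)"
        by (simp add: abs_mult mult.commute[of "\<bar>Q \<omega>\<bar>"] mult_right_mono)
    qed
  qed simp
  have h2: "integrable M (\<lambda>\<omega>. (h n \<omega>)\<^sup>2)"
  proof (rule integrable_const_bound[where B="b\<^sup>2"])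
    show "AE \<omega> in M. norm ((h n \<omega>)\<^sup>2) \<le> b\<^sup>2"
    proof (rule AE_I2)
      fix \<omega> assume "\<omega> \<in> space M"
      then show "norm ((h n \<omega>)\<^sup>2) \<le> b\<^sup>2"
        using power_mono[OF b[of \<omega>], of 2] by simp
    qed
  qed simp
  have cross: "integrable M (\<lambda>\<omega>. Q \<omega> * h n \<omega> * D \<omega>)" "(LINT \<omega>|M. Q \<omega> * h n \<omega> * D \<omega>) = 0"
    using independent_increment[of "\<tau> n" "\<tau> (Suc n)" "\<lambda>\<omega>. Q \<omega> * h n \<omega>" "\<lambda>x. x"] Qh lt
      increment_moments[OF lt] borel_measurable_times[OF QF hF] by (auto simp: D_def)
  have diag: "integrable M (\<lambda>\<omega>. (h n \<omega>)\<^sup>2 * (D \<omega>)\<^sup>2)"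
    "(LINT \<omega>|M. (h n \<omega>)\<^sup>2 * (D \<omega>)\<^sup>2) = (LINT \<omega>|M. (h n \<omega>)\<^sup>2) * (\<tau> (Suc n) - \<tau> n)"
    using independent_increment[of "\<tau> n" "\<tau> (Suc n)" "\<lambda>\<omega>. (h n \<omega>)\<^sup>2" "\<lambda>x. x\<^sup>2"] h2 lt
      increment_moments[OF lt] borel_measurable_power[OF hF] by (auto simp: D_def)
  have sq: "(\<lambda>\<omega>. (elementary_ito B (Suc n) \<tau> h \<omega>)\<^sup>2)
      = (\<lambda>\<omega>. ((Q \<omega>)\<^sup>2 + (h n \<omega>)\<^sup>2 * (D \<omega>)\<^sup>2) + 2 * (Q \<omega> * h n \<omega> * D \<omega>))"
    by (simp add: elementary_ito_def Q_def D_def fun_eq_iff power2_sum power_mult_distrib)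
  have int: "integrable M (\<lambda>\<omega>. (elementary_ito B (Suc n) \<tau> h \<omega>)\<^sup>2)"
    unfolding sq using Q2 cross diag by (intro Bochner_Integration.integrable_add integrable_mult_right) auto
  have [measurable]: "(\<lambda>(s, \<omega>). elementary_process n \<tau> h s \<omega>) \<in> borel_measurable (lborel \<Otimes>\<^sub>M M)"
    by (rule elementary_process_measurable[OF el])
  have "(\<integral>\<^sup>+\<omega>. ennreal ((elementary_ito B (Suc n) \<tau> h \<omega>)\<^sup>2) \<partial>M)
      = ennreal (LINT \<omega>|M. (elementary_ito B (Suc n) \<tau> h \<omega>)\<^sup>2)"
    using int by (intro nn_integral_eq_integral) auto
  also have "(LINT \<omega>|M. (elementary_ito B (Suc n) \<tau> h \<omega>)\<^sup>2)
      = (LINT \<omega>|M. (Q \<omega>)\<^sup>2) + (LINT \<omega>|M. (h n \<omega>)\<^sup>2) * (\<tau> (Suc n) - \<tau> n)"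
    unfolding sq using Q2 cross diag by simp
  also have "ennreal \<dots> = (\<integral>\<^sup>+\<omega>. ennreal ((Q \<omega>)\<^sup>2) \<partial>M)
      + (\<integral>\<^sup>+\<omega>. ennreal ((h n \<omega>)\<^sup>2) \<partial>M) * ennreal (\<tau> (Suc n) - \<tau> n)"
    using Q2 h2 lt by (simp add: nn_integral_eq_integral ennreal_mult ennreal_plus)
  also have "\<dots> = (\<integral>\<^sup>+\<omega>. (\<integral>\<^sup>+s. ennreal ((elementary_process n \<tau> h s \<omega>)\<^sup>2) \<partial>lborel)
      + ennreal ((h n \<omega>)\<^sup>2) * ennreal (\<tau> (Suc n) - \<tau> n) \<partial>M)"
    using Suc.IH[OF el] by (simp add: Q_def nn_integral_add nn_integral_multc)
  also have "\<dots> = (\<integral>\<^sup>+\<omega>. \<integral>\<^sup>+s. ennreal ((elementary_process (Suc n) \<tau> h s \<omega>)\<^sup>2) \<partial>lborel \<partial>M)"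
  proof (intro nn_integral_cong)
    fix \<omega> assume [measurable]: "\<omega> \<in> space M"
    have "(\<integral>\<^sup>+s. ennreal ((elementary_process (Suc n) \<tau> h s \<omega>)\<^sup>2) \<partial>lborel)
      = (\<integral>\<^sup>+s. ennreal ((elementary_process n \<tau> h s \<omega>)\<^sup>2)
          + ennreal ((h n \<omega>)\<^sup>2) * indicator {\<tau> n<..\<tau> (Suc n)} s \<partial>lborel)"
    proof (intro nn_integral_cong)
      fix s
      have "elementary_process (Suc n) \<tau> h s \<omega> = elementary_process n \<tau> h s \<omega>
          + h n \<omega> * indicator {\<tau> n<..\<tau> (Suc n)} s"
        by (simp add: elementary_process_def)
      then show "ennreal ((elementary_process (Suc n) \<tau> h s \<omega>)\<^sup>2)
          = ennreal ((elementary_process n \<tau> h s \<omega>)\<^sup>2)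
            + ennreal ((h n \<omega>)\<^sup>2) * indicator {\<tau> n<..\<tau> (Suc n)} s"
        using elementary_process_eq_0[OF el, of s \<omega>] by (cases "\<tau> n < s") (auto simp: indicator_def)
    qed
    also have "\<dots> = (\<integral>\<^sup>+s. ennreal ((elementary_process n \<tau> h s \<omega>)\<^sup>2) \<partial>lborel)
      + ennreal ((h n \<omega>)\<^sup>2) * ennreal (\<tau> (Suc n) - \<tau> n)"
      using lt by (subst nn_integral_add) (auto simp: nn_integral_cmult)
    finally show "(\<integral>\<^sup>+s. ennreal ((elementary_process n \<tau> h s \<omega>)\<^sup>2) \<partial>lborel)
      + ennreal ((h n \<omega>)\<^sup>2) * ennreal (\<tau> (Suc n) - \<tau> n)
      = (\<integral>\<^sup>+s. ennreal ((elementary_process (Suc n) \<tau> h s \<omega>)\<^sup>2) \<partial>lborel)" by simp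
  qed
  finally show ?case using int by blast
qed

text \<open>Squared \<open>L\<^sup>2\<close> norms of processes and of random variables, with values in \<open>[0, \<infinity>]\<close>.\<close>

definition sqnorm_process :: "(real \<Rightarrow> 'a \<Rightarrow> real) \<Rightarrow> ennreal" where
  "sqnorm_process \<phi> = (\<integral>\<^sup>+(s, \<omega>). ennreal ((\<phi> s \<omega>)\<^sup>2) \<partial>completion (lborel \<Otimes>\<^sub>M M))"

definition sqnorm_rv :: "('a \<Rightarrow> real) \<Rightarrow> ennreal" where
  "sqnorm_rv I = (\<integral>\<^sup>+\<omega>. ennreal ((I \<omega>)\<^sup>2) \<partial>M)"

lemma elementary_ito_isometry:
  assumes "elementary_integrand M F n \<tau> h"
  shows "sqnorm_rv (elementary_ito B n \<tau> h) = sqnorm_process (elementary_process n \<tau> h)"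
proof -
  interpret lM: pair_sigma_finite lborel M by unfold_locales
  note [measurable] = elementary_process_measurable[OF assms]
  have "sqnorm_process (elementary_process n \<tau> h)
      = (\<integral>\<^sup>+\<omega>. \<integral>\<^sup>+s. ennreal ((elementary_process n \<tau> h s \<omega>)\<^sup>2) \<partial>lborel \<partial>M)"
    unfolding sqnorm_process_def nn_integral_completion
    by (subst lM.nn_integral_snd[symmetric]) (auto simp: split_beta')
  then show ?thesis
    using elementary_ito_isometry_aux[OF assms] by (simp add: sqnorm_rv_def)
qed

end

section \<open>Linear combinations and truncations of elementary processes\<close>

text \<open>The elements of a finite set of times in increasing order, starting with index \<open>0\<close>.\<close>

definition nth_point :: "real set \<Rightarrow> nat \<Rightarrow> real" where
  "nth_point P j = sorted_list_of_set P ! j"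

lemma nth_point_less:
  assumes "finite P" "i < j" "j < card P"
  shows "nth_point P i < nth_point P j"
  using assms strict_sorted_list_of_set[of P]
  by (auto simp: nth_point_def sorted_wrt_iff_nth_less)

lemma nth_point_less_iff:
  assumes "finite P" "i < card P" "j < card P"
  shows "nth_point P i < nth_point P j \<longleftrightarrow> i < j"
  using nth_point_less[OF assms(1)] assms(2,3) by (metis less_asym linorder_neqE_nat order_less_irrefl)

lemma nth_point_le_iff:
  assumes "finite P" "i < card P" "j < card P"
  shows "nth_point P i \<le> nth_point P j \<longleftrightarrow> i \<le> j"
  using nth_point_less_iff[OF assms(1,3,2)] by (simp add: linorder_not_less[symmetric])

lemma nth_point_surj:
  assumes "finite P" "x \<in> P"
  obtains i where "i < card P" "nth_point P i = x"
  using assms by (metis in_set_conv_nth length_sorted_list_of_set nth_point_def set_sorted_list_of_set)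

text \<open>The coefficients of an elementary process with respect to a finer partition.\<close>

definition refined_coefficient ::
  "nat \<Rightarrow> (nat \<Rightarrow> real) \<Rightarrow> (nat \<Rightarrow> 'a \<Rightarrow> real) \<Rightarrow> real set \<Rightarrow> nat \<Rightarrow> 'a \<Rightarrow> real" where
  "refined_coefficient n \<tau> h P j \<omega> = (\<Sum>i<n. indicator {\<tau> i..<\<tau> (Suc i)} (nth_point P j) * h i \<omega>)"

lemma sum_increments_refine:
  fixes f :: "real \<Rightarrow> real"
  assumes "finite P" "a \<in> P" "b \<in> P" "a < b"
  shows "(\<Sum>j<card P - 1. indicator {a..<b} (nth_point P j) * (f (nth_point P (Suc j)) - f (nth_point P j)))
    = f b - f a"
proof -
  let ?q = "nth_point P"
  obtain k where k: "k < card P" "?q k = a" using nth_point_surj assms by blast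
  obtain m where m: "m < card P" "?q m = b" using nth_point_surj assms by blast
  have km: "k < m" using nth_point_less_iff[OF assms(1) k(1) m(1)] k m assms(4) by simp
  have "(\<Sum>j<card P - 1. indicator {a..<b} (?q j) * (f (?q (Suc j)) - f (?q j)))
    = (\<Sum>j<card P - 1. if j \<in> {k..<m} then f (?q (Suc j)) - f (?q j) else 0)"
  proof (rule sum.cong)
    fix j assume "j \<in> {..<card P - 1}"
    then have "j < card P" by auto
    then have "?q j \<in> {a..<b} \<longleftrightarrow> j \<in> {k..<m}"
      using nth_point_le_iff[OF assms(1) k(1), of j] nth_point_less_iff[OF assms(1) _ m(1), of j] k m
      by auto
    then show "indicator {a..<b} (?q j) * (f (?q (Suc j)) - f (?q j))
        = (if j \<in> {k..<m} then f (?q (Suc j)) - f (?q j) else 0)"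
      by (simp add: indicator_def)
  qed simp
  also have "\<dots> = (\<Sum>j\<in>{..<card P - 1} \<inter> {k..<m}. f (?q (Suc j)) - f (?q j))"
    by (simp add: sum.inter_restrict)
  also have "{..<card P - 1} \<inter> {k..<m} = {k..<m}" using m(1) by auto
  also have "(\<Sum>j\<in>{k..<m}. f (?q (Suc j)) - f (?q j)) = f (?q m) - f (?q k)"
    using km by (intro sum_Suc_diff') simp
  finally show ?thesis using k m by simp
qed

text \<open>
  With \<open>f = (\<lambda>r. B r \<omega>)\<close> the right hand side is the elementary integral, and with \<open>f\<close> the indicator of
  \<open>[s, \<infinity>)\<close> it is the value of the elementary process at \<open>s\<close>.
\<close>

lemma refined_sum_increments:
  fixes f :: "real \<Rightarrow> real"
  assumes "elementary_integrand M F n \<tau> h" "finite P" "\<tau> ` {..n} \<subseteq> P"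
  shows "(\<Sum>j<card P - 1. refined_coefficient n \<tau> h P j \<omega> * (f (nth_point P (Suc j)) - f (nth_point P j)))
    = (\<Sum>i<n. h i \<omega> * (f (\<tau> (Suc i)) - f (\<tau> i)))"
proof -
  let ?q = "nth_point P"
  have "(\<Sum>j<card P - 1. refined_coefficient n \<tau> h P j \<omega> * (f (?q (Suc j)) - f (?q j)))
    = (\<Sum>j<card P - 1. \<Sum>i<n. h i \<omega> * (indicator {\<tau> i..<\<tau> (Suc i)} (?q j) * (f (?q (Suc j)) - f (?q j))))"
    unfolding refined_coefficient_def sum_distrib_right by (simp only: mult_ac)
  also have "\<dots> = (\<Sum>i<n. h i \<omega> * (\<Sum>j<card P - 1. indicator {\<tau> i..<\<tau> (Suc i)} (?q j) * (f (?q (Suc j)) - f (?q j))))"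
    unfolding sum_distrib_left by (rule sum.swap)
  also have "\<dots> = (\<Sum>i<n. h i \<omega> * (f (\<tau> (Suc i)) - f (\<tau> i)))"
  proof (rule sum.cong)
    fix i assume "i \<in> {..<n}"
    then have "i < n" by simp
    then have "\<tau> i \<in> P" "\<tau> (Suc i) \<in> P" "\<tau> i < \<tau> (Suc i)"
      using assms by (auto simp: elementary_integrand_def image_subset_iff)
    then show "h i \<omega> * (\<Sum>j<card P - 1. indicator {\<tau> i..<\<tau> (Suc i)} (?q j) * (f (?q (Suc j)) - f (?q j)))
      = h i \<omega> * (f (\<tau> (Suc i)) - f (\<tau> i))"
      by (simp only: sum_increments_refine[OF assms(2)])
  qed simp
  finally show ?thesis .
qed

lemma elementary_process_eq_increments:
  assumes "elementary_integrand M F n \<tau> h"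
  shows "elementary_process n \<tau> h s \<omega>
    = (\<Sum>i<n. h i \<omega> * ((if s \<le> \<tau> (Suc i) then 1 else 0) - (if s \<le> \<tau> i then 1 else 0)))"
  unfolding elementary_process_def
proof (rule sum.cong)
  fix i assume "i \<in> {..<n}"
  then have "\<tau> i < \<tau> (Suc i)" using assms by (auto simp: elementary_integrand_def)
  then show "h i \<omega> * indicator {\<tau> i<..\<tau> (Suc i)} s
    = h i \<omega> * ((if s \<le> \<tau> (Suc i) then 1 else 0) - (if s \<le> \<tau> i then 1 else 0))"
    by (simp add: indicator_def)
qed simp

lemma bounded_image_sum:
  fixes h :: "nat \<Rightarrow> 'b \<Rightarrow> real"
  assumes "\<And>i. i < n \<Longrightarrow> bounded (h i ` S)"
  shows "bounded ((\<lambda>\<omega>. \<Sum>i<n. c i * h i \<omega>) ` S)"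
  using assms
proof (induction n)
  case 0
  show ?case by (simp add: image_constant_conv)
next
  case (Suc n)
  have "bounded ((\<lambda>\<omega>. c n * h n \<omega>) ` S)"
    using bounded_scaleR_comp[of "h n" S "c n"] Suc.prems[of n] by simp
  then show ?case using bounded_plus_comp Suc by (simp add: lessI less_SucI)
qed

context two_sided_brownian_motion
begin

lemma refined_integrand:
  assumes el: "elementary_integrand M F n \<tau> h" and P: "finite P"
  shows "elementary_integrand M F (card P - 1) (nth_point P) (refined_coefficient n \<tau> h P)"
  unfolding elementary_integrand_def
proof (intro allI impI conjI)
  fix j assume j: "j < card P - 1"
  then show "nth_point P j < nth_point P (Suc j)" using nth_point_less[OF P, of j "Suc j"] by simp
  show "refined_coefficient n \<tau> h P j \<in> borel_measurable (F (nth_point P j))"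
    unfolding refined_coefficient_def [abs_def]
  proof (intro borel_measurable_sum)
    fix i assume "i \<in> {..<n}"
    then have h: "h i \<in> borel_measurable (F (\<tau> i))"
      using el by (auto simp: elementary_integrand_def)
    show "(\<lambda>\<omega>. indicator {\<tau> i..<\<tau> (Suc i)} (nth_point P j) * h i \<omega>) \<in> borel_measurable (F (nth_point P j))"
    proof (cases "\<tau> i \<le> nth_point P j")
      case True
      then show ?thesis
        by (intro borel_measurable_times borel_measurable_const borel_measurable_F_mono[OF h])
    qed simp
  qed
  show "bounded (refined_coefficient n \<tau> h P j ` space M)"
    unfolding refined_coefficient_def [abs_def]
    using el by (intro bounded_image_sum) (simp add: elementary_integrand_def)
qed

lemma refined_process:
  assumes el: "elementary_integrand M F n \<tau> h" and P: "finite P" "\<tau> ` {..n} \<subseteq> P"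
  shows "elementary_process (card P - 1) (nth_point P) (refined_coefficient n \<tau> h P)
    = elementary_process n \<tau> h"
proof (intro ext)
  fix s \<omega>
  show "elementary_process (card P - 1) (nth_point P) (refined_coefficient n \<tau> h P) s \<omega>
    = elementary_process n \<tau> h s \<omega>"
    unfolding elementary_process_eq_increments[OF el]
      elementary_process_eq_increments[OF refined_integrand[OF el P(1)]]
    by (rule refined_sum_increments[OF assms, where f="\<lambda>x. if s \<le> x then 1 else 0"])
qed

lemma refined_ito:
  assumes el: "elementary_integrand M F n \<tau> h" and P: "finite P" "\<tau> ` {..n} \<subseteq> P"
  shows "elementary_ito B (card P - 1) (nth_point P) (refined_coefficient n \<tau> h P)
    = elementary_ito B n \<tau> h"
  using refined_sum_increments[OF assms]
  by (intro ext) (simp add: elementary_ito_def)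

text \<open>\<open>J\<close> is the integral of the elementary process \<open>e\<close>.\<close>

definition simple_ito :: "(real \<Rightarrow> 'a \<Rightarrow> real) \<Rightarrow> ('a \<Rightarrow> real) \<Rightarrow> bool" where
  "simple_ito e J \<longleftrightarrow> (\<exists>n \<tau> h. elementary_integrand M F n \<tau> h \<and>
     e = elementary_process n \<tau> h \<and> J = elementary_ito B n \<tau> h)"

lemma simple_ito_measurable:
  assumes "simple_ito e J"
  shows "(\<lambda>(s, \<omega>). e s \<omega>) \<in> borel_measurable (lborel \<Otimes>\<^sub>M M)" "J \<in> borel_measurable M"
proof -
  obtain n \<tau> h where *: "elementary_integrand M F n \<tau> h" "e = elementary_process n \<tau> h"
    "J = elementary_ito B n \<tau> h"
    using assms by (auto simp: simple_ito_def)
  show "(\<lambda>(s, \<omega>). e s \<omega>) \<in> borel_measurable (lborel \<Otimes>\<^sub>M M)"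
    unfolding *(2) by (rule elementary_process_measurable[OF *(1)])
  show "J \<in> borel_measurable M"
    unfolding *(3) by (rule borel_measurable_of_F[OF elementary_ito_measurable_F[OF *(1)]])
qed

lemma simple_ito_isometry: "simple_ito e J \<Longrightarrow> sqnorm_rv J = sqnorm_process e"
  by (auto simp: simple_ito_def elementary_ito_isometry)

lemma simple_ito_scale:
  assumes "simple_ito e J"
  shows "simple_ito (\<lambda>s \<omega>. c * e s \<omega>) (\<lambda>\<omega>. c * J \<omega>)"
proof -
  obtain n \<tau> h where *: "elementary_integrand M F n \<tau> h" "e = elementary_process n \<tau> h"
    "J = elementary_ito B n \<tau> h"
    using assms by (auto simp: simple_ito_def)
  let ?h = "\<lambda>i \<omega>. c * h i \<omega>"
  have "bounded (?h i ` space M)" if "i < n" for i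
    using * that bounded_scaleR_comp[of "h i" "space M" c] by (auto simp: elementary_integrand_def)
  then have "elementary_integrand M F n \<tau> ?h"
    using *(1) by (auto simp: elementary_integrand_def)
  moreover have "(\<lambda>s \<omega>. c * e s \<omega>) = elementary_process n \<tau> ?h"
    "(\<lambda>\<omega>. c * J \<omega>) = elementary_ito B n \<tau> ?h"
    by (intro ext, simp only: * elementary_process_def elementary_ito_def sum_distrib_left mult.assoc)+
  ultimately show ?thesis unfolding simple_ito_def by blast
qed

lemma simple_ito_add:
  assumes "simple_ito e J" "simple_ito e' J'"
  shows "simple_ito (\<lambda>s \<omega>. e s \<omega> + e' s \<omega>) (\<lambda>\<omega>. J \<omega> + J' \<omega>)"
proof -
  obtain n \<tau> h where *: "elementary_integrand M F n \<tau> h" "e = elementary_process n \<tau> h"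
    "J = elementary_ito B n \<tau> h"
    using assms(1) by (auto simp: simple_ito_def)
  obtain n' \<tau>' h' where el': "elementary_integrand M F n' \<tau>' h'" "e' = elementary_process n' \<tau>' h'"
    "J' = elementary_ito B n' \<tau>' h'"
    using assms(2) by (auto simp: simple_ito_def)
  define P where "P = \<tau> ` {..n} \<union> \<tau>' ` {..n'}"
  have P: "finite P" "\<tau> ` {..n} \<subseteq> P" "\<tau>' ` {..n'} \<subseteq> P" by (auto simp: P_def)
  define g where "g = refined_coefficient n \<tau> h P"
  define g' where "g' = refined_coefficient n' \<tau>' h' P"
  define m where "m = card P - 1"
  note r = refined_integrand[OF *(1) P(1), folded g_def m_def]
    refined_integrand[OF el'(1) P(1), folded g'_def m_def]
  have e: "e = elementary_process m (nth_point P) g" "e' = elementary_process m (nth_point P) g'"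
    "J = elementary_ito B m (nth_point P) g" "J' = elementary_ito B m (nth_point P) g'"
    using refined_process[OF *(1) P(1,2)] refined_process[OF el'(1) P(1,3)]
      refined_ito[OF *(1) P(1,2)] refined_ito[OF el'(1) P(1,3)]
    by (simp_all add: * el' g_def g'_def m_def)
  let ?h = "\<lambda>i \<omega>. g i \<omega> + g' i \<omega>"
  have "elementary_integrand M F m (nth_point P) ?h"
    using r by (auto simp: elementary_integrand_def intro!: bounded_plus_comp borel_measurable_add)
  moreover have "(\<lambda>s \<omega>. e s \<omega> + e' s \<omega>) = elementary_process m (nth_point P) ?h"
    "(\<lambda>\<omega>. J \<omega> + J' \<omega>) = elementary_ito B m (nth_point P) ?h"
    by (simp_all add: e elementary_process_def elementary_ito_def fun_eq_iff sum.distrib distrib_right)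
  ultimately show ?thesis unfolding simple_ito_def by blast
qed

text \<open>The partition is refined by \<open>t\<close>, so that each of its intervals lies on one side of \<open>t\<close>.\<close>

lemma simple_ito_truncate:
  assumes "simple_ito e J"
  obtains J' where "simple_ito (\<lambda>s \<omega>. indicator {..t} s * e s \<omega>) J'" "J' \<in> borel_measurable (F t)"
proof -
  obtain n \<tau> h where *: "elementary_integrand M F n \<tau> h" "e = elementary_process n \<tau> h"
    "J = elementary_ito B n \<tau> h"
    using assms by (auto simp: simple_ito_def)
  define P where "P = insert t (\<tau> ` {..n})"
  have P: "finite P" "\<tau> ` {..n} \<subseteq> P" by (auto simp: P_def)
  define q where "q = nth_point P"
  define m where "m = card P - 1"
  define g where "g = refined_coefficient n \<tau> h P"
  note r = refined_integrand[OF *(1) P(1), folded g_def m_def q_def]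
  have e: "e = elementary_process m q g"
    using refined_process[OF *(1) P] by (simp add: * g_def m_def q_def)
  obtain k where k: "k < card P" "q k = t"
    using nth_point_surj[OF P(1), of t] unfolding q_def by (auto simp: P_def)
  have le: "q (Suc j) \<le> t" if "j < m" "q j < t" for j
  proof -
    have "j < k" using that k nth_point_less_iff[OF P(1), of j k] by (auto simp: q_def m_def)
    then show ?thesis using that k nth_point_le_iff[OF P(1), of "Suc j" k] by (auto simp: q_def m_def)
  qed
  define g' where "g' j \<omega> = (if q j < t then g j \<omega> else 0)" for j \<omega>
  have g': "g' j = (if q j < t then g j else (\<lambda>_. 0))" for j by (auto simp: g'_def fun_eq_iff)
  have el': "elementary_integrand M F m q g'"
    using r by (auto simp: elementary_integrand_def g' image_constant_conv)
  have "indicator {..t} s * (g j \<omega> * indicator {q j<..q (Suc j)} s) = g' j \<omega> * indicator {q j<..q (Suc j)} s"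
    if "j < m" for j s \<omega>
    using le[OF that] by (auto simp: g'_def indicator_def)
  then have "(\<lambda>s \<omega>. indicator {..t} s * e s \<omega>) = elementary_process m q g'"
    unfolding e elementary_process_def sum_distrib_left by (intro ext sum.cong) auto
  then have 1: "simple_ito (\<lambda>s \<omega>. indicator {..t} s * e s \<omega>) (elementary_ito B m q g')"
    using el' unfolding simple_ito_def by blast
  have 2: "elementary_ito B m q g' \<in> borel_measurable (F t)"
    unfolding elementary_ito_def [abs_def]
  proof (intro borel_measurable_sum)
    fix j assume "j \<in> {..<m}"
    then have j: "j < m" "q j < q (Suc j)" "g j \<in> borel_measurable (F (q j))"
      using r by (auto simp: elementary_integrand_def)
    show "(\<lambda>\<omega>. g' j \<omega> * (B (q (Suc j)) \<omega> - B (q j) \<omega>)) \<in> borel_measurable (F t)"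
    proof (cases "q j < t")
      case True
      have "g' j \<in> borel_measurable (F t)"
        using True borel_measurable_F_mono[OF j(3), of t] by (simp add: g')
      moreover have "(\<lambda>\<omega>. B (q (Suc j)) \<omega> - B (q j) \<omega>) \<in> borel_measurable (F t)"
        using borel_measurable_F_mono[OF increment_measurable_F le[OF j(1) True]] j(2) by simp
      ultimately show ?thesis by (rule borel_measurable_times)
    qed (simp add: g')
  qed
  show ?thesis by (rule that[OF 1 2])
qed

end

section \<open>The Ito integral as a bounded linear operator\<close>

lemma nn_integral_square_add_le:
  fixes f g :: "'b \<Rightarrow> real"
  assumes [measurable]: "f \<in> borel_measurable N" "g \<in> borel_measurable N"
  shows "(\<integral>\<^sup>+x. ennreal ((f x + g x)\<^sup>2) \<partial>N)
    \<le> 2 * ((\<integral>\<^sup>+x. ennreal ((f x)\<^sup>2) \<partial>N) + (\<integral>\<^sup>+x. ennreal ((g x)\<^sup>2) \<partial>N))"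
proof -
  have "(\<integral>\<^sup>+x. ennreal ((f x + g x)\<^sup>2) \<partial>N)
    \<le> (\<integral>\<^sup>+x. 2 * (ennreal ((f x)\<^sup>2) + ennreal ((g x)\<^sup>2)) \<partial>N)"
  proof (intro nn_integral_mono)
    fix x
    have "(f x + g x)\<^sup>2 \<le> 2 * ((f x)\<^sup>2 + (g x)\<^sup>2)"
      using zero_le_power2[of "f x - g x"] by (simp add: power2_eq_square algebra_simps)
    then have "ennreal ((f x + g x)\<^sup>2) \<le> ennreal (2 * ((f x)\<^sup>2 + (g x)\<^sup>2))" by (rule ennreal_leI)
    also have "\<dots> = 2 * (ennreal ((f x)\<^sup>2) + ennreal ((g x)\<^sup>2))"
      by (simp add: ennreal_mult ennreal_plus)
    finally show "ennreal ((f x + g x)\<^sup>2) \<le> 2 * (ennreal ((f x)\<^sup>2) + ennreal ((g x)\<^sup>2))" .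
  qed
  then show ?thesis by (simp add: nn_integral_cmult nn_integral_add)
qed

lemma ennreal_double_quarters:
  fixes \<epsilon> :: real
  assumes "\<epsilon> > 0"
  shows "2 * (ennreal (\<epsilon> / 4) + ennreal (\<epsilon> / 4)) = ennreal \<epsilon>"
proof -
  have "2 * (ennreal (\<epsilon> / 4) + ennreal (\<epsilon> / 4)) = ennreal 2 * ennreal (\<epsilon> / 4 + \<epsilon> / 4)"
    using assms by (subst ennreal_plus) auto
  also have "\<dots> = ennreal \<epsilon>" using assms by (subst ennreal_mult[symmetric]) auto
  finally show ?thesis .
qed

lemma nn_integral_square_scale:
  fixes f :: "'b \<Rightarrow> real"
  assumes [measurable]: "f \<in> borel_measurable N"
  shows "(\<integral>\<^sup>+x. ennreal ((c * f x)\<^sup>2) \<partial>N) = ennreal (c\<^sup>2) * (\<integral>\<^sup>+x. ennreal ((f x)\<^sup>2) \<partial>N)"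
  by (simp add: power_mult_distrib ennreal_mult nn_integral_cmult)

context two_sided_brownian_motion
begin

text \<open>Measurability for the completion, since integrands only matter up to null sets.\<close>

abbreviation process_measurable :: "(real \<Rightarrow> 'a \<Rightarrow> real) \<Rightarrow> bool" where
  "process_measurable \<phi> \<equiv> (\<lambda>(s, \<omega>). \<phi> s \<omega>) \<in> borel_measurable (completion (lborel \<Otimes>\<^sub>M M))"

lemma sqnorm_process_add_le:
  assumes "process_measurable \<phi>" "process_measurable \<psi>"
  shows "sqnorm_process (\<lambda>s \<omega>. \<phi> s \<omega> + \<psi> s \<omega>) \<le> 2 * (sqnorm_process \<phi> + sqnorm_process \<psi>)"
  using nn_integral_square_add_le[OF assms] by (simp add: sqnorm_process_def split_beta')

lemma sqnorm_process_scale: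
  assumes "process_measurable \<phi>"
  shows "sqnorm_process (\<lambda>s \<omega>. c * \<phi> s \<omega>) = ennreal (c\<^sup>2) * sqnorm_process \<phi>"
  using nn_integral_square_scale[OF assms, of c] by (simp add: sqnorm_process_def split_beta')

lemma sqnorm_rv_add_le:
  assumes "I \<in> borel_measurable M" "J \<in> borel_measurable M"
  shows "sqnorm_rv (\<lambda>\<omega>. I \<omega> + J \<omega>) \<le> 2 * (sqnorm_rv I + sqnorm_rv J)"
  using nn_integral_square_add_le[OF assms] by (simp add: sqnorm_rv_def)

lemma sqnorm_rv_scale:
  assumes "I \<in> borel_measurable M"
  shows "sqnorm_rv (\<lambda>\<omega>. c * I \<omega>) = ennreal (c\<^sup>2) * sqnorm_rv I"
  using nn_integral_square_scale[OF assms, of c] by (simp add: sqnorm_rv_def)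

lemma sqnorm_rv_minus_commute: "sqnorm_rv (\<lambda>\<omega>. I \<omega> - J \<omega>) = sqnorm_rv (\<lambda>\<omega>. J \<omega> - I \<omega>)"
  by (simp add: sqnorm_rv_def power2_commute)

lemma process_measurable_add:
  "process_measurable \<phi> \<Longrightarrow> process_measurable \<psi> \<Longrightarrow> process_measurable (\<lambda>s \<omega>. \<phi> s \<omega> + \<psi> s \<omega>)"
  by (simp add: split_beta')

lemma process_measurable_diff:
  "process_measurable \<phi> \<Longrightarrow> process_measurable \<psi> \<Longrightarrow> process_measurable (\<lambda>s \<omega>. \<phi> s \<omega> - \<psi> s \<omega>)"
  by (simp add: split_beta')

lemma process_measurable_scale:
  "process_measurable \<phi> \<Longrightarrow> process_measurable (\<lambda>s \<omega>. c * \<phi> s \<omega>)"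
  by (simp add: split_beta')

lemma simple_ito_process_measurable: "simple_ito e J \<Longrightarrow> process_measurable e"
  by (intro measurable_completion simple_ito_measurable)

text \<open>The definition of the Ito integral in terms of \<open>\<epsilon>\<close>-approximations instead of sequences.\<close>

lemma has_ito_integral_iff:
  "has_ito_integral M F B \<phi> I \<longleftrightarrow> process_measurable \<phi> \<and> I \<in> borel_measurable M \<and>
    (\<forall>\<epsilon>>0. \<exists>e J. simple_ito e J \<and> sqnorm_process (\<lambda>s \<omega>. e s \<omega> - \<phi> s \<omega>) \<le> ennreal \<epsilon> \<and>
       sqnorm_rv (\<lambda>\<omega>. J \<omega> - I \<omega>) \<le> ennreal \<epsilon>)" (is "_ \<longleftrightarrow> ?m1 \<and> ?m2 \<and> ?A")
proof -
  define E where "E n \<tau> h = sqnorm_process (\<lambda>s \<omega>. elementary_process n \<tau> h s \<omega> - \<phi> s \<omega>)" for n \<tau> h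
  define R where "R n \<tau> h = sqnorm_rv (\<lambda>\<omega>. elementary_ito B n \<tau> h \<omega> - I \<omega>)" for n \<tau> h
  define S where "S \<longleftrightarrow> (\<exists>n \<tau> h. (\<forall>k. elementary_integrand M F (n k) (\<tau> k) (h k)) \<and>
    (\<lambda>k::nat. E (n k) (\<tau> k) (h k)) \<longlonglongrightarrow> 0 \<and> (\<lambda>k. R (n k) (\<tau> k) (h k)) \<longlonglongrightarrow> 0)"
  have "has_ito_integral M F B \<phi> I \<longleftrightarrow> ?m1 \<and> ?m2 \<and> S"
    unfolding has_ito_integral_def S_def E_def R_def sqnorm_process_def sqnorm_rv_def ..
  moreover have "S \<longleftrightarrow> ?A"
  proof
    assume S
    then obtain n \<tau> h where el: "\<And>k. elementary_integrand M F (n k) (\<tau> k) (h k)"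
      and lim: "(\<lambda>k::nat. E (n k) (\<tau> k) (h k)) \<longlonglongrightarrow> 0" "(\<lambda>k. R (n k) (\<tau> k) (h k)) \<longlonglongrightarrow> 0"
      unfolding S_def by blast
    show ?A
    proof (intro allI impI)
      fix \<epsilon> :: real assume "\<epsilon> > 0"
      then have "ennreal \<epsilon> > 0" by simp
      then have "\<forall>\<^sub>F k in sequentially. E (n k) (\<tau> k) (h k) < ennreal \<epsilon> \<and> R (n k) (\<tau> k) (h k) < ennreal \<epsilon>"
        using order_tendstoD(2)[OF lim(1)] order_tendstoD(2)[OF lim(2)] by (intro eventually_conj) auto
      then obtain k where "E (n k) (\<tau> k) (h k) < ennreal \<epsilon>" "R (n k) (\<tau> k) (h k) < ennreal \<epsilon>"
        using eventually_happens[of _ sequentially] by auto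
      then show "\<exists>e J. simple_ito e J \<and> sqnorm_process (\<lambda>s \<omega>. e s \<omega> - \<phi> s \<omega>) \<le> ennreal \<epsilon> \<and>
        sqnorm_rv (\<lambda>\<omega>. J \<omega> - I \<omega>) \<le> ennreal \<epsilon>"
        using el[of k] unfolding simple_ito_def E_def R_def by (metis order_less_imp_le)
    qed
  next
    assume A: ?A
    have "\<exists>n \<tau> h. elementary_integrand M F n \<tau> h \<and> E n \<tau> h \<le> ennreal (1 / real (Suc k)) \<and>
      R n \<tau> h \<le> ennreal (1 / real (Suc k))" for k
      using A[rule_format, of "1 / real (Suc k)"] unfolding simple_ito_def E_def R_def by auto
    then obtain n \<tau> h where *: "\<And>k. elementary_integrand M F (n k) (\<tau> k) (h k)"
      "\<And>k. E (n k) (\<tau> k) (h k) \<le> ennreal (1 / real (Suc k))"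
      "\<And>k. R (n k) (\<tau> k) (h k) \<le> ennreal (1 / real (Suc k))"
      by metis
    have "(\<lambda>k. ennreal (1 / real (Suc k))) \<longlonglongrightarrow> ennreal 0"
      by (intro tendsto_ennrealI LIMSEQ_Suc lim_1_over_n)
    then have lim: "(\<lambda>k. ennreal (1 / real (Suc k))) \<longlonglongrightarrow> 0" by simp
    have "(\<lambda>k. E (n k) (\<tau> k) (h k)) \<longlonglongrightarrow> 0" "(\<lambda>k. R (n k) (\<tau> k) (h k)) \<longlonglongrightarrow> 0"
      by (rule tendsto_sandwich[OF _ _ tendsto_const lim]; use * in simp)+
    then show S using *(1) unfolding S_def by blast
  qed
  ultimately show ?thesis by blast
qed

lemma has_ito_integral_measurable:
  assumes "has_ito_integral M F B \<phi> I"
  shows "process_measurable \<phi>" "I \<in> borel_measurable M"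
  using assms by (auto simp: has_ito_integral_iff)

lemma has_ito_integral_approx:
  assumes "has_ito_integral M F B \<phi> I" "\<epsilon> > 0"
  obtains e J where "simple_ito e J" "sqnorm_process (\<lambda>s \<omega>. e s \<omega> - \<phi> s \<omega>) \<le> ennreal \<epsilon>"
    "sqnorm_rv (\<lambda>\<omega>. J \<omega> - I \<omega>) \<le> ennreal \<epsilon>"
  using assms unfolding has_ito_integral_iff by blast

lemma simple_ito_has_ito_integral:
  assumes "simple_ito e J"
  shows "has_ito_integral M F B e J"
  unfolding has_ito_integral_iff
proof (intro conjI allI impI)
  show "process_measurable e" by (rule simple_ito_process_measurable[OF assms])
  show "J \<in> borel_measurable M" by (rule simple_ito_measurable[OF assms])
  show "\<exists>e' J'. simple_ito e' J' \<and> sqnorm_process (\<lambda>s \<omega>. e' s \<omega> - e s \<omega>) \<le> ennreal \<epsilon> \<and>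
        sqnorm_rv (\<lambda>\<omega>. J' \<omega> - J \<omega>) \<le> ennreal \<epsilon>" for \<epsilon>
    using assms by (intro exI[of _ e] exI[of _ J]) (simp add: sqnorm_process_def sqnorm_rv_def split_beta')
qed

text \<open>
  The isometry, with a constant that is good enough for every later purpose: it gives uniqueness
  of the integral and continuity in the integrand.
\<close>

lemma has_ito_integral_sqnorm_le:
  assumes "has_ito_integral M F B \<phi> I"
  shows "sqnorm_rv I \<le> 4 * sqnorm_process \<phi>"
proof (rule ennreal_le_epsilon)
  note m = has_ito_integral_measurable[OF assms]
  fix \<epsilon> :: real assume "\<epsilon> > 0"
  then obtain e J where eJ: "simple_ito e J" "sqnorm_process (\<lambda>s \<omega>. e s \<omega> - \<phi> s \<omega>) \<le> ennreal (\<epsilon> / 6)"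
    "sqnorm_rv (\<lambda>\<omega>. J \<omega> - I \<omega>) \<le> ennreal (\<epsilon> / 6)"
    using has_ito_integral_approx[OF assms, of "\<epsilon> / 6"] by auto
  note me = simple_ito_process_measurable[OF eJ(1)] simple_ito_measurable(2)[OF eJ(1)]
  have "sqnorm_rv J = sqnorm_process (\<lambda>s \<omega>. \<phi> s \<omega> + (e s \<omega> - \<phi> s \<omega>))"
    using simple_ito_isometry[OF eJ(1)] by simp
  also have "\<dots> \<le> 2 * (sqnorm_process \<phi> + sqnorm_process (\<lambda>s \<omega>. e s \<omega> - \<phi> s \<omega>))"
    by (intro sqnorm_process_add_le process_measurable_diff m me)
  also have "\<dots> \<le> 2 * (sqnorm_process \<phi> + ennreal (\<epsilon> / 6))"
    using eJ(2) by (intro mult_left_mono add_left_mono) auto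
  finally have J: "sqnorm_rv J \<le> 2 * (sqnorm_process \<phi> + ennreal (\<epsilon> / 6))" .
  have "sqnorm_rv I = sqnorm_rv (\<lambda>\<omega>. J \<omega> + (I \<omega> - J \<omega>))" by simp
  also have "\<dots> \<le> 2 * (sqnorm_rv J + sqnorm_rv (\<lambda>\<omega>. I \<omega> - J \<omega>))"
    by (intro sqnorm_rv_add_le borel_measurable_diff m me)
  also have "\<dots> \<le> 2 * (2 * (sqnorm_process \<phi> + ennreal (\<epsilon> / 6)) + ennreal (\<epsilon> / 6))"
    using J eJ(3) by (intro mult_left_mono add_mono) (auto simp: sqnorm_rv_minus_commute[of I J])
  also have "\<dots> = 4 * sqnorm_process \<phi> + 6 * ennreal (\<epsilon> / 6)"
  proof -
    have "2 * (2 * (a + b) + b) = 4 * a + (4 + 2) * b" for a b :: ennreal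
      by (simp only: distrib_right) (simp add: distrib_left add.assoc flip: mult.assoc)
    then show ?thesis by simp
  qed
  also have "6 * ennreal (\<epsilon> / 6) = ennreal \<epsilon>"
  proof -
    have "6 * ennreal (\<epsilon> / 6) = ennreal 6 * ennreal (\<epsilon> / 6)" by simp
    also have "\<dots> = ennreal \<epsilon>" using \<open>\<epsilon> > 0\<close> by (subst ennreal_mult[symmetric]) auto
    finally show ?thesis .
  qed
  finally show "sqnorm_rv I \<le> 4 * sqnorm_process \<phi> + ennreal \<epsilon>" .
qed

lemma has_ito_integral_closure:
  assumes m: "process_measurable \<phi>" "I \<in> borel_measurable M"
    and approx: "\<And>\<epsilon>. \<epsilon> > 0 \<Longrightarrow> \<exists>\<psi> J. has_ito_integral M F B \<psi> J \<and>
      sqnorm_process (\<lambda>s \<omega>. \<psi> s \<omega> - \<phi> s \<omega>) \<le> ennreal \<epsilon> \<and> sqnorm_rv (\<lambda>\<omega>. J \<omega> - I \<omega>) \<le> ennreal \<epsilon>"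
  shows "has_ito_integral M F B \<phi> I"
  unfolding has_ito_integral_iff
proof (intro conjI m allI impI)
  fix \<epsilon> :: real assume "\<epsilon> > 0"
  note eps = ennreal_double_quarters[OF \<open>\<epsilon> > 0\<close>]
  have pos: "\<epsilon> / 4 > 0" using \<open>\<epsilon> > 0\<close> by simp
  obtain \<psi> J where psi: "has_ito_integral M F B \<psi> J"
    "sqnorm_process (\<lambda>s \<omega>. \<psi> s \<omega> - \<phi> s \<omega>) \<le> ennreal (\<epsilon> / 4)" "sqnorm_rv (\<lambda>\<omega>. J \<omega> - I \<omega>) \<le> ennreal (\<epsilon> / 4)"
    using approx[OF pos] by blast
  obtain e L where e: "simple_ito e L" "sqnorm_process (\<lambda>s \<omega>. e s \<omega> - \<psi> s \<omega>) \<le> ennreal (\<epsilon> / 4)"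
    "sqnorm_rv (\<lambda>\<omega>. L \<omega> - J \<omega>) \<le> ennreal (\<epsilon> / 4)"
    using has_ito_integral_approx[OF psi(1) pos] .
  note m' = has_ito_integral_measurable[OF psi(1)] simple_ito_process_measurable[OF e(1)]
    simple_ito_measurable(2)[OF e(1)]
  have "sqnorm_process (\<lambda>s \<omega>. e s \<omega> - \<phi> s \<omega>)
    = sqnorm_process (\<lambda>s \<omega>. (e s \<omega> - \<psi> s \<omega>) + (\<psi> s \<omega> - \<phi> s \<omega>))" by simp
  also have "\<dots> \<le> 2 * (sqnorm_process (\<lambda>s \<omega>. e s \<omega> - \<psi> s \<omega>) + sqnorm_process (\<lambda>s \<omega>. \<psi> s \<omega> - \<phi> s \<omega>))"
    by (intro sqnorm_process_add_le process_measurable_diff m m')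
  also have "\<dots> \<le> 2 * (ennreal (\<epsilon> / 4) + ennreal (\<epsilon> / 4))"
    using e psi by (intro mult_left_mono add_mono) auto
  finally have 1: "sqnorm_process (\<lambda>s \<omega>. e s \<omega> - \<phi> s \<omega>) \<le> ennreal \<epsilon>" by (simp only: eps)
  have "sqnorm_rv (\<lambda>\<omega>. L \<omega> - I \<omega>) = sqnorm_rv (\<lambda>\<omega>. (L \<omega> - J \<omega>) + (J \<omega> - I \<omega>))" by simp
  also have "\<dots> \<le> 2 * (sqnorm_rv (\<lambda>\<omega>. L \<omega> - J \<omega>) + sqnorm_rv (\<lambda>\<omega>. J \<omega> - I \<omega>))"
    by (intro sqnorm_rv_add_le borel_measurable_diff m m')
  also have "\<dots> \<le> 2 * (ennreal (\<epsilon> / 4) + ennreal (\<epsilon> / 4))"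
    using e psi by (intro mult_left_mono add_mono) auto
  finally have 2: "sqnorm_rv (\<lambda>\<omega>. L \<omega> - I \<omega>) \<le> ennreal \<epsilon>" by (simp only: eps)
  show "\<exists>e J. simple_ito e J \<and> sqnorm_process (\<lambda>s \<omega>. e s \<omega> - \<phi> s \<omega>) \<le> ennreal \<epsilon> \<and>
      sqnorm_rv (\<lambda>\<omega>. J \<omega> - I \<omega>) \<le> ennreal \<epsilon>"
    using e(1) 1 2 by blast
qed

lemma sqnorm_process_diff_eq_0:
  assumes "AE x in completion (lborel \<Otimes>\<^sub>M M). \<phi> (fst x) (snd x) = \<psi> (fst x) (snd x)"
  shows "sqnorm_process (\<lambda>s \<omega>. \<phi> s \<omega> - \<psi> s \<omega>) = 0"
proof -
  have "AE x in completion (lborel \<Otimes>\<^sub>M M). ennreal ((\<phi> (fst x) (snd x) - \<psi> (fst x) (snd x))\<^sup>2) = 0"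
    using assms by eventually_elim simp
  then have "(\<integral>\<^sup>+x. ennreal ((\<phi> (fst x) (snd x) - \<psi> (fst x) (snd x))\<^sup>2) \<partial>completion (lborel \<Otimes>\<^sub>M M))
    = (\<integral>\<^sup>+x. 0 \<partial>completion ((lborel :: real measure) \<Otimes>\<^sub>M M))"
    by (rule nn_integral_cong_AE)
  then show ?thesis by (simp add: sqnorm_process_def split_beta')
qed

lemma has_ito_integral_cong_AE:
  assumes I: "has_ito_integral M F B \<phi> I"
    and "process_measurable \<psi>" "J \<in> borel_measurable M"
    and ae: "AE x in completion (lborel \<Otimes>\<^sub>M M). \<phi> (fst x) (snd x) = \<psi> (fst x) (snd x)"
      "AE \<omega> in M. I \<omega> = J \<omega>"
  shows "has_ito_integral M F B \<psi> J"
proof (rule has_ito_integral_closure[OF assms(2,3)])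
  have "sqnorm_process (\<lambda>s \<omega>. \<phi> s \<omega> - \<psi> s \<omega>) = 0"
    by (rule sqnorm_process_diff_eq_0[OF ae(1)])
  moreover have "sqnorm_rv (\<lambda>\<omega>. I \<omega> - J \<omega>) = (\<integral>\<^sup>+x. 0 \<partial>M)"
    unfolding sqnorm_rv_def using ae(2) by (intro nn_integral_cong_AE) auto
  ultimately show "\<exists>\<phi>' I'. has_ito_integral M F B \<phi>' I' \<and>
      sqnorm_process (\<lambda>s \<omega>. \<phi>' s \<omega> - \<psi> s \<omega>) \<le> ennreal \<epsilon> \<and> sqnorm_rv (\<lambda>\<omega>. I' \<omega> - J \<omega>) \<le> ennreal \<epsilon>" for \<epsilon>
    using I by (intro exI[of _ \<phi>] exI[of _ I]) simp
qed

lemma has_ito_integral_scale: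
  assumes "has_ito_integral M F B \<phi> I"
  shows "has_ito_integral M F B (\<lambda>s \<omega>. c * \<phi> s \<omega>) (\<lambda>\<omega>. c * I \<omega>)"
proof (rule has_ito_integral_closure)
  note m = has_ito_integral_measurable[OF assms]
  show "process_measurable (\<lambda>s \<omega>. c * \<phi> s \<omega>)" by (rule process_measurable_scale[OF m(1)])
  show "(\<lambda>\<omega>. c * I \<omega>) \<in> borel_measurable M" using m(2) by simp
  fix \<epsilon> :: real assume "\<epsilon> > 0"
  define \<delta> where "\<delta> = \<epsilon> / (c\<^sup>2 + 1)"
  have c: "c\<^sup>2 + 1 > 0" using zero_le_power2[of c] by linarith
  have \<delta>: "\<delta> > 0" "c\<^sup>2 * \<delta> \<le> \<epsilon>"
    using \<open>\<epsilon> > 0\<close> c by (auto simp: \<delta>_def field_simps)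
  obtain e J where e: "simple_ito e J" "sqnorm_process (\<lambda>s \<omega>. e s \<omega> - \<phi> s \<omega>) \<le> ennreal \<delta>"
    "sqnorm_rv (\<lambda>\<omega>. J \<omega> - I \<omega>) \<le> ennreal \<delta>"
    using has_ito_integral_approx[OF assms \<delta>(1)] .
  note m' = simple_ito_process_measurable[OF e(1)] simple_ito_measurable(2)[OF e(1)]
  have le: "ennreal (c\<^sup>2) * x \<le> ennreal \<epsilon>" if "x \<le> ennreal \<delta>" for x
  proof -
    have "ennreal (c\<^sup>2) * x \<le> ennreal (c\<^sup>2) * ennreal \<delta>" using that by (intro mult_left_mono) auto
    also have "\<dots> = ennreal (c\<^sup>2 * \<delta>)" using \<delta>(1) by (simp add: ennreal_mult)
    also have "\<dots> \<le> ennreal \<epsilon>" using \<delta>(2) by (rule ennreal_leI)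
    finally show ?thesis .
  qed
  have 1: "sqnorm_process (\<lambda>s \<omega>. c * e s \<omega> - c * \<phi> s \<omega>) \<le> ennreal \<epsilon>"
    using sqnorm_process_scale[OF process_measurable_diff[OF m'(1) m(1)], of c] le[OF e(2)]
    by (simp add: right_diff_distrib)
  have 2: "sqnorm_rv (\<lambda>\<omega>. c * J \<omega> - c * I \<omega>) \<le> ennreal \<epsilon>"
    using sqnorm_rv_scale[OF borel_measurable_diff[OF m'(2) m(2)], of c] le[OF e(3)]
    by (simp add: right_diff_distrib)
  show "\<exists>\<psi> J. has_ito_integral M F B \<psi> J \<and>
      sqnorm_process (\<lambda>s \<omega>. \<psi> s \<omega> - c * \<phi> s \<omega>) \<le> ennreal \<epsilon> \<and> sqnorm_rv (\<lambda>\<omega>. J \<omega> - c * I \<omega>) \<le> ennreal \<epsilon>"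
    using simple_ito_has_ito_integral[OF simple_ito_scale[OF e(1), of c]] 1 2 by blast
qed

lemma has_ito_integral_add:
  assumes "has_ito_integral M F B \<phi> I" "has_ito_integral M F B \<phi>' I'"
  shows "has_ito_integral M F B (\<lambda>s \<omega>. \<phi> s \<omega> + \<phi>' s \<omega>) (\<lambda>\<omega>. I \<omega> + I' \<omega>)"
proof (rule has_ito_integral_closure)
  note m = has_ito_integral_measurable[OF assms(1)] has_ito_integral_measurable[OF assms(2)]
  show "process_measurable (\<lambda>s \<omega>. \<phi> s \<omega> + \<phi>' s \<omega>)" by (intro process_measurable_add m)
  show "(\<lambda>\<omega>. I \<omega> + I' \<omega>) \<in> borel_measurable M" using m by simp
  fix \<epsilon> :: real assume "\<epsilon> > 0"
  note eps = ennreal_double_quarters[OF \<open>\<epsilon> > 0\<close>]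
  have pos: "\<epsilon> / 4 > 0" using \<open>\<epsilon> > 0\<close> by simp
  obtain e J where e: "simple_ito e J" "sqnorm_process (\<lambda>s \<omega>. e s \<omega> - \<phi> s \<omega>) \<le> ennreal (\<epsilon> / 4)"
    "sqnorm_rv (\<lambda>\<omega>. J \<omega> - I \<omega>) \<le> ennreal (\<epsilon> / 4)"
    using has_ito_integral_approx[OF assms(1) pos] .
  obtain e' J' where e': "simple_ito e' J'" "sqnorm_process (\<lambda>s \<omega>. e' s \<omega> - \<phi>' s \<omega>) \<le> ennreal (\<epsilon> / 4)"
    "sqnorm_rv (\<lambda>\<omega>. J' \<omega> - I' \<omega>) \<le> ennreal (\<epsilon> / 4)"
    using has_ito_integral_approx[OF assms(2) pos] .
  note m' = simple_ito_process_measurable[OF e(1)] simple_ito_measurable(2)[OF e(1)]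
    simple_ito_process_measurable[OF e'(1)] simple_ito_measurable(2)[OF e'(1)]
  have "sqnorm_process (\<lambda>s \<omega>. e s \<omega> + e' s \<omega> - (\<phi> s \<omega> + \<phi>' s \<omega>))
    = sqnorm_process (\<lambda>s \<omega>. (e s \<omega> - \<phi> s \<omega>) + (e' s \<omega> - \<phi>' s \<omega>))" by (simp add: algebra_simps)
  also have "\<dots> \<le> 2 * (sqnorm_process (\<lambda>s \<omega>. e s \<omega> - \<phi> s \<omega>) + sqnorm_process (\<lambda>s \<omega>. e' s \<omega> - \<phi>' s \<omega>))"
    by (intro sqnorm_process_add_le process_measurable_diff m m')
  also have "\<dots> \<le> 2 * (ennreal (\<epsilon> / 4) + ennreal (\<epsilon> / 4))"
    using e e' by (intro mult_left_mono add_mono) auto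
  finally have 1: "sqnorm_process (\<lambda>s \<omega>. e s \<omega> + e' s \<omega> - (\<phi> s \<omega> + \<phi>' s \<omega>)) \<le> ennreal \<epsilon>"
    by (simp only: eps)
  have "sqnorm_rv (\<lambda>\<omega>. J \<omega> + J' \<omega> - (I \<omega> + I' \<omega>))
    = sqnorm_rv (\<lambda>\<omega>. (J \<omega> - I \<omega>) + (J' \<omega> - I' \<omega>))" by (simp add: algebra_simps)
  also have "\<dots> \<le> 2 * (sqnorm_rv (\<lambda>\<omega>. J \<omega> - I \<omega>) + sqnorm_rv (\<lambda>\<omega>. J' \<omega> - I' \<omega>))"
    by (intro sqnorm_rv_add_le borel_measurable_diff m m')
  also have "\<dots> \<le> 2 * (ennreal (\<epsilon> / 4) + ennreal (\<epsilon> / 4))"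
    using e e' by (intro mult_left_mono add_mono) auto
  finally have 2: "sqnorm_rv (\<lambda>\<omega>. J \<omega> + J' \<omega> - (I \<omega> + I' \<omega>)) \<le> ennreal \<epsilon>" by (simp only: eps)
  show "\<exists>\<psi> J. has_ito_integral M F B \<psi> J \<and>
      sqnorm_process (\<lambda>s \<omega>. \<psi> s \<omega> - (\<phi> s \<omega> + \<phi>' s \<omega>)) \<le> ennreal \<epsilon> \<and>
      sqnorm_rv (\<lambda>\<omega>. J \<omega> - (I \<omega> + I' \<omega>)) \<le> ennreal \<epsilon>"
    using simple_ito_has_ito_integral[OF simple_ito_add[OF e(1) e'(1)]] 1 2 by blast
qed

lemma has_ito_integral_diff:
  assumes "has_ito_integral M F B \<phi> I" "has_ito_integral M F B \<phi>' I'"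
  shows "has_ito_integral M F B (\<lambda>s \<omega>. \<phi> s \<omega> - \<phi>' s \<omega>) (\<lambda>\<omega>. I \<omega> - I' \<omega>)"
  using has_ito_integral_add[OF assms(1) has_ito_integral_scale[OF assms(2), of "-1"]] by simp

lemma has_ito_integral_zero: "has_ito_integral M F B (\<lambda>s \<omega>. 0) (\<lambda>\<omega>. 0)"
proof (rule simple_ito_has_ito_integral)
  have "elementary_integrand M F 0 (\<lambda>_. 0) (\<lambda>_ _. 0)" by (simp add: elementary_integrand_def)
  moreover have "(\<lambda>s \<omega>. 0) = elementary_process 0 (\<lambda>_. 0) (\<lambda>_ _. 0 :: real)"
    "(\<lambda>\<omega>. 0) = elementary_ito B 0 (\<lambda>_. 0) (\<lambda>_ _. 0)"
    by (simp_all add: elementary_process_def elementary_ito_def fun_eq_iff)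
  ultimately show "simple_ito (\<lambda>s \<omega>. 0) (\<lambda>\<omega>. 0)" unfolding simple_ito_def by blast
qed

lemma has_ito_integral_sum:
  fixes n :: nat
  assumes "\<And>i. i < n \<Longrightarrow> has_ito_integral M F B (\<phi> i) (I i)"
  shows "has_ito_integral M F B (\<lambda>s \<omega>. \<Sum>i<n. \<phi> i s \<omega>) (\<lambda>\<omega>. \<Sum>i<n. I i \<omega>)"
  using assms
proof (induction n)
  case 0
  show ?case using has_ito_integral_zero by simp
next
  case (Suc n)
  then show ?case using has_ito_integral_add by simp
qed

lemma sqnorm_rv_eq_0:
  assumes [measurable]: "I \<in> borel_measurable M" and "sqnorm_rv I = 0"
  shows "AE \<omega> in M. I \<omega> = 0"
proof -
  have "AE \<omega> in M. ennreal ((I \<omega>)\<^sup>2) = 0"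
    using assms(2) by (subst (asm) sqnorm_rv_def, subst (asm) nn_integral_0_iff_AE) auto
  then show ?thesis by eventually_elim (simp add: ennreal_eq_0_iff)
qed

lemma has_ito_integral_unique:
  assumes "has_ito_integral M F B \<phi> I" "has_ito_integral M F B \<psi> J"
    and ae: "AE x in completion (lborel \<Otimes>\<^sub>M M). \<phi> (fst x) (snd x) = \<psi> (fst x) (snd x)"
  shows "AE \<omega> in M. I \<omega> = J \<omega>"
proof -
  have "sqnorm_process (\<lambda>s \<omega>. \<phi> s \<omega> - \<psi> s \<omega>) = 0"
    by (rule sqnorm_process_diff_eq_0[OF ae])
  then have "sqnorm_rv (\<lambda>\<omega>. I \<omega> - J \<omega>) = 0"
    using has_ito_integral_sqnorm_le[OF has_ito_integral_diff[OF assms(1,2)]] by simp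
  then have "AE \<omega> in M. I \<omega> - J \<omega> = 0"
    using has_ito_integral_measurable[OF assms(1)] has_ito_integral_measurable[OF assms(2)]
    by (intro sqnorm_rv_eq_0) auto
  then show ?thesis by eventually_elim simp
qed

lemma borel_measurable_F_cong_AE:
  fixes f g :: "'a \<Rightarrow> real"
  assumes f: "f \<in> borel_measurable (F t)" and ae: "AE \<omega> in M. f \<omega> = g \<omega>"
  shows "g \<in> borel_measurable (F t)"
proof (rule measurableI)
  define N where "N = {\<omega> \<in> space M. \<not> f \<omega> = g \<omega>}"
  have N: "N \<in> null_sets M" using ae unfolding N_def AE_iff_null_sets .
  fix A :: "real set" assume "A \<in> sets borel"
  then have fA: "f -` A \<inter> space M \<in> sets (F t)" using measurable_sets[OF f] by (simp add: space_F)
  have "N \<in> sets (F t)" using N null_sets_F by blast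
  moreover have "g -` A \<inter> N \<in> sets (F t)"
    using complete2[OF _ N, of "g -` A \<inter> N"] null_sets_F[of t] by blast
  moreover have "g -` A \<inter> space (F t) = (f -` A \<inter> space M - N) \<union> (g -` A \<inter> N)"
    by (auto simp: N_def space_F)
  ultimately show "g -` A \<inter> space (F t) \<in> sets (F t)" using fA by simp
qed simp

text \<open>
  The integral over \<open>(-\<infinity>, t]\<close> is \<open>F t\<close>-measurable: the approximating elementary processes can be
  truncated at \<open>t\<close>, and by completeness \<open>F t\<close> is closed under almost sure limits.
\<close>

lemma has_ito_integral_adapted:
  assumes I: "has_ito_integral M F B \<phi> I" and zero: "\<And>s \<omega>. s > t \<Longrightarrow> \<phi> s \<omega> = 0"
  shows "I \<in> borel_measurable (F t)"
proof -
  note m [measurable] = has_ito_integral_measurable[OF I]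
  have "\<exists>J. J \<in> borel_measurable (F t) \<and> sqnorm_rv (\<lambda>\<omega>. J \<omega> - I \<omega>) \<le> 4 * ennreal ((1/2) ^ k)" for k
  proof -
    obtain e L where e: "simple_ito e L" "sqnorm_process (\<lambda>s \<omega>. e s \<omega> - \<phi> s \<omega>) \<le> ennreal ((1/2) ^ k)"
      "sqnorm_rv (\<lambda>\<omega>. L \<omega> - I \<omega>) \<le> ennreal ((1/2) ^ k)"
      using has_ito_integral_approx[OF I, of "(1/2) ^ k"] by auto
    obtain J where J: "simple_ito (\<lambda>s \<omega>. indicator {..t} s * e s \<omega>) J" "J \<in> borel_measurable (F t)"
      using simple_ito_truncate[OF e(1)] .
    have "sqnorm_rv (\<lambda>\<omega>. J \<omega> - I \<omega>) \<le> 4 * sqnorm_process (\<lambda>s \<omega>. indicator {..t} s * e s \<omega> - \<phi> s \<omega>)"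
      by (intro has_ito_integral_sqnorm_le has_ito_integral_diff I simple_ito_has_ito_integral J)
    also have "\<dots> \<le> 4 * sqnorm_process (\<lambda>s \<omega>. e s \<omega> - \<phi> s \<omega>)"
      unfolding sqnorm_process_def
      by (intro mult_left_mono nn_integral_mono) (auto simp: indicator_def zero intro!: ennreal_leI)
    also have "\<dots> \<le> 4 * ennreal ((1/2) ^ k)" using e(2) by (intro mult_left_mono) auto
    finally show ?thesis using J(2) by blast
  qed
  then obtain J where J: "\<And>k. J k \<in> borel_measurable (F t)"
    "\<And>k. sqnorm_rv (\<lambda>\<omega>. J k \<omega> - I \<omega>) \<le> 4 * ennreal ((1/2) ^ k)"
    by metis
  have [measurable]: "J k \<in> borel_measurable M" for k by (rule borel_measurable_of_F[OF J(1)])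
  \<comment> \<open>Summability of the squared errors gives almost sure convergence without subsequences.\<close>
  have "(\<integral>\<^sup>+\<omega>. (\<Sum>k. ennreal ((J k \<omega> - I \<omega>)\<^sup>2)) \<partial>M) = (\<Sum>k. sqnorm_rv (\<lambda>\<omega>. J k \<omega> - I \<omega>))"
    unfolding sqnorm_rv_def by (rule nn_integral_suminf) simp
  also have "\<dots> \<le> (\<Sum>k. 4 * ennreal ((1/2) ^ k))" by (intro suminf_le J(2)) auto
  also have "\<dots> = 4 * ennreal (\<Sum>k. (1/2) ^ k)"
    by (simp add: suminf_ennreal2 ennreal_suminf_cmult summable_geometric)
  also have "\<dots> < \<infinity>" by (simp add: ennreal_mult_less_top)
  finally have "AE \<omega> in M. (\<Sum>k. ennreal ((J k \<omega> - I \<omega>)\<^sup>2)) \<noteq> \<infinity>"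
    by (intro nn_integral_noteq_infinite) auto
  then have "AE \<omega> in M. lim (\<lambda>k. J k \<omega>) = I \<omega>"
  proof eventually_elim
    case (elim \<omega>)
    then have "summable (\<lambda>k. (J k \<omega> - I \<omega>)\<^sup>2)"
      by (intro summable_suminf_not_top) auto
    then have "(\<lambda>k. (J k \<omega> - I \<omega>)\<^sup>2) \<longlonglongrightarrow> 0" by (rule summable_LIMSEQ_zero)
    then have "(\<lambda>k. J k \<omega> - I \<omega>) \<longlonglongrightarrow> 0"
      using tendsto_real_sqrt[of "\<lambda>k. (J k \<omega> - I \<omega>)\<^sup>2" 0 sequentially] by (simp add: tendsto_rabs_zero_iff)
    then have "(\<lambda>k. J k \<omega>) \<longlonglongrightarrow> I \<omega>" by (simp add: LIM_zero_iff)
    then show ?case by (rule limI)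
  qed
  moreover have "(\<lambda>\<omega>. lim (\<lambda>k. J k \<omega>)) \<in> borel_measurable (F t)"
    by (rule borel_measurable_lim_metric) (rule J(1))
  ultimately show ?thesis by (rule borel_measurable_F_cong_AE[rotated])
qed

end

section \<open>Stochastic Fubini theorem\<close>

lemma AE_integrable_of_sqnorm_bound:
  fixes Y :: "real \<Rightarrow> 'c \<Rightarrow> real" and d :: "real \<Rightarrow> real"
  assumes N: "finite_measure N" and P: "sigma_finite_measure P"
    and Y [measurable]: "(\<lambda>(u, y). Y u y) \<in> borel_measurable (N \<Otimes>\<^sub>M P)"
    and d [measurable]: "d \<in> borel_measurable N" and d_pos: "\<And>u. 0 < d u" and c: "0 \<le> c"
    and bound: "\<And>u. (\<integral>\<^sup>+y. (Y u y)\<^sup>2 \<partial>P) \<le> ennreal (c * (d u)\<^sup>2)"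
    and fin: "(\<integral>\<^sup>+u. d u \<partial>N) < \<infinity>"
  shows "AE y in P. integrable N (\<lambda>u. Y u y)"
    and "(\<integral>\<^sup>+y. ennreal ((LINT u|N. Y u y)\<^sup>2) \<partial>P) < \<infinity>"
proof -
  interpret N: finite_measure N by fact
  interpret P: sigma_finite_measure P by fact
  have sN: "sigma_finite_measure N" by unfold_locales
  have "(\<integral>\<^sup>+y. (\<integral>\<^sup>+u. \<bar>Y u y\<bar> \<partial>N)\<^sup>2 \<partial>P) \<le> ennreal c * (\<integral>\<^sup>+u. d u \<partial>N)\<^sup>2"
    by (rule nn_integral_Minkowski_square[OF sN P Y d d_pos c]) (simp add: bound)
  also have "\<dots> < \<infinity>"
    using fin by (simp add: ennreal_mult_less_top power2_eq_square)
  finally have *: "(\<integral>\<^sup>+y. (\<integral>\<^sup>+u. \<bar>Y u y\<bar> \<partial>N)\<^sup>2 \<partial>P) < \<infinity>" .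
  then have "AE y in P. (\<integral>\<^sup>+u. \<bar>Y u y\<bar> \<partial>N)\<^sup>2 \<noteq> \<infinity>"
    by (intro nn_integral_noteq_infinite) auto
  with AE_space show ae: "AE y in P. integrable N (\<lambda>u. Y u y)"
  proof eventually_elim
    case (elim y)
    note [measurable] = elim(1)
    have "(\<integral>\<^sup>+u. \<bar>Y u y\<bar> \<partial>N) < \<infinity>"
      using elim(2) by (cases "(\<integral>\<^sup>+u. \<bar>Y u y\<bar> \<partial>N) = \<infinity>") (auto simp: less_top)
    then show ?case by (intro integrableI_bounded) auto
  qed
  have "(\<integral>\<^sup>+y. ennreal ((LINT u|N. Y u y)\<^sup>2) \<partial>P) \<le> (\<integral>\<^sup>+y. (\<integral>\<^sup>+u. \<bar>Y u y\<bar> \<partial>N)\<^sup>2 \<partial>P)"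
  proof (rule nn_integral_mono_AE, use ae in eventually_elim)
    case (elim y)
    have "ennreal \<bar>LINT u|N. Y u y\<bar> \<le> (\<integral>\<^sup>+u. \<bar>Y u y\<bar> \<partial>N)"
      using integral_norm_bound_ennreal[OF elim] by simp
    from power_mono[OF this, of 2] show ?case
      by (simp add: ennreal_power)
  qed
  then show "(\<integral>\<^sup>+y. ennreal ((LINT u|N. Y u y)\<^sup>2) \<partial>P) < \<infinity>" using * by simp
qed

text \<open>
  Minkowski's inequality for the error in replacing the integral of the \<open>L\<^sup>2(P)\<close>-valued function
  \<open>u \<mapsto> Y u\<close> by that of a step function \<open>\<Sum>i<n. indicator (A i) * Y (q i)\<close>.
\<close>

lemma step_function_integral_error:
  fixes Y :: "real \<Rightarrow> 'c \<Rightarrow> real" and d :: "real \<Rightarrow> real" and n :: nat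
  assumes N: "finite_measure N" and P: "sigma_finite_measure P"
    and Y [measurable]: "(\<lambda>(u, y). Y u y) \<in> borel_measurable (N \<Otimes>\<^sub>M P)"
    and q: "\<And>i. q i \<in> space N" and A [measurable]: "\<And>i. A i \<in> sets N"
    and d [measurable]: "d \<in> borel_measurable N" and d_pos: "\<And>u. 0 < d u" and c: "0 \<le> c"
    and int: "AE y in P. integrable N (\<lambda>u. Y u y)"
    and bound: "\<And>u. (\<integral>\<^sup>+y. (Y u y - (\<Sum>i<n. indicator (A i) u * Y (q i) y))\<^sup>2 \<partial>P)
      \<le> ennreal (c * (d u)\<^sup>2)"
  shows "(\<integral>\<^sup>+y. ennreal (((\<Sum>i<n. measure N (A i) * Y (q i) y) - (LINT u|N. Y u y))\<^sup>2) \<partial>P)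
    \<le> ennreal c * (\<integral>\<^sup>+u. d u \<partial>N)\<^sup>2"
proof -
  interpret N: finite_measure N by fact
  have sN: "sigma_finite_measure N" by unfold_locales
  have Yq [measurable]: "Y (q i) \<in> borel_measurable P" for i
    using measurable_compose[OF measurable_Pair1'[OF q[of i], of P] Y] by simp
  let ?h = "\<lambda>u y. Y u y - (\<Sum>i<n. indicator (A i) u * Y (q i) y)"
  have "(\<integral>\<^sup>+y. ennreal (((\<Sum>i<n. measure N (A i) * Y (q i) y) - (LINT u|N. Y u y))\<^sup>2) \<partial>P)
    \<le> (\<integral>\<^sup>+y. (\<integral>\<^sup>+u. \<bar>?h u y\<bar> \<partial>N)\<^sup>2 \<partial>P)"
  proof (rule nn_integral_mono_AE, use int in eventually_elim)
    case (elim y)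
    have ind: "integrable N (\<lambda>u. indicator (A i) u * Y (q i) y)" for i
      by (intro integrable_mult_left integrable_real_indicator A) (simp add: N.emeasure_finite less_top[symmetric])
    have inth: "integrable N (\<lambda>u. ?h u y)"
      using elim ind by (intro Bochner_Integration.integrable_diff Bochner_Integration.integrable_sum) auto
    have "(LINT u|N. ?h u y) = (LINT u|N. Y u y) - (LINT u|N. (\<Sum>i<n. indicator (A i) u * Y (q i) y))"
      using elim ind by (intro Bochner_Integration.integral_diff Bochner_Integration.integrable_sum) auto
    also have "(LINT u|N. (\<Sum>i<n. indicator (A i) u * Y (q i) y))
        = (\<Sum>i<n. (LINT u|N. indicator (A i) u * Y (q i) y))"
      by (rule Bochner_Integration.integral_sum) (rule ind)
    also have "\<dots> = (\<Sum>i<n. measure N (A i) * Y (q i) y)"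
      using sets.sets_into_space[OF A]
      by (intro sum.cong refl) (simp add: Int_absorb2)
    finally have eq: "(LINT u|N. ?h u y) = (LINT u|N. Y u y) - (\<Sum>i<n. measure N (A i) * Y (q i) y)" .
    have "ennreal \<bar>LINT u|N. ?h u y\<bar> \<le> (\<integral>\<^sup>+u. \<bar>?h u y\<bar> \<partial>N)"
      using integral_norm_bound_ennreal[OF inth] by simp
    from power_mono[OF this, of 2]
    have "ennreal ((LINT u|N. ?h u y)\<^sup>2) \<le> (\<integral>\<^sup>+u. \<bar>?h u y\<bar> \<partial>N)\<^sup>2"
      by (simp add: ennreal_power)
    then show ?case unfolding eq by (simp add: power2_commute)
  qed
  also have "\<dots> \<le> ennreal c * (\<integral>\<^sup>+u. d u \<partial>N)\<^sup>2"
  proof (rule nn_integral_Minkowski_square[OF sN P _ d d_pos c])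
    show "(\<lambda>(u, y). ?h u y) \<in> borel_measurable (N \<Otimes>\<^sub>M P)" by measurable
    show "AE u in N. (\<integral>\<^sup>+y. (?h u y)\<^sup>2 \<partial>P) \<le> ennreal (c * (d u)\<^sup>2)"
      by (rule AE_I2) (rule bound)
  qed
  finally show ?thesis .
qed

context volterra_kernel
begin

lemma K_measurable [measurable (raw)]:
  assumes [measurable]: "f \<in> borel_measurable N" "g \<in> borel_measurable N"
  shows "(\<lambda>x. K (f x) (g x)) \<in> borel_measurable N"
proof -
  have "(\<lambda>(t, s). K t s) \<in> borel_measurable (borel \<Otimes>\<^sub>M borel)"
    using measurable_K by (simp add: borel_prod)
  from measurable_compose[OF measurable_Pair[OF assms] this] show ?thesis by simp
qed

text \<open>The \<open>L\<^sup>2\<close> norm of \<open>K(u, \<cdot>)\<close>.\<close>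

definition kernel_norm :: "real \<Rightarrow> real" where
  "kernel_norm u = sqrt (LINT r:{..u}|lborel. (K u r)\<^sup>2)"

lemma kernel_norm_nonneg: "0 \<le> kernel_norm u"
  by (simp add: kernel_norm_def set_lebesgue_integral_def)

lemma nn_integral_kernel_square: "(\<integral>\<^sup>+s. ennreal ((K u s)\<^sup>2) \<partial>lborel) = ennreal ((kernel_norm u)\<^sup>2)"
proof -
  have eq: "(\<lambda>s. indicator {..u} s *\<^sub>R (K u s)\<^sup>2) = (\<lambda>s. (K u s)\<^sup>2)"
    using causal by (auto simp: fun_eq_iff indicator_def not_le)
  have "integrable lborel (\<lambda>s. (K u s)\<^sup>2)"
    using square_integrable[of u] unfolding set_integrable_def eq .
  then have "(\<integral>\<^sup>+s. ennreal ((K u s)\<^sup>2) \<partial>lborel) = ennreal (LINT s|lborel. (K u s)\<^sup>2)"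
    by (intro nn_integral_eq_integral) auto
  also have "(LINT s|lborel. (K u s)\<^sup>2) = (kernel_norm u)\<^sup>2"
    unfolding kernel_norm_def set_lebesgue_integral_def eq by simp
  finally show ?thesis .
qed

lemma kernel_norm_measurable [measurable]: "kernel_norm \<in> borel_measurable borel"
proof -
  have "kernel_norm = (\<lambda>u. sqrt (enn2real (\<integral>\<^sup>+s. ennreal ((K u s)\<^sup>2) \<partial>lborel)))"
    by (simp add: nn_integral_kernel_square kernel_norm_nonneg)
  also have "\<dots> \<in> borel_measurable borel" by measurable
  finally show ?thesis .
qed

text \<open>By continuity in \<open>L\<^sup>2(ds)\<close> the kernels at rational times are dense in \<open>{K u | u}\<close>.\<close>

lemma kernel_dense_approx:
  assumes "\<delta> > 0"
  shows "\<exists>n. (\<integral>\<^sup>+s. ennreal ((K u s - K (from_nat_into \<rat> n) s)\<^sup>2) \<partial>lborel) \<le> ennreal (\<delta>\<^sup>2)"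
proof -
  have "ennreal (\<delta>\<^sup>2) > 0" using assms by simp
  then have "\<forall>\<^sub>F t in at u. (\<integral>\<^sup>+s. ennreal ((K t s - K u s)\<^sup>2) \<partial>lborel) < ennreal (\<delta>\<^sup>2)"
    using order_tendstoD(2)[OF L2_continuous[of u]] by simp
  then obtain e where e: "e > 0"
    "\<And>t. t \<noteq> u \<Longrightarrow> dist t u < e \<Longrightarrow> (\<integral>\<^sup>+s. ennreal ((K t s - K u s)\<^sup>2) \<partial>lborel) < ennreal (\<delta>\<^sup>2)"
    by (auto simp: eventually_at)
  obtain r where r: "r \<in> \<rat>" "u < r" "r < u + e"
    using Rats_dense_in_real[of u "u + e"] e(1) by auto
  obtain n where "from_nat_into \<rat> n = r"
    using from_nat_into_surj[OF countable_rat r(1)] by blast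
  then show ?thesis
    using e(2)[of r] r by (intro exI[of _ n]) (auto simp: dist_real_def power2_commute less_imp_le)
qed

end

text \<open>
  A volatility modulated Volterra process, together with a bound \<open>C\<close> for the second moments of its
  volatility.
\<close>

locale vmv_setting =
  two_sided_brownian_motion M F B + volterra_kernel K
  for M :: "'a measure" and F :: "real \<Rightarrow> 'a measure" and B and K +
  fixes \<sigma> X :: "real \<Rightarrow> 'a \<Rightarrow> real" and C :: real
  assumes volatility: "volatility_process M F \<sigma>"
    and vmv: "vmv_process M F B K \<sigma> X"
    and C_nonneg: "0 \<le> C"
    and second_moment_\<sigma>: "(\<integral>\<^sup>+\<omega>. ennreal ((\<sigma> t \<omega>)\<^sup>2) \<partial>M) \<le> ennreal C"
begin

lemma X_measurable [measurable (raw)]: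
  assumes [measurable]: "f \<in> borel_measurable N" "g \<in> measurable N M"
  shows "(\<lambda>x. X (f x) (g x)) \<in> borel_measurable N"
proof -
  have "(\<lambda>(t, \<omega>). X t \<omega>) \<in> borel_measurable (restrict_space borel UNIV \<Otimes>\<^sub>M M)"
    using vmv by (simp add: vmv_process_def measurable_process_def)
  moreover have "sets (restrict_space borel UNIV \<Otimes>\<^sub>M M) = sets (borel \<Otimes>\<^sub>M M)"
    by (intro sets_pair_measure_cong) (auto simp: sets_restrict_space)
  ultimately have "(\<lambda>(t, \<omega>). X t \<omega>) \<in> borel_measurable (borel \<Otimes>\<^sub>M M)"
    using measurable_cong_sets by blast
  from measurable_compose[OF measurable_Pair[OF assms] this] show ?thesis by simp
qed

text \<open>By left continuity \<open>\<sigma>\<close> is the pointwise limit of its values at points of the grids \<open>\<int> / n\<close>.\<close>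

lemma \<sigma>_measurable [measurable (raw)]:
  assumes [measurable]: "f \<in> borel_measurable N" "g \<in> measurable N M"
  shows "(\<lambda>x. \<sigma> (f x) (g x)) \<in> borel_measurable N"
proof -
  define a :: "nat \<Rightarrow> real \<Rightarrow> real" where
    "a n s = (real_of_int \<lceil>real (Suc n) * s\<rceil> - 1) / real (Suc n)" for n s
  have [measurable]: "\<sigma> t \<in> borel_measurable M" for t
    by (rule borel_measurable_of_F[of _ t]) (use volatility in \<open>simp add: volatility_process_def\<close>)
  have "(\<lambda>x. \<sigma> (a n (f x)) (g x)) \<in> borel_measurable N" for n
  proof -
    have "(\<lambda>x. \<sigma> ((real_of_int \<lceil>real (Suc n) * f x\<rceil> - 1) / real (Suc n)) (g x)) \<in> borel_measurable N"
      by (rule measurable_compose_countable[where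
            f="\<lambda>i x. \<sigma> ((real_of_int i - 1) / real (Suc n)) (g x)" and g="\<lambda>x. \<lceil>real (Suc n) * f x\<rceil>"])
        measurable
    then show ?thesis by (simp only: a_def)
  qed
  moreover have "(\<lambda>n. \<sigma> (a n (f x)) (g x)) \<longlonglongrightarrow> \<sigma> (f x) (g x)" if "x \<in> space N" for x
  proof -
    have "g x \<in> space M" using measurable_space[OF assms(2) that] .
    then have lc: "((\<lambda>t. \<sigma> t (g x)) \<longlongrightarrow> \<sigma> (f x) (g x)) (at_left (f x))"
      using volatility by (auto simp: volatility_process_def caglad_def)
    let ?s = "f x"
    have less: "a n ?s < ?s" and ge: "?s - 1 / real (Suc n) \<le> a n ?s" for n
    proof -
      have pos: "real (Suc n) > 0" by simp
      have "real_of_int \<lceil>real (Suc n) * ?s\<rceil> - 1 < real (Suc n) * ?s" by linarith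
      then have "real_of_int \<lceil>real (Suc n) * ?s\<rceil> - 1 < ?s * real (Suc n)"
        by (simp only: mult.commute)
      then show "a n ?s < ?s" unfolding a_def by (subst pos_divide_less_eq[OF pos])
      have "real (Suc n) * ?s - 1 \<le> real_of_int \<lceil>real (Suc n) * ?s\<rceil> - 1" by linarith
      then have "(real (Suc n) * ?s - 1) / real (Suc n) \<le> a n ?s"
        unfolding a_def using pos by (intro divide_right_mono) auto
      also have "(real (Suc n) * ?s - 1) / real (Suc n) = ?s - 1 / real (Suc n)"
        by (simp only: diff_divide_distrib) simp
      finally show "?s - 1 / real (Suc n) \<le> a n ?s" .
    qed
    have "(\<lambda>n. ?s - 1 / real (Suc n)) \<longlonglongrightarrow> ?s - 0"
      by (intro tendsto_diff tendsto_const LIMSEQ_Suc[OF lim_1_over_n])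
    then have lim: "(\<lambda>n. ?s - 1 / real (Suc n)) \<longlonglongrightarrow> ?s" by (simp only: diff_zero)
    have "(\<lambda>n. a n ?s) \<longlonglongrightarrow> ?s"
      by (rule tendsto_sandwich[OF always_eventually always_eventually lim tendsto_const])
        (use ge less_imp_le[OF less] in blast)+
    then have "filterlim (\<lambda>n. a n ?s) (at_left ?s) sequentially"
      using less less_imp_neq[OF less] by (auto simp: filterlim_at intro: always_eventually)
    from filterlim_compose[OF lc this] show ?thesis .
  qed
  ultimately show ?thesis by (rule borel_measurable_LIMSEQ_real[rotated])
qed

lemma kernel_process_measurable:
  assumes [measurable]: "k \<in> borel_measurable borel"
  shows "process_measurable (\<lambda>s \<omega>. k s * \<sigma> s \<omega>)"
  by (rule measurable_completion) measurable

lemma sqnorm_kernel_process_le: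
  assumes [measurable]: "k \<in> borel_measurable borel"
  shows "sqnorm_process (\<lambda>s \<omega>. k s * \<sigma> s \<omega>) \<le> ennreal C * (\<integral>\<^sup>+s. ennreal ((k s)\<^sup>2) \<partial>lborel)"
proof -
  have "sqnorm_process (\<lambda>s \<omega>. k s * \<sigma> s \<omega>)
    = (\<integral>\<^sup>+s. \<integral>\<^sup>+\<omega>. ennreal ((k s)\<^sup>2) * ennreal ((\<sigma> s \<omega>)\<^sup>2) \<partial>M \<partial>lborel)"
    unfolding sqnorm_process_def nn_integral_completion
    by (subst nn_integral_fst[symmetric]) (auto simp: split_beta' power_mult_distrib ennreal_mult)
  also have "\<dots> = (\<integral>\<^sup>+s. ennreal ((k s)\<^sup>2) * (\<integral>\<^sup>+\<omega>. ennreal ((\<sigma> s \<omega>)\<^sup>2) \<partial>M) \<partial>lborel)"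
    by (intro nn_integral_cong nn_integral_cmult) measurable
  also have "\<dots> \<le> (\<integral>\<^sup>+s. ennreal ((k s)\<^sup>2) * ennreal C \<partial>lborel)"
    by (intro nn_integral_mono mult_left_mono second_moment_\<sigma>) auto
  also have "\<dots> = ennreal C * (\<integral>\<^sup>+s. ennreal ((k s)\<^sup>2) \<partial>lborel)"
    by (subst nn_integral_multc) (auto simp: mult.commute)
  finally show ?thesis .
qed

lemma X_has_ito_integral: "has_ito_integral M F B (\<lambda>s \<omega>. K t s * \<sigma> s \<omega>) (X t)"
proof -
  have "(\<lambda>s \<omega>. indicator {..t} s * (K t s * \<sigma> s \<omega>)) = (\<lambda>s \<omega>. K t s * \<sigma> s \<omega>)"
    using causal by (auto simp: fun_eq_iff indicator_def not_le)
  moreover have "has_ito_integral M F B (\<lambda>s \<omega>. indicator {..t} s * (K t s * \<sigma> s \<omega>)) (X t)"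
    using vmv unfolding vmv_process_def by blast
  ultimately show ?thesis by (simp only:)
qed

lemma sqnorm_ito_kernel_le:
  assumes [measurable]: "k \<in> borel_measurable borel"
    and "has_ito_integral M F B (\<lambda>s \<omega>. k s * \<sigma> s \<omega>) I"
    and b: "(\<integral>\<^sup>+s. ennreal ((k s)\<^sup>2) \<partial>lborel) \<le> ennreal b"
  shows "sqnorm_rv I \<le> ennreal (4 * C * b)"
proof -
  have "sqnorm_rv I \<le> 4 * sqnorm_process (\<lambda>s \<omega>. k s * \<sigma> s \<omega>)"
    by (rule has_ito_integral_sqnorm_le) fact
  also have "\<dots> \<le> 4 * (ennreal C * ennreal b)"
    by (intro mult_left_mono order_trans[OF sqnorm_kernel_process_le[OF assms(1)]] b) auto
  also have "\<dots> = ennreal (4 * C * b)"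
    using C_nonneg by (simp add: ennreal_mult'' ennreal_mult' mult.assoc)
  finally show ?thesis .
qed

text \<open>
  Since \<open>\<parallel>K u \<sigma>\<parallel>\<^sup>2 \<le> C \<parallel>K u\<parallel>\<^sup>2\<close>, all estimates reduce to norms of the deterministic kernel.
\<close>

lemma stochastic_Fubini:
  assumes N: "finite_measure N" and sets_N [measurable_cong]: "sets N = sets borel"
    and fin: "(\<integral>\<^sup>+u. ennreal (kernel_norm u) \<partial>N) < \<infinity>"
  shows "AE s in lborel. integrable N (\<lambda>u. K u s)"
    and "(\<integral>\<^sup>+s. ennreal ((LINT u|N. K u s)\<^sup>2) \<partial>lborel) < \<infinity>"
    and "AE \<omega> in M. integrable N (\<lambda>u. X u \<omega>)"
    and "has_ito_integral M F B (\<lambda>s \<omega>. (LINT u|N. K u s) * \<sigma> s \<omega>) (\<lambda>\<omega>. LINT u|N. X u \<omega>)"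
proof -
  interpret N: finite_measure N by fact
  have space_N: "space N = UNIV" using sets_eq_imp_space_eq[OF sets_N] by simp
  have P: "sigma_finite_measure lborel" "sigma_finite_measure M" by unfold_locales
  have KN: "(\<lambda>(u, s). K u s) \<in> borel_measurable (N \<Otimes>\<^sub>M lborel)"
    and XN: "(\<lambda>(u, \<omega>). X u \<omega>) \<in> borel_measurable (N \<Otimes>\<^sub>M M)" by measurable
  have d1: "(\<lambda>u. kernel_norm u + 1) \<in> borel_measurable N" by measurable
  have d1_pos: "0 < kernel_norm u + 1" for u using kernel_norm_nonneg[of u] by simp
  have "(\<integral>\<^sup>+u. ennreal (kernel_norm u + 1) \<partial>N)
    = (\<integral>\<^sup>+u. ennreal (kernel_norm u) \<partial>N) + emeasure N (space N)"
    by (simp add: ennreal_plus kernel_norm_nonneg nn_integral_add)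
  then have d1_fin: "(\<integral>\<^sup>+u. ennreal (kernel_norm u + 1) \<partial>N) < \<infinity>"
    using fin N.emeasure_finite[of "space N"] by (simp add: less_top[symmetric] ennreal_add_eq_top)
  have le_d1: "(kernel_norm u)\<^sup>2 \<le> (kernel_norm u + 1)\<^sup>2" for u
    using kernel_norm_nonneg[of u] by (intro power_mono) auto
  have C4: "0 \<le> 4 * C" using C_nonneg by simp
  have K_bound: "(\<integral>\<^sup>+s. ennreal ((K u s)\<^sup>2) \<partial>lborel) \<le> ennreal (1 * (kernel_norm u + 1)\<^sup>2)" for u
    using le_d1[of u] by (simp add: nn_integral_kernel_square ennreal_leI)
  have X_bound: "(\<integral>\<^sup>+\<omega>. ennreal ((X u \<omega>)\<^sup>2) \<partial>M) \<le> ennreal (4 * C * (kernel_norm u + 1)\<^sup>2)" for u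
    using sqnorm_ito_kernel_le[OF _ X_has_ito_integral, of u] K_bound[of u] by (simp add: sqnorm_rv_def)
  show int_K: "AE s in lborel. integrable N (\<lambda>u. K u s)"
    and "(\<integral>\<^sup>+s. ennreal ((LINT u|N. K u s)\<^sup>2) \<partial>lborel) < \<infinity>"
    using AE_integrable_of_sqnorm_bound[OF N P(1) KN d1 d1_pos _ K_bound d1_fin] by auto
  show int_X: "AE \<omega> in M. integrable N (\<lambda>u. X u \<omega>)"
    using AE_integrable_of_sqnorm_bound[OF N P(2) XN d1 d1_pos C4 X_bound d1_fin] by auto
  have k [measurable]: "(\<lambda>s. LINT u|N. K u s) \<in> borel_measurable borel"
    by measurable
  show "has_ito_integral M F B (\<lambda>s \<omega>. (LINT u|N. K u s) * \<sigma> s \<omega>) (\<lambda>\<omega>. LINT u|N. X u \<omega>)"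
  proof (rule has_ito_integral_closure)
    show "process_measurable (\<lambda>s \<omega>. (LINT u|N. K u s) * \<sigma> s \<omega>)"
      by (rule kernel_process_measurable[OF k])
    show "(\<lambda>\<omega>. LINT u|N. X u \<omega>) \<in> borel_measurable M" by measurable
    fix \<epsilon> :: real assume "\<epsilon> > 0"
    define c where "c = measure N (space N) + 1"
    have c: "c > 0" unfolding c_def using measure_nonneg[of N "space N"] by linarith
    define \<delta> where "\<delta> = sqrt (\<epsilon> / (4 * C * c\<^sup>2 + 1))"
    have den: "4 * C * c\<^sup>2 + 1 > 0" using C_nonneg by (simp add: add_nonneg_pos)
    have \<delta>: "\<delta> > 0" using \<open>\<epsilon> > 0\<close> den by (simp add: \<delta>_def)
    have "(4 * C * c\<^sup>2 + 1) * \<delta>\<^sup>2 = \<epsilon>" using \<open>\<epsilon> > 0\<close> den by (simp add: \<delta>_def)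
    then have "4 * C * (\<delta> * c)\<^sup>2 + \<delta>\<^sup>2 = \<epsilon>" by (simp add: algebra_simps power_mult_distrib)
    then have \<delta>_le: "4 * C * (\<delta> * c)\<^sup>2 \<le> \<epsilon>" using zero_le_power2[of \<delta>] by linarith
    \<comment> \<open>\<open>\<nu> u\<close> is the index of the first rational whose kernel is \<open>\<delta>\<close>-close to that of \<open>u\<close>.\<close>
    define q where "q = from_nat_into (\<rat> :: real set)"
    define D where "D u v = (\<integral>\<^sup>+s. ennreal ((K u s - K v s)\<^sup>2) \<partial>lborel)" for u v
    define \<nu> where "\<nu> u = (LEAST i. D u (q i) \<le> ennreal (\<delta>\<^sup>2))" for u
    have \<nu>: "D u (q (\<nu> u)) \<le> ennreal (\<delta>\<^sup>2)" for u
      unfolding \<nu>_def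
    proof (rule LeastI_ex)
      show "\<exists>i. D u (q i) \<le> ennreal (\<delta>\<^sup>2)"
        unfolding D_def q_def by (rule kernel_dense_approx[OF \<delta>])
    qed
    have [measurable]: "(\<lambda>u. D u (q i)) \<in> borel_measurable borel" for i
      unfolding D_def by measurable
    have \<nu>_meas [measurable]: "\<nu> \<in> measurable borel (count_space UNIV)"
      unfolding \<nu>_def by measurable
    have "(\<lambda>m. \<integral>\<^sup>+u. ennreal (kernel_norm u) * indicator {u. m < \<nu> u} u \<partial>N) \<longlonglongrightarrow> (\<integral>\<^sup>+u. 0 \<partial>N)"
    proof (rule nn_integral_dominated_convergence[where w="\<lambda>u. ennreal (kernel_norm u)"])
      show "(\<integral>\<^sup>+u. ennreal (kernel_norm u) \<partial>N) < \<infinity>" by fact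
      show "AE u in N. (\<lambda>m. ennreal (kernel_norm u) * indicator {u. m < \<nu> u} u) \<longlonglongrightarrow> 0"
      proof (rule AE_I2)
        fix u
        have "\<forall>\<^sub>F m in sequentially. ennreal (kernel_norm u) * indicator {u. m < \<nu> u} u = 0"
          using eventually_ge_at_top[of "\<nu> u"] by eventually_elim simp
        then show "(\<lambda>m. ennreal (kernel_norm u) * indicator {u. m < \<nu> u} u) \<longlonglongrightarrow> 0"
          by (rule tendsto_eventually)
      qed
    qed (auto simp: indicator_def)
    then have "\<forall>\<^sub>F m in sequentially. (\<integral>\<^sup>+u. ennreal (kernel_norm u) * indicator {u. m < \<nu> u} u \<partial>N) < ennreal \<delta>"
      using \<delta> by (intro order_tendstoD(2)) auto
    then obtain m where m: "(\<integral>\<^sup>+u. ennreal (kernel_norm u) * indicator {u. m < \<nu> u} u \<partial>N) < ennreal \<delta>"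
      using eventually_happens[of _ sequentially] by auto
    define A where "A i = {u. \<nu> u = i}" for i
    have A: "A i \<in> sets N" for i unfolding A_def sets_N by measurable
    \<comment> \<open>A majorant of the error: at most \<open>\<delta>\<close> where \<open>\<nu> u \<le> m\<close>, and the full norm of \<open>K u\<close> elsewhere.\<close>
    define d where "d u = \<delta> + kernel_norm u * indicator {u. m < \<nu> u} u" for u
    have d [measurable]: "d \<in> borel_measurable N" unfolding d_def by measurable
    have d_pos: "0 < d u" for u using \<delta> kernel_norm_nonneg[of u] by (simp add: d_def add_pos_nonneg)
    have "(\<integral>\<^sup>+u. ennreal (d u) \<partial>N)
      = (\<integral>\<^sup>+u. ennreal \<delta> + ennreal (kernel_norm u) * indicator {u. m < \<nu> u} u \<partial>N)"
      using \<delta> kernel_norm_nonneg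
      by (intro nn_integral_cong) (auto simp: d_def indicator_def ennreal_plus)
    also have "\<dots> = ennreal \<delta> * emeasure N (space N)
        + (\<integral>\<^sup>+u. ennreal (kernel_norm u) * indicator {u. m < \<nu> u} u \<partial>N)"
      by (subst nn_integral_add) auto
    also have "\<dots> \<le> ennreal \<delta> * ennreal (measure N (space N)) + ennreal \<delta>"
      using m by (intro add_mono) (auto simp: N.emeasure_eq_measure)
    also have "\<dots> = ennreal (\<delta> * c)"
      using \<delta> by (simp add: c_def distrib_left ennreal_mult ennreal_plus)
    finally have d_le: "(\<integral>\<^sup>+u. ennreal (d u) \<partial>N) \<le> ennreal (\<delta> * c)" .
    \<comment> \<open>The step function takes the value \<open>Y (q (\<nu> u))\<close> if \<open>\<nu> u \<le> m\<close> and vanishes otherwise.\<close>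
    have step: "(\<Sum>i<Suc m. indicator (A i) u * g (q i)) = (if \<nu> u \<le> m then g (q (\<nu> u)) else 0)"
      for u and g :: "real \<Rightarrow> real"
    proof -
      have "(\<Sum>i<Suc m. indicator (A i) u * g (q i)) = (\<Sum>i<Suc m. if \<nu> u = i then g (q i) else 0)"
        by (intro sum.cong) (auto simp: A_def)
      then show ?thesis by (simp add: sum.delta' less_Suc_eq_le)
    qed
    have stepK: "(\<Sum>i<Suc m. indicator (A i) u * K (q i) s) = (if \<nu> u \<le> m then K (q (\<nu> u)) s else 0)"
      for u s by (rule step)
    have K_step: "(\<integral>\<^sup>+s. ennreal ((K u s - (\<Sum>i<Suc m. indicator (A i) u * K (q i) s))\<^sup>2) \<partial>lborel)
      \<le> ennreal (1 * (d u)\<^sup>2)" for u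
    proof (cases "\<nu> u \<le> m")
      case True
      then show ?thesis using \<nu>[of u] by (simp only: stepK) (simp add: D_def d_def)
    next
      case False
      have "(kernel_norm u)\<^sup>2 \<le> (d u)\<^sup>2"
        using False \<delta> kernel_norm_nonneg[of u] by (intro power_mono) (auto simp: d_def)
      then show ?thesis
        using False by (simp only: stepK) (simp add: nn_integral_kernel_square ennreal_leI)
    qed
    have X_step: "(\<integral>\<^sup>+\<omega>. ennreal ((X u \<omega> - (\<Sum>i<Suc m. indicator (A i) u * X (q i) \<omega>))\<^sup>2) \<partial>M)
      \<le> ennreal (4 * C * (d u)\<^sup>2)" for u
    proof -
      let ?k = "\<lambda>s. K u s - (\<Sum>i<Suc m. indicator (A i) u * K (q i) s)"
      have "has_ito_integral M F B
          (\<lambda>s \<omega>. K u s * \<sigma> s \<omega> - (\<Sum>i<Suc m. indicator (A i) u * (K (q i) s * \<sigma> s \<omega>)))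
          (\<lambda>\<omega>. X u \<omega> - (\<Sum>i<Suc m. indicator (A i) u * X (q i) \<omega>))"
        by (intro has_ito_integral_diff has_ito_integral_sum has_ito_integral_scale X_has_ito_integral)
      also have "(\<lambda>s \<omega>. K u s * \<sigma> s \<omega> - (\<Sum>i<Suc m. indicator (A i) u * (K (q i) s * \<sigma> s \<omega>)))
          = (\<lambda>s \<omega>. ?k s * \<sigma> s \<omega>)"
        by (simp only: left_diff_distrib sum_distrib_right mult.assoc)
      finally show ?thesis
        using sqnorm_ito_kernel_le[of ?k _ "(d u)\<^sup>2"] K_step[of u] by (simp add: sqnorm_rv_def)
    qed
    let ?k = "\<lambda>s. \<Sum>i<Suc m. measure N (A i) * K (q i) s"
    let ?I = "\<lambda>\<omega>. \<Sum>i<Suc m. measure N (A i) * X (q i) \<omega>"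
    have qN: "q i \<in> space N" for i by (simp add: space_N)
    have dd: "(\<integral>\<^sup>+u. ennreal (d u) \<partial>N)\<^sup>2 \<le> ennreal ((\<delta> * c)\<^sup>2)"
      using power_mono[OF d_le, of 2] \<delta> c by (simp add: ennreal_power)
    have "(\<integral>\<^sup>+s. ennreal ((?k s - (LINT u|N. K u s))\<^sup>2) \<partial>lborel) \<le> ennreal 1 * (\<integral>\<^sup>+u. ennreal (d u) \<partial>N)\<^sup>2"
      by (rule step_function_integral_error[OF N P(1) KN qN A d d_pos _ int_K K_step]) simp
    also have "\<dots> \<le> ennreal ((\<delta> * c)\<^sup>2)" using dd by simp
    finally have k_err: "(\<integral>\<^sup>+s. ennreal ((?k s - (LINT u|N. K u s))\<^sup>2) \<partial>lborel) \<le> ennreal ((\<delta> * c)\<^sup>2)" .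
    have "sqnorm_process (\<lambda>s \<omega>. ?k s * \<sigma> s \<omega> - (LINT u|N. K u s) * \<sigma> s \<omega>)
      = sqnorm_process (\<lambda>s \<omega>. (?k s - (LINT u|N. K u s)) * \<sigma> s \<omega>)"
      by (simp only: left_diff_distrib)
    also have "\<dots> \<le> ennreal C * (\<integral>\<^sup>+s. ennreal ((?k s - (LINT u|N. K u s))\<^sup>2) \<partial>lborel)"
      by (rule sqnorm_kernel_process_le) measurable
    also have "\<dots> \<le> ennreal C * ennreal ((\<delta> * c)\<^sup>2)" using k_err by (intro mult_left_mono) auto
    also have "\<dots> = ennreal (C * (\<delta> * c)\<^sup>2)" using C_nonneg by (simp add: ennreal_mult)
    also have "\<dots> \<le> ennreal \<epsilon>"
    proof (rule ennreal_leI)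
      have "0 \<le> C * (\<delta> * c)\<^sup>2" using C_nonneg by (rule mult_nonneg_nonneg) simp
      then show "C * (\<delta> * c)\<^sup>2 \<le> \<epsilon>" using \<delta>_le by linarith
    qed
    finally have 1: "sqnorm_process (\<lambda>s \<omega>. ?k s * \<sigma> s \<omega> - (LINT u|N. K u s) * \<sigma> s \<omega>) \<le> ennreal \<epsilon>" .
    have "sqnorm_rv (\<lambda>\<omega>. ?I \<omega> - (LINT u|N. X u \<omega>)) \<le> ennreal (4 * C) * (\<integral>\<^sup>+u. ennreal (d u) \<partial>N)\<^sup>2"
      unfolding sqnorm_rv_def
      by (rule step_function_integral_error[OF N P(2) XN qN A d d_pos C4 int_X X_step])
    also have "\<dots> \<le> ennreal (4 * C) * ennreal ((\<delta> * c)\<^sup>2)" using dd by (intro mult_left_mono) auto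
    also have "\<dots> = ennreal (4 * C * (\<delta> * c)\<^sup>2)" using C4 by (simp only: ennreal_mult zero_le_power2)
    also have "\<dots> \<le> ennreal \<epsilon>" using \<delta>_le by (rule ennreal_leI)
    finally have 2: "sqnorm_rv (\<lambda>\<omega>. ?I \<omega> - (LINT u|N. X u \<omega>)) \<le> ennreal \<epsilon>" .
    have "has_ito_integral M F B (\<lambda>s \<omega>. \<Sum>i<Suc m. measure N (A i) * (K (q i) s * \<sigma> s \<omega>)) ?I"
      by (intro has_ito_integral_sum has_ito_integral_scale X_has_ito_integral)
    also have "(\<lambda>s \<omega>. \<Sum>i<Suc m. measure N (A i) * (K (q i) s * \<sigma> s \<omega>)) = (\<lambda>s \<omega>. ?k s * \<sigma> s \<omega>)"
      by (simp only: sum_distrib_right mult.assoc)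
    finally show "\<exists>\<psi> J. has_ito_integral M F B \<psi> J \<and>
        sqnorm_process (\<lambda>s \<omega>. \<psi> s \<omega> - (LINT u|N. K u s) * \<sigma> s \<omega>) \<le> ennreal \<epsilon> \<and>
        sqnorm_rv (\<lambda>\<omega>. J \<omega> - (LINT u|N. X u \<omega>)) \<le> ennreal \<epsilon>"
      using 1 2 by blast
  qed
qed

end

section \<open>The kernel of the exponential integral\<close>

lemma (in complete_measure) borel_measurable_cong_AE:
  fixes f g :: "'a \<Rightarrow> real"
  assumes f: "f \<in> borel_measurable M" and ae: "AE x in M. f x = g x"
  shows "g \<in> borel_measurable M"
proof (rule measurableI)
  fix A :: "real set" assume "A \<in> sets borel"
  then have "f -` A \<inter> space M \<in> sets M" by (rule measurable_sets[OF f])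
  moreover have "AE x in M. x \<in> f -` A \<inter> space M \<longleftrightarrow> x \<in> g -` A \<inter> space M"
    using ae by eventually_elim simp
  ultimately show "g -` A \<inter> space M \<in> sets M" using in_sets_AE by blast
qed simp

lemma AE_completion_pair_fst:
  assumes "AE s in lborel. P s" and "sigma_finite_measure M"
  shows "AE x in completion (lborel \<Otimes>\<^sub>M M). P (fst x)"
proof -
  interpret M: sigma_finite_measure M by fact
  obtain N where N: "{s \<in> space lborel. \<not> P s} \<subseteq> N" "emeasure lborel N = 0" "N \<in> sets lborel"
    using assms(1) by (rule AE_E)
  have "N \<times> space M \<in> null_sets (lborel \<Otimes>\<^sub>M M)"
    using N by (auto simp: null_sets_def M.emeasure_pair_measure_Times)
  then have "AE x in lborel \<Otimes>\<^sub>M M. P (fst x)"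
    by (rule AE_I') (use N(1) in \<open>auto simp: space_pair_measure\<close>)
  then show ?thesis by (rule AE_completion)
qed

lemma langevin_integrand_measurable [measurable]: "langevin_integrand l t \<in> borel_measurable borel"
  unfolding langevin_integrand_def [abs_def] by measurable

text \<open>
  The derivative of \<open>langevin_integrand l t\<close>, cut off at \<open>t\<close>. For \<open>l > 0\<close> it is the density of a
  probability measure.
\<close>

definition exp_weight :: "real \<Rightarrow> real \<Rightarrow> real \<Rightarrow> real" where
  "exp_weight l t u = indicator {..t} u * (l * exp (- l * (t - u)))"

text \<open>The measure \<open>l exp(-l(t - u)) du\<close> on \<open>(-\<infinity>, t]\<close>.\<close>

definition exp_measure :: "real \<Rightarrow> real \<Rightarrow> real measure" where
  "exp_measure l t = density lborel (\<lambda>u. ennreal (exp_weight l t u))"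

lemma exp_weight_measurable [measurable (raw)]:
  assumes [measurable]: "f \<in> borel_measurable N" "g \<in> borel_measurable N"
  shows "(\<lambda>x. exp_weight l (f x) (g x)) \<in> borel_measurable N"
proof -
  have "(\<lambda>x. if g x \<le> f x then l * exp (- l * (f x - g x)) else 0) \<in> borel_measurable N" by measurable
  also have "(\<lambda>x. if g x \<le> f x then l * exp (- l * (f x - g x)) else 0)
    = (\<lambda>x. exp_weight l (f x) (g x))"
    by (auto simp: exp_weight_def fun_eq_iff)
  finally show ?thesis .
qed

lemma exp_weight_nonneg: "l > 0 \<Longrightarrow> 0 \<le> exp_weight l t u"
  by (simp add: exp_weight_def)

lemma sets_exp_measure [measurable_cong]: "sets (exp_measure l t) = sets borel"
  by (simp add: exp_measure_def)

lemma finite_exp_measure: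
  assumes "l > 0"
  shows "finite_measure (exp_measure l t)"
proof
  have "emeasure (exp_measure l t) (space (exp_measure l t)) = (\<integral>\<^sup>+u. ennreal (exp_weight l t u) \<partial>lborel)"
    by (simp add: exp_measure_def emeasure_density)
  also have "\<dots> = (\<integral>\<^sup>+u. ennreal (exp_weight l t (t + (-1) * u)) \<partial>lborel)"
    by (subst nn_integral_real_affine[of _ "-1" t]) auto
  also have "\<dots> = (\<integral>\<^sup>+u. ennreal (exponential_density l u) \<partial>lborel)"
    by (intro nn_integral_cong) (auto simp: exp_weight_def exponential_density_def mult.commute)
  also have "\<dots> = emeasure (density lborel (exponential_density l)) (space (density lborel (exponential_density l)))"
    by (simp add: emeasure_density)
  also have "\<dots> = 1"
    using prob_space.emeasure_space_1[OF prob_space_exponential_density[OF assms]] .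
  finally show "emeasure (exp_measure l t) (space (exp_measure l t)) \<noteq> \<infinity>" by simp
qed

lemma integral_exp_measure:
  fixes f :: "real \<Rightarrow> real"
  assumes "l > 0" "f \<in> borel_measurable borel"
  shows "(LINT u|exp_measure l t. f u) = (LINT u|lborel. exp_weight l t u * f u)"
    and "integrable (exp_measure l t) f \<longleftrightarrow> integrable lborel (\<lambda>u. exp_weight l t u * f u)"
  using assms by (simp_all add: exp_measure_def integral_density integrable_density exp_weight_nonneg)

text \<open>
  The two conditions on the kernel: vanishing boundary terms, and integrability of the norms
  \<open>kernel_norm\<close> with respect to the total variation measure of the exponential.
\<close>

locale langevin_setting = vmv_setting M F B K \<sigma> X C
  for M :: "'a measure" and F :: "real \<Rightarrow> 'a measure" and B and K and \<sigma> X and C +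
  fixes l :: real
  assumes l_pos: "l > 0"
    and boundary_term: "0 \<le> t \<Longrightarrow> AE s in lborel. s < t \<longrightarrow>
      ((\<lambda>u. (langevin_integrand l t u - langevin_integrand l t s) * K u s) \<longlongrightarrow> 0) (at_right s)"
    and variation_finite: "0 \<le> t \<Longrightarrow>
      (\<integral>\<^sup>+s\<in>{..t}. ennreal (kernel_norm s) \<partial>langevin_variation l t) < \<infinity>"
begin

lemma nn_integral_kernel_norm_finite:
  assumes "0 \<le> t"
  shows "(\<integral>\<^sup>+u. ennreal (kernel_norm u) \<partial>exp_measure l t) < \<infinity>"
proof -
  have "(\<integral>\<^sup>+u. ennreal (kernel_norm u) \<partial>exp_measure l t)
    = (\<integral>\<^sup>+u. ennreal (exp_weight l t u) * ennreal (kernel_norm u) \<partial>lborel)"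
    unfolding exp_measure_def by (subst nn_integral_density) auto
  also have "\<dots> = (\<integral>\<^sup>+u. ennreal (l * exp (- l * (t - u))) * (ennreal (kernel_norm u) * indicator {..t} u) \<partial>lborel)"
    by (intro nn_integral_cong) (auto simp: exp_weight_def indicator_def)
  also have "\<dots> = (\<integral>\<^sup>+s\<in>{..t}. ennreal (kernel_norm s) \<partial>langevin_variation l t)"
    unfolding langevin_variation_def by (subst nn_integral_density) auto
  finally show ?thesis using variation_finite[OF assms] by simp
qed

lemmas exp_Fubini = stochastic_Fubini[OF finite_exp_measure[OF l_pos] sets_exp_measure nn_integral_kernel_norm_finite]

text \<open>The kernel \<open>K(t, s) - \<integral>\<^bsub>s\<^esub>\<^bsup>t\<^esup> l exp(-l(t - u)) K(u, s) du\<close> of the exponential integral.\<close>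

definition exp_kernel :: "real \<Rightarrow> real \<Rightarrow> real" where
  "exp_kernel t s = K t s - (LINT u|exp_measure l t. K u s)"

lemma exp_kernel_measurable [measurable]: "exp_kernel t \<in> borel_measurable borel"
proof -
  interpret finite_measure "exp_measure l t" by (rule finite_exp_measure[OF l_pos])
  show ?thesis unfolding exp_kernel_def [abs_def] by measurable
qed

lemma integral_kernel_causal: "t < s \<Longrightarrow> (LINT u|exp_measure l t. K u s) = 0"
proof -
  assume "t < s"
  then have "(\<lambda>u. exp_weight l t u * K u s) = (\<lambda>u. 0)"
    using causal by (auto simp: fun_eq_iff exp_weight_def indicator_def)
  then show ?thesis by (simp add: integral_exp_measure[OF l_pos])
qed

text \<open>Integration by parts; the boundary term at \<open>s\<close> vanishes by assumption.\<close>

lemma \<K>_langevin_integrand: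
  assumes t: "0 \<le> t"
  shows "AE s in lborel. s < t \<longrightarrow>
      (\<lambda>u. (langevin_integrand l t u - langevin_integrand l t s) * deriv (\<lambda>v. K v s) u) integrable_on {s..t} \<and>
      \<K> K (langevin_integrand l t) t s = exp_kernel t s"
  using boundary_term[OF t] exp_Fubini(1)[OF t] continuously_differentiable
proof eventually_elim
  case (elim s)
  show ?case
  proof
    assume st: "s < t"
    let ?f = "langevin_integrand l t"
    let ?f' = "\<lambda>u. l * exp (- l * (t - u))"
    define G where "G u = (?f u - ?f s) * K u s" for u
    obtain D where D: "\<And>u. u > s \<Longrightarrow> ((\<lambda>t. K t s) has_vector_derivative D u) (at u)"
      using elim(3) by (auto simp: C1_differentiable_on_def)
    have derivK: "((\<lambda>t. K t s) has_field_derivative deriv (\<lambda>v. K v s) u) (at u)" if "u > s" for u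
      using D[OF that] unfolding has_real_derivative_iff_has_vector_derivative[symmetric]
      by (metis DERIV_imp_deriv)
    have derivf: "(?f has_field_derivative ?f' u) (at u)" for u
      unfolding langevin_integrand_def [abs_def] by (auto intro!: derivative_eq_intros)
    have derivG: "(G has_field_derivative (?f' u * K u s + (?f u - ?f s) * deriv (\<lambda>v. K v s) u)) (at u)"
      if "u > s" for u
      unfolding G_def [abs_def]
      by (auto intro!: derivative_eq_intros derivf derivK[OF that])
    \<comment> \<open>Continuity at the lower endpoint is the assumption on the boundary term, as \<open>G s = 0\<close>.\<close>
    have contG: "continuous_on {s..t} G"
      unfolding continuous_on_eq_continuous_within
    proof
      fix u assume u: "u \<in> {s..t}"
      show "continuous (at u within {s..t}) G"
      proof (cases "u = s")
        case True
        have "(G \<longlongrightarrow> 0) (at_right s)" using elim(1) st by (simp add: G_def [abs_def])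
        then have "(G \<longlongrightarrow> G s) (at s within {s..t})"
          using st by (simp add: G_def at_within_Icc_at_right)
        then show ?thesis using True by (simp add: continuous_within)
      next
        case False
        then have "u > s" using u by simp
        from DERIV_isCont[OF derivG[OF this]] show ?thesis by (rule continuous_at_imp_continuous_at_within)
      qed
    qed
    have "((\<lambda>u. ?f' u * K u s + (?f u - ?f s) * deriv (\<lambda>v. K v s) u) has_integral (G t - G s)) {s..t}"
      using st contG derivG
      by (intro fundamental_theorem_of_calculus_interior)
        (auto simp flip: has_real_derivative_iff_has_vector_derivative)
    then have 1: "((\<lambda>u. ?f' u * K u s + (?f u - ?f s) * deriv (\<lambda>v. K v s) u) has_integral G t) {s..t}"
      by (simp add: G_def)
    have [measurable]: "(\<lambda>u. K u s) \<in> borel_measurable borel" by measurable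
    have "integrable lborel (\<lambda>u. exp_weight l t u * K u s)"
      using elim(2) by (simp add: integral_exp_measure[OF l_pos])
    from has_integral_integral_lborel[OF this]
    have "((\<lambda>u. exp_weight l t u * K u s) has_integral (LINT u|exp_measure l t. K u s)) UNIV"
      by (simp add: integral_exp_measure[OF l_pos])
    also have "(\<lambda>u. exp_weight l t u * K u s) = (\<lambda>u. if u \<in> {s..t} then ?f' u * K u s else 0)"
      using causal by (auto simp: fun_eq_iff exp_weight_def indicator_def)
    finally have 2: "((\<lambda>u. ?f' u * K u s) has_integral (LINT u|exp_measure l t. K u s)) {s..t}"
      by (simp only: has_integral_restrict_UNIV)
    have 3: "((\<lambda>u. (?f u - ?f s) * deriv (\<lambda>v. K v s) u) has_integral
        (G t - (LINT u|exp_measure l t. K u s))) {s..t}"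
      using has_integral_diff[OF 1 2] by simp
    have "\<K> K ?f t s = exp_kernel t s"
      unfolding \<K>_def integral_unique[OF 3] exp_kernel_def
      by (simp add: G_def langevin_integrand_def algebra_simps)
    with 3 show "(\<lambda>u. (?f u - ?f s) * deriv (\<lambda>v. K v s) u) integrable_on {s..t} \<and>
      \<K> K ?f t s = exp_kernel t s" by (auto simp: integrable_on_def)
  qed
qed

lemma \<K>_langevin_integrand_AE:
  assumes t: "0 \<le> t"
  shows "AE s in lborel. indicator {..t} s * \<K> K (langevin_integrand l t) t s = exp_kernel t s"
  using \<K>_langevin_integrand[OF t] AE_lborel_singleton[of t]
proof eventually_elim
  case (elim s)
  show ?case
  proof (cases "s < t")
    case False
    with elim(2) have "t < s" by simp
    then show ?thesis using causal[of t s] integral_kernel_causal by (simp add: exp_kernel_def)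
  qed (use elim(1) in simp)
qed

lemma exp_kernel_square_integrable:
  assumes "0 \<le> t"
  shows "integrable lborel (\<lambda>s. (exp_kernel t s)\<^sup>2)"
proof (rule integrableI_bounded)
  interpret finite_measure "exp_measure l t" by (rule finite_exp_measure[OF l_pos])
  have "(\<integral>\<^sup>+s. ennreal ((K t s + - (LINT u|exp_measure l t. K u s))\<^sup>2) \<partial>lborel)
    \<le> 2 * ((\<integral>\<^sup>+s. ennreal ((K t s)\<^sup>2) \<partial>lborel)
      + (\<integral>\<^sup>+s. ennreal ((- (LINT u|exp_measure l t. K u s))\<^sup>2) \<partial>lborel))"
    by (rule nn_integral_square_add_le) measurable
  also have "\<dots> < \<infinity>"
    using exp_Fubini(2)[OF assms] by (simp add: nn_integral_kernel_square ennreal_mult_less_top)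
  finally show "(\<integral>\<^sup>+s. ennreal (norm ((exp_kernel t s)\<^sup>2)) \<partial>lborel) < \<infinity>"
    by (simp add: exp_kernel_def)
qed measurable

lemma langevin_integrand_in_\<H>:
  assumes t: "0 \<le> t"
  shows "langevin_integrand l t \<in> \<H> K t"
proof -
  let ?k = "\<K> K (langevin_integrand l t) t"
  have "AE s in lebesgue. indicator {..t} s * ?k s = exp_kernel t s"
    using \<K>_langevin_integrand_AE[OF t] by (rule AE_completion)
  then have ae: "AE s in lebesgue. exp_kernel t s = indicator {..t} s * ?k s"
    by eventually_elim simp
  have m: "exp_kernel t \<in> borel_measurable lebesgue" by (rule measurable_completion) simp
  have m1: "(\<lambda>s. indicator {..t} s * ?k s) \<in> borel_measurable lebesgue"
    by (rule completion.borel_measurable_cong_AE[OF m ae])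
  then have 1: "?k \<in> borel_measurable (lebesgue_on {..t})"
    by (subst borel_measurable_restrict_space_iff) auto
  have "integrable lebesgue (\<lambda>s. (exp_kernel t s)\<^sup>2)"
    using exp_kernel_square_integrable[OF t] by (subst integrable_completion) auto
  then have "integrable lebesgue (\<lambda>s. (indicator {..t} s * ?k s)\<^sup>2)"
    by (rule integrable_cong_AE_imp) (use m1 ae in \<open>auto elim: eventually_mono\<close>)
  also have "(\<lambda>s. (indicator {..t} s * ?k s)\<^sup>2) = (\<lambda>s. indicator {..t} s *\<^sub>R (?k s)\<^sup>2)"
    by (auto simp: fun_eq_iff indicator_def)
  finally have 2: "integrable (lebesgue_on {..t}) (\<lambda>s. (?k s)\<^sup>2)"
    by (subst integrable_restrict_space) auto
  have 3: "AE s in lborel. s < t \<longrightarrow>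
      (\<lambda>u. (langevin_integrand l t u - langevin_integrand l t s) * deriv (\<lambda>v. K v s) u) integrable_on {s..t}"
    using \<K>_langevin_integrand[OF t] by eventually_elim simp
  show ?thesis unfolding \<H>_def using 1 2 3 by simp
qed

text \<open>
  The explicit version \<open>X t - \<integral>\<^bsub>-\<infinity>\<^esub>\<^bsup>t\<^esup> l exp(-l(t - u)) X u du\<close> of \<open>\<integral>\<^bsub>-\<infinity>\<^esub>\<^bsup>t\<^esup> exp(-l(t - s)) dX\<^sub>s\<close>.
  It takes the value \<open>X t\<close> on the null set where the integral does not exist.
\<close>

definition exp_integral :: "real \<Rightarrow> 'a \<Rightarrow> real" where
  "exp_integral t \<omega> = X t \<omega> - (LINT u|exp_measure l t. X u \<omega>)"

lemma has_vmv_integral_exp_integral: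
  assumes t: "0 \<le> t"
  shows "has_vmv_integral M F B K \<sigma> t (langevin_integrand l t) (exp_integral t)"
  unfolding has_vmv_integral_def
proof
  show "langevin_integrand l t \<in> \<H> K t" by (rule langevin_integrand_in_\<H>[OF t])
  let ?\<phi> = "\<lambda>s \<omega>. indicator {..t} s * (\<K> K (langevin_integrand l t) t s * \<sigma> s \<omega>)"
  have "has_ito_integral M F B (\<lambda>s \<omega>. K t s * \<sigma> s \<omega> - (LINT u|exp_measure l t. K u s) * \<sigma> s \<omega>)
      (\<lambda>\<omega>. X t \<omega> - (LINT u|exp_measure l t. X u \<omega>))"
    by (intro has_ito_integral_diff X_has_ito_integral exp_Fubini(4) t)
  then have I: "has_ito_integral M F B (\<lambda>s \<omega>. exp_kernel t s * \<sigma> s \<omega>) (exp_integral t)"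
    by (simp add: exp_kernel_def exp_integral_def [abs_def] left_diff_distrib)
  have ae: "AE x in completion (lborel \<Otimes>\<^sub>M M). exp_kernel t (fst x) * \<sigma> (fst x) (snd x) = ?\<phi> (fst x) (snd x)"
    using AE_completion_pair_fst[OF \<K>_langevin_integrand_AE[OF t] sigma_finite_measure_axioms]
    by eventually_elim (simp add: mult.assoc[symmetric])
  have "(\<lambda>x. exp_kernel t (fst x) * \<sigma> (fst x) (snd x)) \<in> borel_measurable (completion (lborel \<Otimes>\<^sub>M M))"
    using has_ito_integral_measurable(1)[OF I] by (simp add: split_beta')
  from completion.borel_measurable_cong_AE[OF this ae] have "process_measurable ?\<phi>"
    by (simp add: split_beta')
  then show "has_ito_integral M F B ?\<phi> (exp_integral t)"
    using has_ito_integral_measurable(2)[OF I] by (intro has_ito_integral_cong_AE[OF I _ _ ae]) auto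
qed

end

section \<open>The Langevin equation along a path\<close>

lemma integrable_lborel_pair_bounded:
  fixes a :: "real \<Rightarrow> real" and H :: "real \<Rightarrow> real \<Rightarrow> real"
  assumes "integrable lborel a" and [measurable]: "(\<lambda>(s, u). H s u) \<in> borel_measurable (lborel \<Otimes>\<^sub>M lborel)"
    and le: "\<And>s u. \<bar>H s u\<bar> \<le> indicator {0..t} s * \<bar>a u\<bar>"
  shows "integrable (lborel \<Otimes>\<^sub>M lborel) (\<lambda>(s, u). H s u)"
proof (rule integrableI_bounded)
  have [measurable]: "a \<in> borel_measurable borel" using assms(1) by simp
  have a: "(\<integral>\<^sup>+u. ennreal \<bar>a u\<bar> \<partial>lborel) < \<infinity>"
    using assms(1) by (simp add: integrable_iff_bounded)
  have "(\<integral>\<^sup>+x. ennreal (norm (case x of (s, u) \<Rightarrow> H s u)) \<partial>(lborel \<Otimes>\<^sub>M lborel))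
    \<le> (\<integral>\<^sup>+x. indicator {0..t} (fst x) * ennreal \<bar>a (snd x)\<bar> \<partial>(lborel \<Otimes>\<^sub>M lborel))"
  proof (intro nn_integral_mono)
    fix x :: "real \<times> real"
    have "ennreal \<bar>H (fst x) (snd x)\<bar> \<le> ennreal (indicator {0..t} (fst x) * \<bar>a (snd x)\<bar>)"
      by (rule ennreal_leI) (rule le)
    also have "\<dots> = indicator {0..t} (fst x) * ennreal \<bar>a (snd x)\<bar>" by (simp add: indicator_def)
    finally show "ennreal (norm (case x of (s, u) \<Rightarrow> H s u)) \<le> indicator {0..t} (fst x) * ennreal \<bar>a (snd x)\<bar>"
      by (simp add: split_beta')
  qed
  also have "\<dots> = (\<integral>\<^sup>+s. \<integral>\<^sup>+u. indicator {0..t} s * ennreal \<bar>a u\<bar> \<partial>lborel \<partial>lborel)"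
    by (subst lborel.nn_integral_fst[symmetric]) auto
  also have "\<dots> = (\<integral>\<^sup>+s. indicator {0..t} s * (\<integral>\<^sup>+u. ennreal \<bar>a u\<bar> \<partial>lborel) \<partial>lborel)"
    by (intro nn_integral_cong nn_integral_cmult) measurable
  also have "\<dots> = emeasure lborel {0..t} * (\<integral>\<^sup>+u. ennreal \<bar>a u\<bar> \<partial>lborel)"
    by (subst nn_integral_multc) auto
  also have "\<dots> < \<infinity>" using a by (auto simp: ennreal_mult_less_top emeasure_lborel_Icc_eq)
  finally show "(\<integral>\<^sup>+x. ennreal (norm (case x of (s, u) \<Rightarrow> H s u)) \<partial>(lborel \<Otimes>\<^sub>M lborel)) < \<infinity>" .
qed (use assms in simp)

text \<open>
  The variation of constants formula \<open>z t = x t - \<integral>\<^bsub>-\<infinity>\<^esub>\<^bsup>t\<^esup> l exp(-l(t - u)) x u du\<close> solves the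
  Langevin equation driven by \<open>x\<close>. The proof computes the iterated integral
  \<open>\<integral>\<^bsub>0\<^esub>\<^bsup>t\<^esup> \<integral>\<^bsub>-\<infinity>\<^esub>\<^bsup>s\<^esup> l exp(-l(s - u)) x u du ds\<close> by exchanging the order of integration.
\<close>

lemma langevin_path:
  fixes x :: "real \<Rightarrow> real" and t :: real
  assumes l: "l > 0" and t: "0 \<le> t" and x [measurable]: "x \<in> borel_measurable borel"
    and int: "integrable lborel (\<lambda>u. exp_weight l t u * x u)"
  defines "z \<equiv> \<lambda>s. x s - (LINT u|lborel. exp_weight l s u * x u)"
  shows "set_integrable lborel {0..t} z"
    and "z t = - (LINT u|lborel. exp_weight l 0 u * x u) + x t - l * (LINT s:{0..t}|lborel. z s)"
proof -
  define a where "a u = indicator {..t} u * (l * exp (l * u) * x u)" for u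
  have exp_eq: "exp (l * u) = exp (l * s) * exp (- l * (s - u))" for s u
    by (simp add: algebra_simps flip: exp_add)
  have a_eq: "a = (\<lambda>u. exp (l * t) * (exp_weight l t u * x u))"
  proof
    fix u
    show "a u = exp (l * t) * (exp_weight l t u * x u)"
      unfolding a_def exp_weight_def exp_eq[where s=t and u=u] by (simp only: mult_ac)
  qed
  have a: "integrable lborel a" unfolding a_eq using int by simp
  have [measurable]: "a \<in> borel_measurable borel" using a by simp
  \<comment> \<open>The integrand \<open>l exp(-l(s - u)) x u\<close> of the iterated integral, extended by zero.\<close>
  define H where "H s u = indicator {0..t} s * (exp (- l * s) * (if u \<le> s then a u else 0))" for s u
  have H_le: "\<bar>H s u\<bar> \<le> indicator {0..t} s * \<bar>a u\<bar>" for s u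
  proof (cases "s \<in> {0..t} \<and> u \<le> s")
    case True
    then have "exp (- l * s) \<le> 1" using l by simp
    then show ?thesis using True by (simp add: H_def abs_mult mult_left_le_one_le)
  qed (auto simp: H_def indicator_def)
  have [measurable]: "(\<lambda>(s, u). H s u) \<in> borel_measurable (lborel \<Otimes>\<^sub>M lborel)"
    unfolding H_def by measurable
  have H: "integrable (lborel \<Otimes>\<^sub>M lborel) (\<lambda>(s, u). H s u)"
    by (rule integrable_lborel_pair_bounded[OF a _ H_le]) measurable
  have H_s: "H s u = indicator {0..t} s * (exp_weight l s u * x u)" for s u
    by (cases "s \<le> t") (auto simp: H_def a_def exp_weight_def indicator_def right_diff_distrib exp_diff exp_minus field_simps)
  have H_s_int: "(LINT u|lborel. H s u) = indicator {0..t} s * (LINT u|lborel. exp_weight l s u * x u)" for s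
    unfolding H_s by simp
  have x_int: "integrable lborel (\<lambda>u. indicator {0..t} u * x u)"
  proof (rule Bochner_Integration.integrable_bound)
    show "integrable lborel (\<lambda>u. (1 / l) * a u)" using a by simp
    show "AE u in lborel. norm (indicator {0..t} u * x u) \<le> norm ((1 / l) * a u)"
    proof (rule AE_I2)
      fix u
      show "norm (indicator {0..t} u * x u) \<le> norm ((1 / l) * a u)"
      proof (cases "u \<in> {0..t}")
        case True
        then have "1 \<le> exp (l * u)" using l by simp
        then have "\<bar>x u\<bar> \<le> exp (l * u) * \<bar>x u\<bar>" using mult_right_mono[of 1 "exp (l * u)" "\<bar>x u\<bar>"] by simp
        then show ?thesis using True l by (simp add: a_def abs_mult)
      qed simp
    qed
  qed measurable
  have H_u: "(LINT s|lborel. H s u)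
      = (1 / l) * (exp_weight l 0 u * x u - exp_weight l t u * x u) + indicator {0..t} u * x u"
    if "u \<noteq> 0" for u
  proof (cases "u \<le> t")
    case True
    define c where "c = max 0 u"
    have c: "c \<le> t" using True t by (simp add: c_def)
    have "(LINT s|lborel. H s u) = (LINT s|lborel. (exp (- l * s) * indicator {c..t} s) * a u)"
      by (intro Bochner_Integration.integral_cong refl) (auto simp: H_def c_def indicator_def)
    also have "\<dots> = (LINT s|lborel. exp (- l * s) * indicator {c..t} s) * a u" by simp
    also have "(LINT s|lborel. exp (- l * s) * indicator {c..t} s)
        = (- exp (- l * t) / l) - (- exp (- l * c) / l)"
      using l c by (intro integral_FTC_Icc_real) (auto intro!: derivative_eq_intros)
    finally have *: "(LINT s|lborel. H s u) = (exp (- l * c) - exp (- l * t)) / l * a u"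
      by (simp add: diff_divide_distrib)
    show ?thesis
    proof (cases "u < 0")
      case True
      then show ?thesis
        unfolding * using \<open>u \<le> t\<close> l
        by (simp add: c_def a_def exp_weight_def right_diff_distrib exp_diff exp_minus field_simps)
    next
      case False
      with that have "u > 0" by simp
      then show ?thesis
        unfolding * using \<open>u \<le> t\<close> l
        by (simp add: c_def a_def exp_weight_def right_diff_distrib exp_diff exp_minus field_simps)
    qed
  next
    case False
    then have "H s u = 0" for s by (simp add: H_def a_def)
    then show ?thesis using False t by (simp add: exp_weight_def)
  qed
  have int0: "integrable lborel (\<lambda>u. exp_weight l 0 u * x u)"
  proof (rule Bochner_Integration.integrable_bound[OF a])
    show "AE u in lborel. norm (exp_weight l 0 u * x u) \<le> norm (a u)"
      using t l by (intro AE_I2) (auto simp: a_def exp_weight_def indicator_def)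
  qed measurable
  have "integrable lborel (\<lambda>s. LINT u|lborel. H s u)"
    by (rule lborel_pair.integrable_fst[OF H])
  then have P: "integrable lborel (\<lambda>s. indicator {0..t} s * (LINT u|lborel. exp_weight l s u * x u))"
    by (simp add: H_s_int)
  show z_int: "set_integrable lborel {0..t} z"
    using Bochner_Integration.integrable_diff[OF x_int P]
    by (simp add: set_integrable_def z_def right_diff_distrib)
  have "(LINT s|lborel. indicator {0..t} s * (LINT u|lborel. exp_weight l s u * x u))
    = (LINT s|lborel. LINT u|lborel. H s u)" by (simp add: H_s_int)
  also have "\<dots> = (LINT u|lborel. LINT s|lborel. H s u)"
    by (rule lborel_pair.Fubini_integral[OF H, symmetric])
  also have "\<dots> = (LINT u|lborel. (1 / l) * (exp_weight l 0 u * x u - exp_weight l t u * x u) + indicator {0..t} u * x u)"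
    using H_u AE_lborel_singleton[of 0] by (intro integral_cong_AE) auto
  also have "\<dots> = (1 / l) * ((LINT u|lborel. exp_weight l 0 u * x u) - (LINT u|lborel. exp_weight l t u * x u))
      + (LINT u|lborel. indicator {0..t} u * x u)"
    using int int0 x_int by simp
  finally have eq: "l * (LINT s|lborel. indicator {0..t} s * (LINT u|lborel. exp_weight l s u * x u))
    = (LINT u|lborel. exp_weight l 0 u * x u) - (LINT u|lborel. exp_weight l t u * x u)
      + l * (LINT u|lborel. indicator {0..t} u * x u)"
    using l by (simp add: distrib_left)
  have "(LINT s:{0..t}|lborel. z s) = (LINT u|lborel. indicator {0..t} u * x u)
    - (LINT s|lborel. indicator {0..t} s * (LINT u|lborel. exp_weight l s u * x u))"
    using Bochner_Integration.integral_diff[OF x_int P]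
    by (simp add: set_lebesgue_integral_def z_def right_diff_distrib)
  then show "z t = - (LINT u|lborel. exp_weight l 0 u * x u) + x t - l * (LINT s:{0..t}|lborel. z s)"
    using eq by (simp add: z_def right_diff_distrib)
qed

text \<open>
  A difference \<open>d\<close> of two solutions has the primitive \<open>G\<close> with \<open>G' = -l G\<close> and \<open>G 0 = 0\<close>.
\<close>

lemma langevin_path_unique:
  fixes d :: "real \<Rightarrow> real"
  assumes t: "0 \<le> t" and int: "set_integrable lborel {0..t} d"
    and eq: "AE s in lborel. 0 \<le> s \<longrightarrow> d s = - l * (LINT u:{0..s}|lborel. d u)"
  shows "(LINT u:{0..t}|lborel. d u) = 0"
proof -
  define G where "G s = integral {0..s} d" for s
  have G: "(LINT u:{0..s}|lborel. d u) = G s" if "s \<le> t" for s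
  proof -
    have "set_integrable lborel {0..s} d"
      by (rule set_integrable_subset[OF int]) (use that in auto)
    then show ?thesis unfolding G_def by (rule set_borel_integral_eq_integral(2))
  qed
  have "d integrable_on {0..t}" by (rule set_borel_integral_eq_integral(1)[OF int])
  then have cont: "continuous_on {0..t} G"
    unfolding G_def by (rule indefinite_integral_continuous_1)
  \<comment> \<open>Off a null set \<open>d = -l G\<close>, which is continuous, so \<open>G\<close> is continuously differentiable.\<close>
  define N where "N = {s. \<not> (0 \<le> s \<longrightarrow> d s = - l * (LINT u:{0..s}|lborel. d u))}"
  have "N \<in> null_sets lebesgue"
    using AE_completion[OF eq] unfolding completion.AE_iff_null_sets by (simp add: N_def)
  then have N: "negligible N" by (simp add: negligible_iff_null_sets)
  have G_eq: "G s = integral {0..s} (\<lambda>u. - l * G u)" if "s \<in> {0..t}" for s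
    unfolding G_def[of s]
  proof (rule integral_spike[OF N])
    fix u assume "u \<in> {0..s} - N"
    then show "- l * G u = d u" using G[of u] that by (auto simp: N_def)
  qed
  have deriv: "(G has_field_derivative (- l * G s)) (at s within {0..t})" if "s \<in> {0..t}" for s
  proof -
    have "((\<lambda>s. integral {0..s} (\<lambda>u. - l * G u)) has_vector_derivative (- l * G s)) (at s within {0..t})"
      by (rule integral_has_vector_derivative) (intro continuous_intros cont that)+
    then have "(G has_vector_derivative (- l * G s)) (at s within {0..t})"
      by (rule has_vector_derivative_transform[rotated 2]) (use that G_eq in auto)
    then show ?thesis by (simp add: has_real_derivative_iff_has_vector_derivative)
  qed
  have "((\<lambda>s. exp (l * s) * G s) has_field_derivative 0) (at s within {0..t})" if "s \<in> {0..t}" for s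
    by (rule derivative_eq_intros deriv[OF that] refl | simp)+
  then obtain c where c: "\<And>s. s \<in> {0..t} \<Longrightarrow> exp (l * s) * G s = c"
    using has_field_derivative_zero_constant[of "{0..t}" "\<lambda>s. exp (l * s) * G s"] by auto
  have "G 0 = 0" by (simp add: G_def)
  then have "c = 0" using c[of 0] t by simp
  then have "G t = 0" using c[of t] t by simp
  then show ?thesis using G[of t] by simp
qed

section \<open>Existence and uniqueness\<close>

lemma measurable_processI:
  assumes "(\<lambda>(s, \<omega>). Z s \<omega>) \<in> borel_measurable (borel \<Otimes>\<^sub>M M)"
  shows "measurable_process M T Z"
proof -
  have "(\<lambda>x. (fst x, snd x)) \<in> measurable (restrict_space borel T \<Otimes>\<^sub>M M) (borel \<Otimes>\<^sub>M M)"
    by (intro measurable_Pair measurable_snd measurable_compose[OF measurable_fst]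
        measurable_restrict_space1) simp
  from measurable_compose[OF this assms] show ?thesis by (simp add: measurable_process_def split_beta')
qed

lemma measurable_process_extend:
  assumes "measurable_process M {0..} Z"
  shows "(\<lambda>(s, \<omega>). if 0 \<le> s then Z s \<omega> else 0) \<in> borel_measurable (borel \<Otimes>\<^sub>M M)"
proof -
  have "(\<lambda>x. (fst x, snd x)) \<in> measurable (restrict_space (borel \<Otimes>\<^sub>M M) {x. 0 \<le> fst x})
      (restrict_space borel {0..} \<Otimes>\<^sub>M M)"
    by (intro measurable_Pair measurable_restrict_space2 measurable_restrict_space1 measurable_fst measurable_snd)
      (auto simp: space_restrict_space)
  from measurable_compose[OF this assms[unfolded measurable_process_def]]
  have "(\<lambda>x. Z (fst x) (snd x)) \<in> borel_measurable (restrict_space (borel \<Otimes>\<^sub>M M) {x. 0 \<le> fst x})"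
    by (simp add: split_beta')
  then have "(\<lambda>x. if 0 \<le> fst x then Z (fst x) (snd x) else 0) \<in> borel_measurable (borel \<Otimes>\<^sub>M M)"
    by (subst measurable_If_restrict_space_iff) auto
  then show ?thesis by (simp add: split_beta')
qed

context langevin_setting
begin

lemma AE_AE_eq_of_modification:
  fixes V W :: "real \<Rightarrow> 'a \<Rightarrow> real"
  assumes [measurable]: "(\<lambda>(s, \<omega>). V s \<omega>) \<in> borel_measurable (borel \<Otimes>\<^sub>M M)"
    "(\<lambda>(s, \<omega>). W s \<omega>) \<in> borel_measurable (borel \<Otimes>\<^sub>M M)"
    and eq: "\<And>s. 0 \<le> s \<Longrightarrow> AE \<omega> in M. V s \<omega> = W s \<omega>"
  shows "AE \<omega> in M. AE s in lborel. 0 \<le> s \<longrightarrow> V s \<omega> = W s \<omega>"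
proof -
  interpret lM: pair_sigma_finite lborel M by unfold_locales
  have "AE s in lborel. AE \<omega> in M. 0 \<le> s \<longrightarrow> V s \<omega> = W s \<omega>"
  proof (rule AE_I2)
    fix s :: real
    show "AE \<omega> in M. 0 \<le> s \<longrightarrow> V s \<omega> = W s \<omega>" by (cases "0 \<le> s") (use eq in auto)
  qed
  then show ?thesis by (subst (asm) lM.AE_commute) measurable
qed

lemma exp_integral_measurable [measurable]: "(\<lambda>(s, \<omega>). exp_integral s \<omega>) \<in> borel_measurable (borel \<Otimes>\<^sub>M M)"
proof -
  have "(\<lambda>(s, \<omega>). X s \<omega> - (LINT u|lborel. exp_weight l s u * X u \<omega>)) \<in> borel_measurable (borel \<Otimes>\<^sub>M M)"
    by measurable
  also have "?this \<longleftrightarrow> (\<lambda>(s, \<omega>). exp_integral s \<omega>) \<in> borel_measurable (borel \<Otimes>\<^sub>M M)"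
    by (intro measurable_cong)
      (auto simp: exp_integral_def space_pair_measure integral_exp_measure[OF l_pos])
  finally show ?thesis .
qed

lemma exp_integral_process_exp_integral: "exp_integral_process M F B K \<sigma> l exp_integral"
  unfolding exp_integral_process_def
  using measurable_processI[OF exp_integral_measurable] has_vmv_integral_exp_integral by blast

text \<open>The initial condition \<open>-l \<integral>\<^bsub>-\<infinity>\<^esub>\<^bsup>0\<^esup> exp(l u) X u du\<close>.\<close>

definition initial_value :: "'a \<Rightarrow> real" where
  "initial_value \<omega> = - l * (LINT u:{..0}|lborel. exp (l * u) * X u \<omega>)"

lemma initial_value_eq: "initial_value \<omega> = - (LINT u|lborel. exp_weight l 0 u * X u \<omega>)"
proof -
  have "(LINT u|lborel. exp_weight l 0 u * X u \<omega>)
    = (LINT u|lborel. l * (indicator {..0} u *\<^sub>R (exp (l * u) * X u \<omega>)))"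
    by (intro Bochner_Integration.integral_cong) (auto simp: exp_weight_def)
  then show ?thesis by (simp add: initial_value_def set_lebesgue_integral_def)
qed

text \<open>Up to sign, the initial value is the Ito integral of a process that vanishes on \<open>(0, \<infinity>)\<close>.\<close>

lemma initial_value_measurable: "initial_value \<in> borel_measurable (F 0)"
proof -
  have "(\<lambda>\<omega>. LINT u|exp_measure l 0. X u \<omega>) \<in> borel_measurable (F 0)"
    by (rule has_ito_integral_adapted[OF exp_Fubini(4)]) (simp_all add: integral_kernel_causal)
  then have "(\<lambda>\<omega>. - (LINT u|exp_measure l 0. X u \<omega>)) \<in> borel_measurable (F 0)" by simp
  also have "?this \<longleftrightarrow> initial_value \<in> borel_measurable (F 0)"
    by (intro measurable_cong) (simp add: space_F initial_value_eq integral_exp_measure[OF l_pos])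
  finally show ?thesis .
qed

lemma initial_value_integrable: "AE \<omega> in M. set_integrable lborel {..0} (\<lambda>u. exp (l * u) * X u \<omega>)"
  using exp_Fubini(3)[OF order_refl] AE_space
proof eventually_elim
  case (elim \<omega>)
  note [measurable] = elim(2)
  have "integrable lborel (\<lambda>u. exp_weight l 0 u * X u \<omega>)"
    using elim(1) by (simp add: integral_exp_measure[OF l_pos])
  then have "integrable lborel (\<lambda>u. (1 / l) * (exp_weight l 0 u * X u \<omega>))" by simp
  also have "(\<lambda>u. (1 / l) * (exp_weight l 0 u * X u \<omega>))
    = (\<lambda>u. indicator {..0} u *\<^sub>R (exp (l * u) * X u \<omega>))"
    using l_pos by (auto simp: fun_eq_iff exp_weight_def)
  finally show ?case by (simp add: set_integrable_def)
qed

lemma exp_integral_process_modification: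
  assumes Z: "exp_integral_process M F B K \<sigma> l Z" and t: "0 \<le> t"
  shows "AE \<omega> in M. Z t \<omega> = exp_integral t \<omega>"
proof (rule has_ito_integral_unique)
  show "has_ito_integral M F B
      (\<lambda>s \<omega>. indicator {..t} s * (\<K> K (langevin_integrand l t) t s * \<sigma> s \<omega>)) (Z t)"
    using Z t unfolding exp_integral_process_def has_vmv_integral_def by blast
  show "has_ito_integral M F B
      (\<lambda>s \<omega>. indicator {..t} s * (\<K> K (langevin_integrand l t) t s * \<sigma> s \<omega>)) (exp_integral t)"
    using has_vmv_integral_exp_integral[OF t] unfolding has_vmv_integral_def by blast
qed simp

lemma exp_integral_process_solves:
  assumes Z: "exp_integral_process M F B K \<sigma> l Z"
  shows "langevin_solution M F l X initial_value Z"
  unfolding langevin_solution_def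
proof (intro conjI allI impI)
  show "initial_value \<in> borel_measurable (F 0)" by (rule initial_value_measurable)
  show mZ: "measurable_process M {0..} Z" using Z by (simp add: exp_integral_process_def)
  define V where "V s \<omega> = (if 0 \<le> s then Z s \<omega> else 0)" for s \<omega>
  have V [measurable]: "(\<lambda>(s, \<omega>). V s \<omega>) \<in> borel_measurable (borel \<Otimes>\<^sub>M M)"
    unfolding V_def by (rule measurable_process_extend[OF mZ])
  have ae: "AE \<omega> in M. AE s in lborel. 0 \<le> s \<longrightarrow> V s \<omega> = exp_integral s \<omega>"
    by (rule AE_AE_eq_of_modification[OF V exp_integral_measurable])
      (use exp_integral_process_modification[OF Z] in \<open>simp add: V_def\<close>)
  fix t :: real assume t: "0 \<le> t"
  show "AE \<omega> in M. set_integrable lborel {0..t} (\<lambda>s. Z s \<omega>) \<and>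
      Z t \<omega> = initial_value \<omega> + X t \<omega> - l * (LINT s:{0..t}|lborel. Z s \<omega>)"
    using ae exp_integral_process_modification[OF Z t] exp_Fubini(3)[OF t] AE_space
  proof eventually_elim
    case (elim \<omega>)
    note [measurable] = elim(4)
    have x: "(\<lambda>u. X u \<omega>) \<in> borel_measurable borel" by measurable
    have int: "integrable lborel (\<lambda>u. exp_weight l t u * X u \<omega>)"
      using elim(3) by (simp add: integral_exp_measure[OF l_pos])
    have z: "(\<lambda>s. X s \<omega> - (LINT u|lborel. exp_weight l s u * X u \<omega>)) = (\<lambda>s. exp_integral s \<omega>)"
      by (simp add: exp_integral_def integral_exp_measure[OF l_pos])
    note path = langevin_path[OF l_pos t x int, unfolded z]
    have eq: "X t \<omega> - (LINT u|lborel. exp_weight l t u * X u \<omega>) = exp_integral t \<omega>"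
      using z by (rule fun_cong)
    have [measurable]: "(\<lambda>s. exp_integral s \<omega>) \<in> borel_measurable borel" by measurable
    have VZ: "(\<lambda>s. indicator {0..t} s *\<^sub>R Z s \<omega>) = (\<lambda>s. indicator {0..t} s *\<^sub>R V s \<omega>)"
      by (auto simp: V_def fun_eq_iff indicator_def)
    have aes: "AE s in lborel. indicator {0..t} s *\<^sub>R exp_integral s \<omega> = indicator {0..t} s *\<^sub>R V s \<omega>"
      using elim(1) by eventually_elim (auto simp: indicator_def)
    have "set_integrable lborel {0..t} (\<lambda>s. Z s \<omega>)"
      unfolding set_integrable_def VZ
      by (rule integrable_cong_AE_imp[OF path(1)[unfolded set_integrable_def] _ aes]) measurable
    moreover have "(LINT s:{0..t}|lborel. Z s \<omega>) = (LINT s:{0..t}|lborel. exp_integral s \<omega>)"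
      unfolding set_lebesgue_integral_def VZ
      by (rule integral_cong_AE[OF _ _ aes[THEN AE_symmetric]]) measurable
    ultimately show ?case
      using path(2) elim(2) by (simp add: initial_value_eq eq)
  qed
qed

lemma langevin_solution_unique:
  assumes Y: "langevin_solution M F l X \<xi> Y" and Z: "langevin_solution M F l X \<xi> Z" and t: "0 \<le> t"
  shows "AE \<omega> in M. Y t \<omega> = Z t \<omega>"
proof -
  define D where "D s \<omega> = (if 0 \<le> s then Y s \<omega> else 0) - (if 0 \<le> s then Z s \<omega> else 0)" for s \<omega>
  have [measurable]: "(\<lambda>(s, \<omega>). if 0 \<le> s then Y s \<omega> else 0) \<in> borel_measurable (borel \<Otimes>\<^sub>M M)"
    "(\<lambda>(s, \<omega>). if 0 \<le> s then Z s \<omega> else 0) \<in> borel_measurable (borel \<Otimes>\<^sub>M M)"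
    using Y Z by (auto simp: langevin_solution_def intro: measurable_process_extend)
  have D [measurable]: "(\<lambda>(s, \<omega>). D s \<omega>) \<in> borel_measurable (borel \<Otimes>\<^sub>M M)"
    unfolding D_def split_beta' by measurable
  have D_eq: "AE \<omega> in M. set_integrable lborel {0..s} (\<lambda>u. D u \<omega>) \<and>
      D s \<omega> = - l * (LINT u:{0..s}|lborel. D u \<omega>)" if s: "0 \<le> s" for s
  proof -
    have "AE \<omega> in M. set_integrable lborel {0..s} (\<lambda>s. Y s \<omega>) \<and>
        Y s \<omega> = \<xi> \<omega> + X s \<omega> - l * (LINT s:{0..s}|lborel. Y s \<omega>)"
      "AE \<omega> in M. set_integrable lborel {0..s} (\<lambda>s. Z s \<omega>) \<and>
        Z s \<omega> = \<xi> \<omega> + X s \<omega> - l * (LINT s:{0..s}|lborel. Z s \<omega>)"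
      using Y Z s by (auto simp: langevin_solution_def)
    then show ?thesis
    proof eventually_elim
      case (elim \<omega>)
      have eq: "(\<lambda>u. indicator {0..s} u *\<^sub>R (Y u \<omega> - Z u \<omega>)) = (\<lambda>u. indicator {0..s} u *\<^sub>R D u \<omega>)"
        by (auto simp: D_def fun_eq_iff indicator_def)
      have "set_integrable lborel {0..s} (\<lambda>u. Y u \<omega> - Z u \<omega>)"
        "(LINT u:{0..s}|lborel. Y u \<omega> - Z u \<omega>)
          = (LINT u:{0..s}|lborel. Y u \<omega>) - (LINT u:{0..s}|lborel. Z u \<omega>)"
        using elim by auto
      then have *: "set_integrable lborel {0..s} (\<lambda>u. D u \<omega>)"
        "(LINT u:{0..s}|lborel. D u \<omega>) = (LINT u:{0..s}|lborel. Y u \<omega>) - (LINT u:{0..s}|lborel. Z u \<omega>)"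
        unfolding set_integrable_def set_lebesgue_integral_def eq by simp_all
      have "D s \<omega> = - l * (LINT u:{0..s}|lborel. Y u \<omega>) + l * (LINT u:{0..s}|lborel. Z u \<omega>)"
        using elim s by (simp add: D_def)
      then show ?case using * by (simp add: right_diff_distrib)
    qed
  qed
  define W where "W s \<omega> = - l * (LINT u:{0..s}|lborel. D u \<omega>)" for s \<omega>
  have W_eq: "W s \<omega> = - l * (LINT u|lborel. (if 0 \<le> u \<and> u \<le> s then D u \<omega> else 0))" for s \<omega>
    unfolding W_def set_lebesgue_integral_def
    by (intro arg_cong2[where f="(*)"] refl Bochner_Integration.integral_cong) (auto simp: indicator_def)
  have W: "(\<lambda>(s, \<omega>). W s \<omega>) \<in> borel_measurable (borel \<Otimes>\<^sub>M M)"
    unfolding W_eq by measurable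
  have DW: "AE \<omega> in M. AE s in lborel. 0 \<le> s \<longrightarrow> D s \<omega> = W s \<omega>"
  proof (rule AE_AE_eq_of_modification[OF D W])
    show "AE \<omega> in M. D s \<omega> = W s \<omega>" if "0 \<le> s" for s
      using D_eq[OF that] by eventually_elim (simp add: W_def)
  qed
  show ?thesis
    using D_eq[OF t] DW
  proof eventually_elim
    case (elim \<omega>)
    have "(LINT u:{0..t}|lborel. D u \<omega>) = 0"
      by (rule langevin_path_unique[OF t, where l=l]) (use elim in \<open>simp_all add: W_def\<close>)
    then have "D t \<omega> = 0" using elim by simp
    then show ?case using t by (simp add: D_def)
  qed
qed

end

theorem proposition4:
  fixes M :: "'a measure" and F :: "real \<Rightarrow> 'a measure"
    and B \<sigma> X :: "real \<Rightarrow> 'a \<Rightarrow> real" and K :: "real \<Rightarrow> real \<Rightarrow> real"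
    and l :: real and \<xi> :: "'a \<Rightarrow> real"
  assumes "two_sided_brownian_motion M F B"
    and "volterra_kernel K"
    and "volatility_process M F \<sigma>"
    and "vmv_process M F B K \<sigma> X"
    and "l > 0"
    and "\<forall>t\<ge>0. AE s in lborel. s < t \<longrightarrow>
          ((\<lambda>u. (langevin_integrand l t u - langevin_integrand l t s) * K u s) \<longlongrightarrow> 0) (at_right s)"
    and "\<forall>t\<ge>0. (\<integral>\<^sup>+s\<in>{..t}. ennreal (sqrt (LINT r:{..s}|lborel. (K s r)\<^sup>2))
                   \<partial>langevin_variation l t) < \<infinity>"
    and "\<xi> = (\<lambda>\<omega>. - l * (LINT u:{..0}|lborel. exp (l * u) * X u \<omega>))"
  shows "(AE \<omega> in M. set_integrable lborel {..0} (\<lambda>u. exp (l * u) * X u \<omega>)) \<and>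
         (\<exists>Z. exp_integral_process M F B K \<sigma> l Z) \<and>
         (\<forall>Z. exp_integral_process M F B K \<sigma> l Z \<longrightarrow>
            langevin_solution M F l X \<xi> Z \<and>
            (\<forall>Y. langevin_solution M F l X \<xi> Y \<longrightarrow> (\<forall>t\<ge>0. AE \<omega> in M. Y t \<omega> = Z t \<omega>)))"
proof -
  interpret two_sided_brownian_motion M F B by fact
  interpret volterra_kernel K by fact
  define C where "C = enn2real (SUP t. \<integral>\<^sup>+\<omega>. ennreal ((\<sigma> t \<omega>)\<^sup>2) \<partial>M)"
  have "(SUP t. \<integral>\<^sup>+\<omega>. ennreal ((\<sigma> t \<omega>)\<^sup>2) \<partial>M) < \<infinity>"
    using assms(3) by (simp add: volatility_process_def)
  then have C: "ennreal C = (SUP t. \<integral>\<^sup>+\<omega>. ennreal ((\<sigma> t \<omega>)\<^sup>2) \<partial>M)" by (simp add: C_def)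
  have "(\<integral>\<^sup>+\<omega>. ennreal ((\<sigma> t \<omega>)\<^sup>2) \<partial>M) \<le> ennreal C" for t
    unfolding C by (rule SUP_upper) simp
  then interpret langevin_setting M F B K \<sigma> X C l
    using assms(3-7) by unfold_locales (auto simp: C_def kernel_norm_def)
  have "\<xi> = initial_value" using assms(8) by (simp add: fun_eq_iff initial_value_def)
  then show ?thesis
    using initial_value_integrable exp_integral_process_exp_integral exp_integral_process_solves
      langevin_solution_unique by blast
qed

end
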